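(* Let $N=2$, $k>0$, $p>p_s:=k+1$, $f(u)=(1+u)^p$, and consider the problem $$-\Delta u=\lambda V_k(|x|)f(u)\ \text{ in } B_1,\qquad u>0\ \text{ in } B_1,\qquad u=0\ \text{ on }\partial B_1, \qquad (P)$$ with $\lambda>0$ and $V_k(r)=\dfrac{1}{r^2(-\log(r/e))^{2+k}}$. Then there exists $\beta^*\in(0,\infty]$ depending only on $p$ and $k$ such that the set of radial solutions $(\lambda,u)$ of $(P)$ is described as $$\{(\lambda(\beta),u(r,\alpha(\beta)));\ \beta\in(0,\beta^* )\}\quad\text{with}\quad \alpha(\beta)=\lambda(\beta)^{-\frac{1}{p-1}}\beta-1,$$ where $\alpha(\beta):=\lVert u(\cdot,\alpha(\beta))\rVert_{L^\infty(B_1)}=u(0,\alpha(\beta))$ (so the radial solution with parameter $\beta$ is the one satisfying $\lambda^{1/(p-1)}(u(0)+1)=\beta$). Every radial solution $u$ belongs to $H^1_0(B_1)$ and satisfies $(P)$ in the weak sense. Moreover, $\mathcal{C}:=\{(\lambda(\beta),\alpha(\beta));\ \beta\in(0,\beta^* )\}$ is an unbounded analytic curve emanating from $(0,0)$, and there exists $0<\lambda^*<\infty$ such that $\lambda(\beta)\le\lambda^*$ for all $\beta\in(0,\beta^* )$. In addition, with $p_c:=2k+1$, $\beta^*=\infty$ if $p\ge p_c$, and $\beta^*<\infty$ if $p_s<p<p_c$.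
   Context: $B_1\subset\mathbb{R}^2$ is the open unit ball, $r=|x|$. A pair $(\lambda,u)$ with $\lambda>0$ is a radial solution of $(P)$ if $u$ is radial, continuous on $[0,1]$ as a function of $r$, of class $C^2$ on $(0,1]$, and satisfies $(P)$ (the equation holding pointwise for $0<r<1$). "Analytic curve emanating from $(0,0)$" means that $\beta\mapsto(\lambda(\beta),\alpha(\beta))$ is real analytic and $(\lambda(\beta),\alpha(\beta))\to(0,0)$ as $\beta\to0^+$. *)

theory Defs
  imports "HOL-Analysis.Analysis" "HOL-Probability.Essential_Supremum"
begin

section \<open>Real analyticity and smoothness\<close>

text \<open>Only complex analyticity is available in the library; this is the power series
  definition for a function of one real variable.\<close>

definition real_analytic_on :: "(real \<Rightarrow> 'a::real_normed_vector) \<Rightarrow> real set \<Rightarrow> bool" where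
  "real_analytic_on f S \<longleftrightarrow>
     (\<forall>x\<in>S. \<exists>r>0. \<exists>a :: nat \<Rightarrow> 'a. \<forall>y. \<bar>y - x\<bar> < r \<longrightarrow> (\<lambda>n. (y - x) ^ n *\<^sub>R a n) sums f y)"

definition C2_on :: "real set \<Rightarrow> (real \<Rightarrow> real) \<Rightarrow> bool" where
  "C2_on S w \<longleftrightarrow> (\<exists>w' w''.
     (\<forall>r\<in>S. (w has_real_derivative w' r) (at r within S)) \<and>
     (\<forall>r\<in>S. (w' has_real_derivative w'' r) (at r within S)) \<and>
     continuous_on S w'')"

primrec Ck :: "nat \<Rightarrow> ('a::euclidean_space \<Rightarrow> real) \<Rightarrow> bool" where
  "Ck 0 f \<longleftrightarrow> continuous_on UNIV f"
| "Ck (Suc m) f \<longleftrightarrow> f differentiable_on UNIV \<and>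
     (\<forall>b\<in>Basis. Ck m (\<lambda>x. frechet_derivative f (at x) b))"

definition grad :: "('a::euclidean_space \<Rightarrow> real) \<Rightarrow> 'a \<Rightarrow> 'a" where
  "grad f x = (\<Sum>b\<in>Basis. frechet_derivative f (at x) b *\<^sub>R b)"

definition laplacian :: "('a::euclidean_space \<Rightarrow> real) \<Rightarrow> 'a \<Rightarrow> real" where
  "laplacian f x = (\<Sum>b\<in>Basis. deriv (deriv (\<lambda>t. f (x + t *\<^sub>R b))) 0)"


section \<open>Function spaces\<close>

text \<open>The space \<open>C\<^sub>c\<^sup>\<infinity>(\<Omega>)\<close>, its elements being extended by zero to the whole space.\<close>

definition test_function :: "'a::euclidean_space set \<Rightarrow> ('a \<Rightarrow> real) \<Rightarrow> bool" where
  "test_function \<Omega> \<phi> \<longleftrightarrow> (\<forall>m. Ck m \<phi>) \<and>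
     compact (closure {x. \<phi> x \<noteq> 0}) \<and> closure {x. \<phi> x \<noteq> 0} \<subseteq> \<Omega>"

definition L2_on :: "'a::euclidean_space set \<Rightarrow> ('a \<Rightarrow> 'b::euclidean_space) \<Rightarrow> bool" where
  "L2_on \<Omega> f \<longleftrightarrow> f \<in> borel_measurable (lebesgue_on \<Omega>) \<and>
     integrable (lebesgue_on \<Omega>) (\<lambda>x. (norm (f x))\<^sup>2)"

definition Linf_norm :: "'a::euclidean_space set \<Rightarrow> ('a \<Rightarrow> real) \<Rightarrow> ereal" where
  "Linf_norm \<Omega> f = esssup (lebesgue_on \<Omega>) (\<lambda>x. ereal \<bar>f x\<bar>)"

text \<open>\<open>H1_grad \<Omega> u g\<close>: \<open>u \<in> H\<^sup>1(\<Omega>)\<close> and \<open>g\<close> is (a representative of) its weak gradient.\<close>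

definition H1_grad :: "'a::euclidean_space set \<Rightarrow> ('a \<Rightarrow> real) \<Rightarrow> ('a \<Rightarrow> 'a) \<Rightarrow> bool" where
  "H1_grad \<Omega> u g \<longleftrightarrow> L2_on \<Omega> u \<and> L2_on \<Omega> g \<and>
     (\<forall>\<phi>. test_function \<Omega> \<phi> \<longrightarrow> (\<forall>b\<in>Basis.
        (LINT x|lebesgue_on \<Omega>. u x * (grad \<phi> x \<bullet> b)) =
        - (LINT x|lebesgue_on \<Omega>. (g x \<bullet> b) * \<phi> x)))"

text \<open>\<open>H\<^sub>0\<^sup>1(\<Omega>)\<close> is the closure of \<open>C\<^sub>c\<^sup>\<infinity>(\<Omega>)\<close> in the norm of \<open>H\<^sup>1(\<Omega>)\<close>.\<close>

definition H10_grad :: "'a::euclidean_space set \<Rightarrow> ('a \<Rightarrow> real) \<Rightarrow> ('a \<Rightarrow> 'a) \<Rightarrow> bool" where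
  "H10_grad \<Omega> u g \<longleftrightarrow> H1_grad \<Omega> u g \<and>
     (\<exists>\<phi> :: nat \<Rightarrow> 'a \<Rightarrow> real. (\<forall>n. test_function \<Omega> (\<phi> n)) \<and>
        (\<lambda>n. LINT x|lebesgue_on \<Omega>. (u x - \<phi> n x)\<^sup>2 + (norm (g x - grad (\<phi> n) x))\<^sup>2)
          \<longlonglongrightarrow> 0)"

definition H10 :: "'a::euclidean_space set \<Rightarrow> ('a \<Rightarrow> real) set" where
  "H10 \<Omega> = {u. \<exists>g. H10_grad \<Omega> u g}"


section \<open>The problem\<close>

type_synonym plane = "real ^ 2"

abbreviation B1 :: "plane set" where
  "B1 \<equiv> ball 0 1"

definition Vk :: "real \<Rightarrow> real \<Rightarrow> real" where
  "Vk k r = 1 / (r\<^sup>2 * (- ln (r / exp 1)) powr (2 + k))"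

definition nonlin :: "real \<Rightarrow> real \<Rightarrow> real" where
  "nonlin p u = (1 + u) powr p"

definition p_s :: "real \<Rightarrow> real" where
  "p_s k = k + 1"

definition p_c :: "real \<Rightarrow> real" where
  "p_c k = 2 * k + 1"

text \<open>A solution is a function on the closed unit disc. It is represented by its extension by
  zero to the whole plane, so that solutions are equal iff they agree on the closed disc.
  The equation is imposed away from the origin, where \<open>Vk k\<close> is singular.\<close>

definition radial_solution :: "real \<Rightarrow> real \<Rightarrow> real \<Rightarrow> (plane \<Rightarrow> real) \<Rightarrow> bool" where
  "radial_solution k p l u \<longleftrightarrow>
     l > 0 \<and>
     (\<exists>w. (\<forall>x\<in>cball 0 1. u x = w (norm x)) \<and> continuous_on {0..1} w \<and> C2_on {0<..1} w) \<and>
     (\<forall>x\<in>B1 - {0}. - laplacian u x = l * Vk k (norm x) * nonlin p (u x)) \<and>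
     (\<forall>x\<in>B1. u x > 0) \<and>
     (\<forall>x\<in>sphere 0 1. u x = 0) \<and>
     (\<forall>x. x \<notin> cball 0 1 \<longrightarrow> u x = 0)"

definition radial_solutions :: "real \<Rightarrow> real \<Rightarrow> (real \<times> (plane \<Rightarrow> real)) set" where
  "radial_solutions k p = {(l, u). radial_solution k p l u}"

text \<open>The equation tested against all of \<open>H\<^sub>0\<^sup>1\<close>. Integrability of the right-hand side is
  part of the definition, since the integral of a non-integrable function is \<open>0\<close>.\<close>

definition weak_solution :: "real \<Rightarrow> real \<Rightarrow> real \<Rightarrow> (plane \<Rightarrow> real) \<Rightarrow> bool" where
  "weak_solution k p l u \<longleftrightarrow>
     (\<exists>g. H10_grad B1 u g \<and>
        (\<forall>\<phi> h. H10_grad B1 \<phi> h \<longrightarrow>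
           integrable (lebesgue_on B1) (\<lambda>x. Vk k (norm x) * nonlin p (u x) * \<phi> x) \<and>
           (LINT x|lebesgue_on B1. g x \<bullet> h x) =
             l * (LINT x|lebesgue_on B1. Vk k (norm x) * nonlin p (u x) * \<phi> x)))"

end

theory Submission
  imports Defs
begin

text \<open>
  Put \<open>q = 1 / k\<close>. In the variable \<open>x = (1 - ln r) powr -k\<close> the radial equation reads
  \<open>(x powr (1 + q) * w')' = - q\<^sup>2 \<lambda> x powr q (1 + w) powr p\<close>. It is uniquely solvable from \<open>x = 0\<close> and scales, so
  there is one profile \<open>W\<close> with \<open>W 0 = 1\<close> of which every radial solution is a rescaled piece:
  with \<open>X = \<beta> powr (p - 1)\<close> one has \<open>1 + u = W (X x) / W X\<close>, \<open>\<lambda> = X * W X powr (p - 1)\<close> and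
  \<open>\<alpha> = 1 / W X - 1\<close>, where \<open>X\<close> runs over the interval on which \<open>W\<close> is positive. As a function of
  \<open>t = x powr -q\<close> the profile is concave, which bounds \<open>\<lambda>\<close>. Whether \<open>W\<close> has a zero is decided by
  a Pohozaev functional that vanishes at \<open>x = 0\<close> and whose derivative has the sign of
  \<open>2 * k + 1 - p\<close>.

  In \<open>\<beta>\<close>, the functions \<open>\<lambda>\<close> and \<open>\<alpha> + 1\<close> are components of a solution of a quadratic system, and the
  Taylor coefficients of such solutions grow at most geometrically.

  The weight \<open>V\<^sub>k\<close> is the divergence of a square integrable field. This gives a bound of
  \<open>\<integral> V\<^sub>k \<bar>\<phi>\<bar>\<close> by the norm of \<open>grad \<phi>\<close> in \<open>L\<^sup>2\<close>, by which the weak equation passes from test functions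
  to their \<open>H\<^sup>1\<close> limits. A radial solution is the limit of its smooth truncations, which are constant
  near the origin and zero near the boundary.
\<close>

section \<open>Analyticity of solutions of quadratic systems\<close>

text \<open>Under \<open>x = s^2\<close> the equation of the profile becomes the Lane-Emden equation
  in the fractional dimension \<open>N = 2 + 2 * q = 2 + 2 / k\<close>. There
  \<open>N / (N - 2) = k + 1\<close>, and the Sobolev exponent \<open>(N + 2) / (N - 2)\<close> is
  \<open>2 * k + 1\<close>: this is the origin of \<open>p_s\<close> and \<open>p_c\<close>, and the
  reason why a Pohozaev argument changes sign at \<open>2 * k + 1\<close>. The parameter
  \<open>X\<close> is the scaling invariant \<open>\<lambda> * (1 + u 0) powr (p - 1)\<close>. The
  obstacle throughout is the origin. The coefficient \<open>x powr (- 1 - q)\<close> is singular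
  there, and a solution is only assumed continuous at \<open>r = 0\<close>, so no initial slope is
  given. In the variable \<open>t = x powr -q\<close> the origin lies at infinity, where a bounded
  solution cannot keep a slope bounded away from 0; hence the flux tends to 0 and the initial value
  problem is well posed. For the same reason the divergence identities are first proved with a
  cut-off near the origin, and then passed to the limit with majorants built from the weight
  itself.\<close>

text \<open>The Taylor coefficients at \<open>t\<close> of a solution of \<open>x' = B x x\<close>.\<close>

fun quad_coeff :: "('a \<Rightarrow> 'a \<Rightarrow> 'a) \<Rightarrow> (real \<Rightarrow> 'a::real_normed_vector) \<Rightarrow> nat \<Rightarrow> real \<Rightarrow> 'a" where
  "quad_coeff B x 0 t = x t"
| "quad_coeff B x (Suc n) t =
     (\<Sum>i\<le>n. B (quad_coeff B x i t) (quad_coeff B x (n - i) t)) /\<^sub>R real (Suc n)"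

declare quad_coeff.simps(2) [simp del]

text \<open>The product rule gives two sums over the Cauchy product of order \<open>Suc m\<close>,
  weighted by \<open>Suc m - i\<close> and, after an index shift, by \<open>i\<close>. The weights
  add up to \<open>Suc m\<close>, which cancels the denominator in the definition of the
  coefficient.\<close>

lemma quad_coeff_has_vector_derivative:
  fixes x :: "real \<Rightarrow> 'a::real_normed_vector"
  assumes B: "bounded_bilinear B"
    and x: "(x has_vector_derivative B (x t) (x t)) (at t)"
  shows "(quad_coeff B x n has_vector_derivative real (Suc n) *\<^sub>R quad_coeff B x (Suc n) t) (at t)"
proof (induction n rule: less_induct)
  case (less n)
  show ?case
  proof (cases n)
    case 0
    have "quad_coeff B x 0 = x" by auto
    then show ?thesis using x 0 by (simp add: quad_coeff.simps(2))
  next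
    case (Suc m)
    interpret bounded_bilinear B by fact
    let ?d = "\<lambda>i. quad_coeff B x i t"
    have eq: "quad_coeff B x n =
        (\<lambda>t. (\<Sum>i\<le>m. B (quad_coeff B x i t) (quad_coeff B x (m - i) t)) /\<^sub>R real (Suc m))"
      using Suc by (auto simp: quad_coeff.simps(2))
    have 1: "(quad_coeff B x n has_vector_derivative
       (\<Sum>i\<le>m. B (?d i) (real (Suc (m - i)) *\<^sub>R ?d (Suc (m - i))) +
                B (real (Suc i) *\<^sub>R ?d (Suc i)) (?d (m - i))) /\<^sub>R real (Suc m)) (at t)"
      unfolding eq
      by (intro bounded_linear.has_vector_derivative[OF bounded_linear_scaleR_right]
          has_vector_derivative_sum has_vector_derivative less) (auto simp: Suc)
    have "(\<Sum>i\<le>m. B (?d i) (real (Suc (m - i)) *\<^sub>R ?d (Suc (m - i))) +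
                B (real (Suc i) *\<^sub>R ?d (Suc i)) (?d (m - i)))
      = (\<Sum>i\<le>m. real (Suc m - i) *\<^sub>R B (?d i) (?d (Suc m - i))) +
        (\<Sum>i\<le>m. real (Suc i) *\<^sub>R B (?d (Suc i)) (?d (Suc m - Suc i)))"
      unfolding sum.distrib
      by (intro arg_cong2[where f="(+)"] sum.cong) (auto simp: scaleR_left scaleR_right Suc_diff_le)
    \<comment> \<open>The summand with \<open>i = Suc m\<close> has weight 0, so the range can be
      extended.\<close>
    also have "(\<Sum>i\<le>m. real (Suc m - i) *\<^sub>R B (?d i) (?d (Suc m - i)))
       = (\<Sum>i\<le>Suc m. real (Suc m - i) *\<^sub>R B (?d i) (?d (Suc m - i)))" by simp
    also have "(\<Sum>i\<le>m. real (Suc i) *\<^sub>R B (?d (Suc i)) (?d (Suc m - Suc i)))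
       = (\<Sum>i\<le>Suc m. real i *\<^sub>R B (?d i) (?d (Suc m - i)))"
      by (subst sum.atMost_Suc_shift) simp
    also have "(\<Sum>i\<le>Suc m. real (Suc m - i) *\<^sub>R B (?d i) (?d (Suc m - i))) +
       (\<Sum>i\<le>Suc m. real i *\<^sub>R B (?d i) (?d (Suc m - i)))
       = real (Suc m) *\<^sub>R (\<Sum>i\<le>Suc m. B (?d i) (?d (Suc m - i)))"
      unfolding sum.distrib[symmetric] scaleR_sum_right
      by (intro sum.cong refl) (simp add: scaleR_add_left[symmetric] of_nat_diff)
    finally have "(\<Sum>i\<le>m. B (?d i) (real (Suc (m - i)) *\<^sub>R ?d (Suc (m - i))) +
                B (real (Suc i) *\<^sub>R ?d (Suc i)) (?d (m - i))) /\<^sub>R real (Suc m) =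
        (\<Sum>i\<le>n. B (?d i) (?d (n - i)))"
      using Suc by simp
    also have "\<dots> = real (Suc n) *\<^sub>R ?d (Suc n)"
      by (simp add: quad_coeff.simps(2)[of _ _ n] del: of_nat_Suc)
    finally show ?thesis using 1 by simp
  qed
qed

text \<open>The sum has \<open>Suc m\<close> terms with the same bound, and the division by
  \<open>Suc m\<close> cancels their number. The bounds are the Taylor coefficients of
  \<open>M / (1 - K * M * t)\<close>, which solves the scalar majorant equation
  \<open>y' = K * y^2\<close>, \<open>y 0 = M\<close>.\<close>

lemma norm_quad_coeff_le:
  fixes x :: "real \<Rightarrow> 'a::real_normed_vector"
  assumes K: "\<And>a b. norm (B a b) \<le> norm a * norm b * K" and "K \<ge> 0" and x: "norm (x t) \<le> M"
  shows "norm (quad_coeff B x n t) \<le> M * (K * M) ^ n"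
proof (induction n rule: less_induct)
  case (less n)
  have M: "M \<ge> 0" using x norm_ge_zero order_trans by blast
  show ?case
  proof (cases n)
    case 0 then show ?thesis using x by simp
  next
    case (Suc m)
    have "norm (\<Sum>i\<le>m. B (quad_coeff B x i t) (quad_coeff B x (m - i) t)) \<le>
       (\<Sum>i\<le>m. M * (K * M) ^ m * M * K)"
    proof (rule sum_norm_le)
      fix i assume i: "i \<in> {..m}"
      have "norm (B (quad_coeff B x i t) (quad_coeff B x (m - i) t)) \<le>
        norm (quad_coeff B x i t) * norm (quad_coeff B x (m - i) t) * K" by (rule K)
      also have "\<dots> \<le> (M * (K * M) ^ i) * (M * (K * M) ^ (m - i)) * K"
        using i Suc M assms(2) by (intro mult_right_mono mult_mono less) auto
      also have "\<dots> = M * ((K * M) ^ i * (K * M) ^ (m - i)) * M * K" by (simp add: algebra_simps)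
      also have "(K * M) ^ i * (K * M) ^ (m - i) = (K * M) ^ m"
        using i by (simp add: power_add[symmetric])
      finally show "norm (B (quad_coeff B x i t) (quad_coeff B x (m - i) t)) \<le> M * (K * M) ^ m * M * K" .
    qed
    also have "\<dots> = real (Suc m) * (M * (K * M) ^ Suc m)" by (simp add: algebra_simps)
    finally show ?thesis using Suc by (simp add: quad_coeff.simps(2) field_simps)
  qed
qed

text \<open>The Taylor remainder of order \<open>N\<close> is the coefficient of order
  \<open>N\<close> at an intermediate point, and the bound on the coefficients holds with one
  constant \<open>M\<close> at all points of a compact ball around the centre.\<close>

proposition real_analytic_quadratic_ODE:
  fixes x :: "real \<Rightarrow> 'a::euclidean_space"
  assumes B: "bounded_bilinear B" and "open S"
    and x: "\<And>t. t \<in> S \<Longrightarrow> (x has_vector_derivative B (x t) (x t)) (at t)"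
  shows "real_analytic_on x S"
  unfolding real_analytic_on_def
proof
  fix t0 assume "t0 \<in> S"
  then obtain e where e: "e > 0" "cball t0 e \<subseteq> S" using \<open>open S\<close> open_contains_cball by blast
  obtain K where K: "K > 0" "\<And>a b. norm (B a b) \<le> norm a * norm b * K"
    using bounded_bilinear.pos_bounded[OF B] by metis
  have "continuous_on (cball t0 e) x"
    using e x by (intro continuous_at_imp_continuous_on) (meson has_vector_derivative_continuous subsetD)
  then have "bounded (x ` cball t0 e)" by (intro compact_imp_bounded compact_continuous_image) auto
  then obtain M where M: "M > 0" "\<And>t. t \<in> cball t0 e \<Longrightarrow> norm (x t) \<le> M"
    by (metis bounded_pos image_eqI)
  let ?d = "\<lambda>n. quad_coeff B x n"
  have bd: "norm (?d n t) \<le> M * (K * M) ^ n" if "t \<in> cball t0 e" for n t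
    using norm_quad_coeff_le[OF K(2)] K(1) M(2)[OF that] by (simp add: less_imp_le)
  \<comment> \<open>With this radius \<open>K * M * \<bar>z\<bar> \<le> 1/2\<close>, so the
    remainder is at most \<open>M / 2^N\<close>; the bound by \<open>e\<close> keeps the
    intermediate point in the ball.\<close>
  define r where "r = min e (1 / (2 * K * M))"
  have r: "r > 0" "r \<le> e" "r * (K * M) \<le> 1/2"
  proof -
    show "r > 0" "r \<le> e" using e K M by (auto simp: r_def)
    have "r * (K * M) \<le> 1 / (2 * K * M) * (K * M)"
      using K M by (intro mult_right_mono) (auto simp: r_def)
    then show "r * (K * M) \<le> 1/2" using K M by simp
  qed
  show "\<exists>r>0. \<exists>a :: nat \<Rightarrow> 'a. \<forall>y. \<bar>y - t0\<bar> < r \<longrightarrow> (\<lambda>n. (y - t0) ^ n *\<^sub>R a n) sums x y"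
  proof (intro exI conjI allI impI)
    show "r > 0" by fact
    fix y assume y: "\<bar>y - t0\<bar> < r"
    define z where "z = y - t0"
    have z: "\<bar>z\<bar> \<le> e" "\<bar>z\<bar> * (K * M) \<le> 1/2"
    proof -
      show "\<bar>z\<bar> \<le> e" using y r by (simp add: z_def)
      have "\<bar>z\<bar> * (K * M) \<le> r * (K * M)"
        using y K M by (intro mult_right_mono) (auto simp: z_def)
      then show "\<bar>z\<bar> * (K * M) \<le> 1/2" using r by simp
    qed
    have "(\<lambda>N. \<Sum>n<N. z ^ n *\<^sub>R ?d n t0) \<longlonglongrightarrow> x y"
      \<comment> \<open>The Lagrange form of the remainder concerns real functions, so each
        coordinate has its own intermediate point.\<close>
      unfolding tendsto_componentwise_iff[where l="x y"]
    proof
      fix b :: 'a assume b: "b \<in> Basis"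
      \<comment> \<open>The factorial turns the Taylor coefficient into the derivative of order
        \<open>m\<close>.\<close>
      define diff where "diff = (\<lambda>m s. fact m * (?d m (t0 + s) \<bullet> b))"
      have D: "DERIV (diff m) s :> diff (Suc m) s" if "\<bar>s\<bar> \<le> \<bar>z\<bar>" for m s
      proof -
        have S: "t0 + s \<in> S" using e z that by (auto simp: dist_norm subset_iff)
        have "((\<lambda>s. ?d m (t0 + s)) has_vector_derivative
            real (Suc m) *\<^sub>R ?d (Suc m) (t0 + s)) (at s)"
        proof -
          have "((\<lambda>s. t0 + s) has_vector_derivative 1) (at s)"
            by (auto intro!: derivative_eq_intros
                simp: has_real_derivative_iff_has_vector_derivative[symmetric])
          from vector_diff_chain_at[OF this quad_coeff_has_vector_derivative[OF B x[OF S], of m]]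
          show ?thesis by (simp add: o_def)
        qed
        then have "((\<lambda>s. ?d m (t0 + s) \<bullet> b) has_vector_derivative
            (real (Suc m) *\<^sub>R ?d (Suc m) (t0 + s)) \<bullet> b) (at s)"
          by (rule bounded_linear.has_vector_derivative[OF bounded_linear_inner_left])
        then show ?thesis unfolding diff_def has_real_derivative_iff_has_vector_derivative[symmetric]
          by (auto intro!: derivative_eq_intros)
      qed
      have rem: "norm ((\<Sum>n<N. z ^ n *\<^sub>R ?d n t0) \<bullet> b - x y \<bullet> b) \<le> M * (1/2) ^ N" for N
      proof -
        have "\<exists>s. \<bar>s\<bar> \<le> \<bar>z\<bar> \<and> diff 0 z = (\<Sum>m<N. (diff m 0 / fact m) * z ^ m) + (diff N s / fact N) * z ^ N"
          by (rule Maclaurin_bi_le) (use D in auto)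
        then obtain s where s: "\<bar>s\<bar> \<le> \<bar>z\<bar>"
          "x y \<bullet> b = (\<Sum>m<N. (?d m t0 \<bullet> b) * z ^ m) + (?d N (t0 + s) \<bullet> b) * z ^ N"
          by (auto simp: diff_def z_def)
        have "norm ((\<Sum>n<N. z ^ n *\<^sub>R ?d n t0) \<bullet> b - x y \<bullet> b) = \<bar>?d N (t0 + s) \<bullet> b\<bar> * \<bar>z\<bar> ^ N"
          unfolding s(2) by (simp add: inner_sum_left mult.commute abs_mult power_abs)
        also have "\<dots> \<le> (M * (K * M) ^ N) * \<bar>z\<bar> ^ N"
          using Basis_le_norm[OF b, of "?d N (t0+s)"] bd[of "t0 + s" N] s z
          by (intro mult_right_mono) (auto simp: dist_norm)
        also have "\<dots> = M * (\<bar>z\<bar> * (K * M)) ^ N" by (simp add: power_mult_distrib algebra_simps)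
        also have "\<dots> \<le> M * (1/2) ^ N" using M z K by (intro mult_left_mono power_mono) auto
        finally show ?thesis .
      qed
      have lim: "(\<lambda>N. M * (1/2) ^ N) \<longlonglongrightarrow> 0"
        by (intro tendsto_mult_right_zero LIMSEQ_power_zero) auto
      have "(\<lambda>N. (\<Sum>n<N. z ^ n *\<^sub>R ?d n t0) \<bullet> b - x y \<bullet> b) \<longlonglongrightarrow> 0"
        by (rule tendsto_0_le[OF lim, where K=1]) (use rem M in \<open>auto intro!: always_eventually\<close>)
      then show "(\<lambda>N. (\<Sum>n<N. z ^ n *\<^sub>R ?d n t0) \<bullet> b) \<longlonglongrightarrow> x y \<bullet> b" 
        by (simp add: LIM_zero_iff)
    qed
    then show "(\<lambda>n. (y - t0) ^ n *\<^sub>R ?d n t0) sums x y" by (simp add: sums_def z_def)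
  qed
qed

lemma real_analytic_on_bounded_linear:
  assumes "bounded_linear L" and "real_analytic_on f S"
  shows "real_analytic_on (\<lambda>x. L (f x)) S"
proof -
  interpret bounded_linear L by fact
  show ?thesis
    unfolding real_analytic_on_def
  proof
    fix x assume "x \<in> S"
    then obtain r a where r: "r > 0" "\<And>y. \<bar>y - x\<bar> < r \<Longrightarrow> (\<lambda>n. (y - x) ^ n *\<^sub>R a n) sums f y"
      using assms(2) unfolding real_analytic_on_def by meson
    show "\<exists>r>0. \<exists>a. \<forall>y. \<bar>y - x\<bar> < r \<longrightarrow> (\<lambda>n. (y - x) ^ n *\<^sub>R a n) sums L (f y)"
    proof (intro exI conjI allI impI)
      fix y assume "\<bar>y - x\<bar> < r"
      from sums[OF r(2)[OF this]] show "(\<lambda>n. (y - x) ^ n *\<^sub>R L (a n)) sums L (f y)"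
        by (simp add: scaleR)
    qed (use r in auto)
  qed
qed

lemma real_analytic_on_diff_const:
  fixes c :: "'a::real_normed_vector"
  assumes "real_analytic_on f S"
  shows "real_analytic_on (\<lambda>x. f x - c) S"
  unfolding real_analytic_on_def
proof
  fix x assume "x \<in> S"
  then obtain r a where r: "r > 0" "\<And>y. \<bar>y - x\<bar> < r \<Longrightarrow> (\<lambda>n. (y - x) ^ n *\<^sub>R a n) sums f y"
    using assms unfolding real_analytic_on_def by meson
  show "\<exists>r>0. \<exists>a. \<forall>y. \<bar>y - x\<bar> < r \<longrightarrow> (\<lambda>n. (y - x) ^ n *\<^sub>R a n) sums (f y - c)"
  proof (intro exI conjI allI impI)
    fix y assume "\<bar>y - x\<bar> < r"
    moreover have "(\<lambda>n. if n = 0 then c else 0) sums c" using sums_single[of 0 "\<lambda>_. c"] by simp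
    ultimately have "(\<lambda>n. (y - x) ^ n *\<^sub>R a n - (if n = 0 then c else 0)) sums (f y - c)"
      using r(2) by (intro sums_diff)
    then show "(\<lambda>n. (y - x) ^ n *\<^sub>R (a n - (if n = 0 then c else 0))) sums (f y - c)"
      by (rule sums_cong[THEN iffD1, rotated]) (auto simp: scaleR_diff_right)
  qed (use r in auto)
qed

section \<open>The profile of the Emden--Fowler equation\<close>

text \<open>A comparison that asks for a limit at 0 instead of a derivative there, because the
  powers of \<open>x\<close> in the equations below are singular at 0.\<close>

lemma nonneg_deriv_ge_limit:
  fixes f :: "real \<Rightarrow> real"
  assumes d: "\<And>x. 0 < x \<Longrightarrow> x < b \<Longrightarrow> (f has_real_derivative f' x) (at x)"
    and nn: "\<And>x. 0 < x \<Longrightarrow> x < b \<Longrightarrow> 0 \<le> f' x"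
    and lim: "(f \<longlongrightarrow> L) (at_right 0)" and x: "0 < x" "x < b"
  shows "L \<le> f x"
proof (rule tendsto_upperbound[OF lim])
  show "\<forall>\<^sub>F y in at_right 0. f y \<le> f x"
    unfolding eventually_at_right_field
  proof (intro exI conjI allI impI)
    fix y assume y: "0 < y" "y < x"
    show "f y \<le> f x"
    proof (rule DERIV_nonneg_imp_nondecreasing[of y x f])
      show "y \<le> x" using y by simp
      fix z assume "y \<le> z" "z \<le> x"
      then show "\<exists>w. (f has_real_derivative w) (at z) \<and> 0 \<le> w"
        using d[of z] nn[of z] x y by auto
    qed
  qed (use x in auto)
qed auto

text \<open>The cut-off makes the nonlinearity globally Lipschitz; it is inactive on solutions with values
  in \<open>[0,1]\<close>.\<close>

definition cut_powr :: "real \<Rightarrow> real \<Rightarrow> real" where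
  "cut_powr p v = (min 1 (max 0 v)) powr p"

lemma cut_powr_nonneg [simp]: "0 \<le> cut_powr p v"
  by (simp add: cut_powr_def)

lemma cut_powr_le_1: "p \<ge> 0 \<Longrightarrow> cut_powr p v \<le> 1"
  unfolding cut_powr_def by (intro powr_le1) auto

lemma cut_powr_eq: "0 \<le> v \<Longrightarrow> v \<le> 1 \<Longrightarrow> cut_powr p v = v powr p"
  by (simp add: cut_powr_def)

lemma continuous_on_cut_powr:
  "p > 0 \<Longrightarrow> continuous_on S f \<Longrightarrow> continuous_on S (\<lambda>x. cut_powr p (f x))"
  unfolding cut_powr_def by (intro continuous_on_powr' continuous_intros) auto

lemma powr_lipschitz_unit:
  fixes a b p :: real
  assumes "0 \<le> a" "a < b" "b \<le> 1" "p \<ge> 1"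
  shows "b powr p - a powr p \<le> p * (b - a)"
proof -
  have "\<exists>l z. a < z \<and> z < b \<and> ((\<lambda>x. x powr p) has_real_derivative l) (at z) \<and>
      b powr p - a powr p = (b - a) * l"
  proof (rule MVT)
    show "continuous_on {a..b} (\<lambda>x. x powr p)"
      using assms by (intro continuous_on_powr' continuous_intros) auto
    fix x assume "a < x"
    then have "((\<lambda>x. x powr p) has_real_derivative p * x powr (p - 1)) (at x)"
      using assms by (auto intro!: derivative_eq_intros)
    then show "(\<lambda>x. x powr p) differentiable (at x)" using real_differentiable_def by blast
  qed fact
  then obtain l z where z: "a < z" "z < b" "((\<lambda>x. x powr p) has_real_derivative l) (at z)"
      "b powr p - a powr p = (b - a) * l" by blast
  have "((\<lambda>x. x powr p) has_real_derivative p * z powr (p - 1)) (at z)"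
    using z assms by (auto intro!: derivative_eq_intros)
  then have "l = p * z powr (p - 1)" using z DERIV_unique by blast
  moreover have "z powr (p - 1) \<le> 1" using z assms by (intro powr_le1) auto
  ultimately have "l \<le> p" using assms mult_left_mono[of "z powr (p-1)" 1 p] by simp
  then show ?thesis using z assms mult_left_mono[of l p "b - a"] by (simp add: mult.commute)
qed

lemma cut_powr_lipschitz:
  assumes "p \<ge> 1"
  shows "\<bar>cut_powr p a - cut_powr p b\<bar> \<le> p * \<bar>a - b\<bar>"
proof -
  have *: "\<bar>cut_powr p a - cut_powr p b\<bar> \<le> p * \<bar>a - b\<bar>" if "a \<le> b" for a b
  proof (cases "min 1 (max 0 a) = min 1 (max 0 b)")
    case False
    then have "min 1 (max 0 a) < min 1 (max 0 b)" using that by linarith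
    then have "cut_powr p b - cut_powr p a \<le> p * (min 1 (max 0 b) - min 1 (max 0 a))"
      unfolding cut_powr_def using assms by (intro powr_lipschitz_unit) auto
    also have "\<dots> \<le> p * \<bar>a - b\<bar>" using that assms by (intro mult_left_mono) auto
    finally have "cut_powr p b - cut_powr p a \<le> p * \<bar>a - b\<bar>" .
    moreover have "cut_powr p a \<le> cut_powr p b"
      unfolding cut_powr_def using that assms by (intro powr_mono2) auto
    ultimately show ?thesis by simp
  qed (use assms in \<open>simp add: cut_powr_def\<close>)
  show ?thesis using *[of a b] *[of b a] by (cases "a \<le> b") (auto simp: abs_minus_commute)
qed

section \<open>Existence of the profile by a contraction in a weighted norm\<close>

locale emden =
  fixes k p q :: real
  assumes k: "k > 0" and p: "p > 1" and q_def: "q = 1 / k"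
begin

lemma q: "q > 0" using k q_def by simp

lemma kq: "k * q = 1" using k q_def by simp

abbreviation g :: "real \<Rightarrow> real" where "g \<equiv> cut_powr p"

text \<open>Banach's theorem in the weight \<open>exp (c * x)\<close>; for \<open>c = 2 * q * p\<close> the contraction factor is
  \<open>1 / 2\<close>. The profile is extended to negative arguments by a constant only to have a type of bounded
  continuous functions at hand.\<close>

lemma fixed_point_exists:
  "\<exists>W. continuous_on {0..} W \<and>
    (\<forall>x\<ge>0. W x = 1 - q * x * integral {0..1} (\<lambda>\<theta>. (1 - \<theta> powr q) * g (W (x * \<theta>))))"
proof -
  define c where "c = 2 * q * p"
  have c: "c > 0" using q p by (simp add: c_def)
  \<comment> \<open>Integrating the equation twice and exchanging the order of integration leaves
    the kernel \<open>1 - (y / x) powr q\<close>; the substitution \<open>y = x * \<theta>\<close>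
    fixes the interval of integration. The unknown is
    \<open>\<phi> x = exp (- c * x) * W x\<close>.\<close>
  define K where "K = (\<lambda>(\<phi> :: real \<Rightarrow>\<^sub>C real) y \<theta>. (1 - \<theta> powr q) * g (exp (c * y * \<theta>) * \<phi> (y * \<theta>)))"
  define T where "T = (\<lambda>(\<phi> :: real \<Rightarrow>\<^sub>C real) x. let y = max 0 x in
      exp (- c * y) * (1 - q * y * integral {0..1} (K \<phi> y)))"
  have q01: "0 \<le> \<theta> powr q" "\<theta> powr q \<le> 1" if "\<theta> \<in> {0..1}" for \<theta>
    using that q by (auto intro: powr_le1)
  have contK: "continuous_on ({0..} \<times> cbox 0 1) (\<lambda>(y, \<theta>). K \<phi> y \<theta>)" for \<phi>
  proof -
    have "continuous_on ({0::real..} \<times> cbox 0 1) (\<lambda>z. \<phi> (fst z * snd z))"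
      by (rule continuous_on_compose2[where t=UNIV and g="apply_bcontfun \<phi>"])
        (auto intro!: continuous_intros)
    then show ?thesis unfolding K_def split_beta using q p
      by (intro continuous_on_cut_powr continuous_on_powr' continuous_intros) auto
  qed
  have contKy: "continuous_on {0..1} (K \<phi> y)" if "y \<ge> 0" for \<phi> y
  proof -
    have "continuous_on {0..1} (\<lambda>\<theta>. (y, \<theta>))"
      by (intro continuous_on_Pair continuous_on_const continuous_on_id)
    from continuous_on_compose2[OF contK[of \<phi>] this] that show ?thesis by auto
  qed
  have Kle: "\<bar>K \<phi> y \<theta>\<bar> \<le> 1" if "\<theta> \<in> {0..1}" for \<phi> y \<theta>
    unfolding K_def abs_mult using q01[OF that] cut_powr_le_1[of p] p
    by (intro mult_le_one) auto
  have intK: "\<bar>integral {0..1} (K \<phi> y)\<bar> \<le> 1" if "y \<ge> 0" for \<phi> y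
    using integral_norm_bound_integral[of "K \<phi> y" "{0..1}" "\<lambda>_. 1"] Kle
      integrable_continuous_real[OF contKy[OF that]] by auto
  have ey: "exp (- c * y) * y \<le> 1 / c" if "y \<ge> 0" for y
  proof -
    have "c * y \<le> exp (c * y)" using exp_ge_add_one_self[of "c * y"] by linarith
    then show ?thesis using c by (simp add: exp_minus field_simps)
  qed
  have Tb: "T \<phi> \<in> bcontfun" for \<phi>
  proof (rule bcontfun_normI)
    have "continuous_on {0..} (\<lambda>y. integral {0..1} (K \<phi> y))"
      using integral_continuous_on_param[OF contK[of \<phi>]] by simp
    then have "continuous_on UNIV (\<lambda>x. integral {0..1} (K \<phi> (max 0 x)))"
      by (rule continuous_on_compose2) (auto intro!: continuous_intros)
    then show "continuous_on UNIV (T \<phi>)" unfolding T_def Let_def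
      by (intro continuous_intros) auto
    fix x :: real
    let ?y = "max 0 x"
    have "norm (T \<phi> x) = exp (- c * ?y) * \<bar>1 - q * ?y * integral {0..1} (K \<phi> ?y)\<bar>"
      by (simp add: T_def Let_def abs_mult)
    also have "\<dots> \<le> exp (- c * ?y) * (1 + q * ?y * 1)"
    proof (intro mult_left_mono)
      have "\<bar>q * ?y * integral {0..1} (K \<phi> ?y)\<bar> \<le> q * ?y * 1"
        unfolding abs_mult using q intK[of ?y \<phi>] by (intro mult_mono) auto
      then show "\<bar>1 - q * ?y * integral {0..1} (K \<phi> ?y)\<bar> \<le> 1 + q * ?y * 1" by linarith
    qed auto
    also have "\<dots> = exp (- c * ?y) + q * (exp (- c * ?y) * ?y)" by (simp add: algebra_simps)
    also have "\<dots> \<le> 1 + q * (1 / c)"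
      using c q by (intro add_mono mult_left_mono ey) auto
    finally show "norm (T \<phi> x) \<le> 1 + q * (1 / c)" .
  qed
  have app: "apply_bcontfun (Bcontfun (T \<phi>)) = T \<phi>" for \<phi>
    using Tb by (simp add: Bcontfun_inverse)
  have "\<exists>!\<phi>. Bcontfun (T \<phi>) = \<phi>"
  proof (rule banach_fix_type[where c="1/2"])
    show "\<forall>\<phi> \<psi>. dist (Bcontfun (T \<phi>)) (Bcontfun (T \<psi>)) \<le> 1/2 * dist \<phi> \<psi>"
    proof (intro allI dist_bound)
      fix \<phi> \<psi> :: "real \<Rightarrow>\<^sub>C real" and x :: real
      define y where "y = max 0 x"
      define d where "d = dist \<phi> \<psi>"
      have y: "y \<ge> 0" by (simp add: y_def)
      have K: "K \<phi> y integrable_on {0..1}" "K \<psi> y integrable_on {0..1}"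
        using contKy[OF y] integrable_continuous_real by blast+
      \<comment> \<open>Integrating the weight yields the factor \<open>1 / c\<close>, which makes
        the total factor \<open>q * p / c = 1 / 2\<close>.\<close>
      have E: "((\<lambda>\<theta>. p * d * (y * exp (c * y * \<theta>))) has_integral
          p * d * (exp (c * y * 1) / c - exp (c * y * 0) / c)) {0..1}"
        using c by (intro has_integral_mult_right fundamental_theorem_of_calculus)
          (auto intro!: derivative_eq_intros simp: has_real_derivative_iff_has_vector_derivative[symmetric])
      have "norm (integral {0..1} (\<lambda>\<theta>. y * (K \<phi> y \<theta> - K \<psi> y \<theta>))) \<le>
          integral {0..1} (\<lambda>\<theta>. p * d * (y * exp (c * y * \<theta>)))"
      proof (rule integral_norm_bound_integral)
        show "(\<lambda>\<theta>. y * (K \<phi> y \<theta> - K \<psi> y \<theta>)) integrable_on {0..1}"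
          using K by (intro integrable_on_mult_right integrable_diff)
        show "(\<lambda>\<theta>. p * d * (y * exp (c * y * \<theta>))) integrable_on {0..1}" using E by blast
        fix \<theta> :: real assume th: "\<theta> \<in> {0..1}"
        have "\<bar>K \<phi> y \<theta> - K \<psi> y \<theta>\<bar> = (1 - \<theta> powr q) *
            \<bar>g (exp (c * y * \<theta>) * \<phi> (y * \<theta>)) - g (exp (c * y * \<theta>) * \<psi> (y * \<theta>))\<bar>"
          using q01[OF th] by (simp add: K_def abs_mult flip: right_diff_distrib)
        also have "\<dots> \<le> 1 * (p * \<bar>exp (c * y * \<theta>) * \<phi> (y * \<theta>) - exp (c * y * \<theta>) * \<psi> (y * \<theta>)\<bar>)"
          using q01[OF th] p by (intro mult_mono cut_powr_lipschitz) auto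
        also have "\<dots> = p * (exp (c * y * \<theta>) * dist (\<phi> (y * \<theta>)) (\<psi> (y * \<theta>)))"
          by (simp add: dist_real_def abs_mult flip: right_diff_distrib)
        also have "\<dots> \<le> p * (exp (c * y * \<theta>) * d)"
          unfolding d_def using p by (intro mult_left_mono dist_bounded) auto
        finally have "\<bar>K \<phi> y \<theta> - K \<psi> y \<theta>\<bar> \<le> p * (exp (c * y * \<theta>) * d)" .
        then have "y * \<bar>K \<phi> y \<theta> - K \<psi> y \<theta>\<bar> \<le> y * (p * (exp (c * y * \<theta>) * d))"
          using y by (rule mult_left_mono)
        then show "norm (y * (K \<phi> y \<theta> - K \<psi> y \<theta>)) \<le> p * d * (y * exp (c * y * \<theta>))"
          using y unfolding real_norm_def abs_mult by (simp add: ac_simps)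
      qed
      also have "\<dots> = p * d * (exp (c * y) - 1) / c" unfolding integral_unique[OF E] using c by (simp add: field_simps)
      finally have I: "\<bar>y * (integral {0..1} (K \<phi> y) - integral {0..1} (K \<psi> y))\<bar> \<le> p * d * (exp (c * y) - 1) / c"
        using K by (simp add: Henstock_Kurzweil_Integration.integral_diff)
      have "dist (T \<phi> x) (T \<psi> x) =
          exp (- c * y) * q * \<bar>y * (integral {0..1} (K \<phi> y) - integral {0..1} (K \<psi> y))\<bar>"
        using q by (simp add: T_def Let_def dist_real_def y_def[symmetric] abs_mult abs_minus_commute
            right_diff_distrib[symmetric] mult.assoc flip: right_diff_distrib)
      also have "\<dots> \<le> exp (- c * y) * q * (p * d * (exp (c * y) - 1) / c)"
        using q by (intro mult_left_mono I) auto
      also have "\<dots> = d / 2 * (1 - exp (- c * y))"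
        using c q p by (simp add: c_def exp_minus field_simps)
      also have "\<dots> \<le> d / 2 * 1" by (intro mult_left_mono) (auto simp: d_def)
      finally show "dist (apply_bcontfun (Bcontfun (T \<phi>)) x) (apply_bcontfun (Bcontfun (T \<psi>)) x) \<le> 1/2 * dist \<phi> \<psi>"
        by (simp add: app d_def)
    qed
  qed auto
  then obtain \<phi> where "Bcontfun (T \<phi>) = \<phi>" by blast
  then have \<phi>: "\<phi> x = T \<phi> x" for x using app by metis
  show ?thesis
  proof (intro exI[of _ "\<lambda>x. exp (c * x) * \<phi> x"] conjI allI impI)
    show "continuous_on {0..} (\<lambda>x. exp (c * x) * \<phi> x)" by (intro continuous_intros) auto
    fix x :: real assume x: "x \<ge> 0"
    have "exp (c * x) * \<phi> x = exp (c * x) * exp (- c * x) * (1 - q * x * integral {0..1} (K \<phi> x))"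
      by (subst \<phi>) (use x in \<open>simp add: T_def max_def\<close>)
    also have "exp (c * x) * exp (- c * x) = 1" by (simp flip: exp_add)
    finally show "exp (c * x) * \<phi> x = 1 - q * x * integral {0..1}
        (\<lambda>\<theta>. (1 - \<theta> powr q) * g (exp (c * (x * \<theta>)) * \<phi> (x * \<theta>)))"
      by (simp add: K_def mult.assoc)
  qed
qed

lemma integral_0_has_real_derivative:
  fixes f :: "real \<Rightarrow> real"
  assumes "continuous_on {0..} f" "x > 0"
  shows "((\<lambda>x. integral {0..x} f) has_real_derivative f x) (at x)"
proof -
  have "((\<lambda>x. integral {0..x} f) has_real_derivative f x) (at x within {0..x+1})"
    by (rule integral_has_real_derivative) (use assms in \<open>auto intro: continuous_on_subset\<close>)
  then show ?thesis using assms by (subst (asm) at_within_interior) auto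
qed

lemma continuous_on_integral_0:
  fixes f :: "real \<Rightarrow> real"
  assumes "continuous_on {0..} f"
  shows "continuous_on {0..} (\<lambda>x. integral {0..x} f)"
proof (rule continuous_on_subset[of "{0..}"])
  have "continuous_on {0..b} (\<lambda>x. integral {0..x} f)" for b
    by (intro indefinite_integral_continuous_1 integrable_continuous_real continuous_on_subset[OF assms]) auto
  then show "continuous_on {0..} (\<lambda>x. integral {0..x} f)"
    unfolding continuous_on_eq_continuous_within
  proof (intro ballI)
    fix x :: real
    assume *: "\<And>b. \<forall>x\<in>{0..b}. continuous (at x within {0..b}) (\<lambda>x. integral {0..x} f)" and "x \<in> {0..}"
    then have "continuous (at x within {0..x+1}) (\<lambda>x. integral {0..x} f)" by auto
    moreover have "at x within {0..x+1} = at x within {0..}"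
      by (rule at_within_nhd[of _ "{x-1<..<x+1}"]) auto
    ultimately show "continuous (at x within {0..}) (\<lambda>x. integral {0..x} f)" by simp
  qed
qed auto

text \<open>The kernel is split by the two primitives \<open>F\<close> and \<open>H\<close>. When
  \<open>W = 1 - q * (F - x powr -q * H)\<close> is differentiated, the terms with
  \<open>cut_powr p (W x)\<close> cancel and only the derivative of \<open>x powr -q\<close>
  survives, so that \<open>Z\<close> must be \<open>q * H\<close>.\<close>

lemma profile_exists:
  "\<exists>W Z. continuous_on {0..} W \<and> continuous_on {0..} Z \<and> W 0 = 1 \<and> Z 0 = 0 \<and>
    (\<forall>x>0. (W has_real_derivative - q * x powr (- 1 - q) * Z x) (at x)) \<and>
    (\<forall>x>0. (Z has_real_derivative q * x powr q * g (W x)) (at x))"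
proof -
  obtain W where Wc: "continuous_on {0..} W" and
    W: "\<And>x. x \<ge> 0 \<Longrightarrow> W x = 1 - q * x * integral {0..1} (\<lambda>\<theta>. (1 - \<theta> powr q) * g (W (x * \<theta>)))"
    using fixed_point_exists by blast
  have gW: "continuous_on {0..} (\<lambda>y. g (W y))" using Wc p by (intro continuous_on_cut_powr) auto
  have hW: "continuous_on {0..} (\<lambda>y. y powr q * g (W y))"
    using gW q by (intro continuous_intros continuous_on_powr') auto
  define F where "F = (\<lambda>x. integral {0..x} (\<lambda>y. g (W y)))"
  define H where "H = (\<lambda>x. integral {0..x} (\<lambda>y. y powr q * g (W y)))"
  have F: "(F has_real_derivative g (W x)) (at x)" and H: "(H has_real_derivative x powr q * g (W x)) (at x)"
    if "x > 0" for x
    unfolding F_def H_def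
    by (rule integral_0_has_real_derivative[OF gW that] integral_0_has_real_derivative[OF hW that])+
  have Fc: "continuous_on {0..} F" and Hc: "continuous_on {0..} H"
    unfolding F_def H_def using gW hW by (auto intro: continuous_on_integral_0)
  have FH0: "F 0 = 0" "H 0 = 0" by (auto simp: F_def H_def)
  have Weq: "W x = 1 - q * (F x - x powr (-q) * H x)" if x: "x > 0" for x
  proof -
    have "((\<lambda>\<theta>. x * ((1 - \<theta> powr q) * g (W (x * \<theta>)))) has_integral
        (F (x * 1) - x powr (-q) * H (x * 1)) - (F (x * 0) - x powr (-q) * H (x * 0))) {0..1}"
    proof (rule fundamental_theorem_of_calculus_interior)
      show "continuous_on {0..1} (\<lambda>\<theta>. F (x * \<theta>) - x powr (-q) * H (x * \<theta>))"
        using x by (intro continuous_intros continuous_on_compose2[OF Fc] continuous_on_compose2[OF Hc]) auto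
      fix \<theta> :: real assume th: "\<theta> \<in> {0<..<1}"
      then have xt: "x * \<theta> > 0" using x by simp
      have "((\<lambda>\<theta>. F (x * \<theta>) - x powr (-q) * H (x * \<theta>)) has_real_derivative
          g (W (x * \<theta>)) * x - x powr (-q) * ((x * \<theta>) powr q * g (W (x * \<theta>)) * x)) (at \<theta>)"
        by (intro DERIV_diff DERIV_cmult DERIV_chain2[where f=F and g="\<lambda>\<theta>. x * \<theta>", OF F[OF xt]]
            DERIV_chain2[where f=H and g="\<lambda>\<theta>. x * \<theta>", OF H[OF xt]])
          (auto intro!: derivative_eq_intros)
      moreover have "g (W (x * \<theta>)) * x - x powr (-q) * ((x * \<theta>) powr q * g (W (x * \<theta>)) * x)
          = x * ((1 - \<theta> powr q) * g (W (x * \<theta>)))"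
        using x th by (simp add: powr_mult powr_minus field_simps)
      ultimately show "((\<lambda>\<theta>. F (x * \<theta>) - x powr (-q) * H (x * \<theta>)) has_vector_derivative
          x * ((1 - \<theta> powr q) * g (W (x * \<theta>)))) (at \<theta>)"
        by (simp add: has_real_derivative_iff_has_vector_derivative)
    qed auto
    from integral_unique[OF this]
    have "integral {0..1} (\<lambda>\<theta>. x * ((1 - \<theta> powr q) * g (W (x * \<theta>)))) = F x - x powr (-q) * H x"
      using FH0 by simp
    then show ?thesis using W[of x] x by (simp add: mult.assoc)
  qed
  show ?thesis
  proof (rule exI[of _ W], rule exI[of _ "\<lambda>x. q * H x"], intro conjI allI impI)
    show "continuous_on {0..} W" "continuous_on {0..} (\<lambda>x. q * H x)" using Wc Hc by (auto intro: continuous_intros)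
    show "W 0 = 1" "q * H 0 = 0" using W[of 0] FH0 by auto
    fix x :: real assume x: "x > 0"
    show "((\<lambda>x. q * H x) has_real_derivative q * x powr q * g (W x)) (at x)"
      using DERIV_cmult[OF H[OF x], of q] by (simp add: mult.assoc)
    have "((\<lambda>x. 1 - q * (F x - x powr (-q) * H x)) has_real_derivative
      0 - q * (g (W x) - (- q * x powr (-q - 1) * H x + x powr q * g (W x) * x powr (-q)))) (at x)"
      using x by (intro DERIV_diff DERIV_cmult DERIV_mult F[OF x] H[OF x] DERIV_const) (auto intro!: derivative_eq_intros)
    moreover have "0 - q * (g (W x) - (- q * x powr (-q - 1) * H x + x powr q * g (W x) * x powr (-q)))
      = - q * x powr (- 1 - q) * (q * H x)"
    proof -
      have "x powr q * g (W x) * x powr (-q) = g (W x)" using x by (simp add: powr_minus)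
      moreover have "x powr (-q - 1) = x powr (- 1 - q)" by (simp only: minus_diff_commute)
      ultimately show ?thesis by (simp add: algebra_simps)
    qed
    ultimately have "((\<lambda>x. 1 - q * (F x - x powr (-q) * H x)) has_real_derivative
        - q * x powr (- 1 - q) * (q * H x)) (at x)" by (rule DERIV_cong)
    then show "(W has_real_derivative - q * x powr (- 1 - q) * (q * H x)) (at x)"
      by (rule has_field_derivative_transform_within_open[of _ _ _ "{0<..}"]) (use x Weq in auto)
  qed
qed

end

section \<open>Monotonicity, growth and decay of the profile\<close>

locale emden_profile = emden +
  fixes W Z :: "real \<Rightarrow> real"
  assumes W_cont: "continuous_on {0..} W" and Z_cont: "continuous_on {0..} Z"
    and W_0 [simp]: "W 0 = 1" and Z_0 [simp]: "Z 0 = 0"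
    and W_deriv: "\<And>x. x > 0 \<Longrightarrow> (W has_real_derivative - q * x powr (- 1 - q) * Z x) (at x)"
    and Z_deriv: "\<And>x. x > 0 \<Longrightarrow> (Z has_real_derivative q * x powr q * cut_powr p (W x)) (at x)"
begin

lemma at_right_0_limit:
  fixes f :: "real \<Rightarrow> real"
  assumes "continuous_on {0..} f"
  shows "(f \<longlongrightarrow> f 0) (at_right 0)"
proof -
  have "(f \<longlongrightarrow> f 0) (at 0 within {0..})" using assms by (auto simp: continuous_on_def)
  then show ?thesis by (rule tendsto_within_subset) auto
qed

lemma W_lim: "(W \<longlongrightarrow> 1) (at_right 0)" and Z_lim: "(Z \<longlongrightarrow> 0) (at_right 0)"
  using at_right_0_limit[OF W_cont] at_right_0_limit[OF Z_cont] by auto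

lemma Z_mono: assumes "0 \<le> x" "x \<le> y" shows "Z x \<le> Z y"
proof (cases "x = y")
  case False
  show ?thesis
  proof (rule DERIV_nonneg_imp_increasing_open[of x y Z])
    show "continuous_on {x..y} Z" using Z_cont by (rule continuous_on_subset) (use assms in auto)
    fix z assume "x < z" "z < y"
    then show "\<exists>w. (Z has_real_derivative w) (at z) \<and> 0 \<le> w"
      using Z_deriv[of z] assms q by (intro exI[of _ "q * z powr q * g (W z)"] conjI) auto
  qed (use assms in auto)
qed auto

lemma Z_nonneg: "0 \<le> x \<Longrightarrow> 0 \<le> Z x"
  using Z_mono[of 0 x] by simp

lemma W_antimono: assumes "0 \<le> x" "x \<le> y" shows "W y \<le> W x"
proof -
  have "- W x \<le> - W y"
  proof (rule DERIV_nonneg_imp_increasing_open[of x y "\<lambda>x. - W x"])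
    show "continuous_on {x..y} (\<lambda>x. - W x)"
      by (intro continuous_intros continuous_on_subset[OF W_cont]) (use assms in auto)
    fix z assume z: "x < z" "z < y"
    have "((\<lambda>x. - W x) has_real_derivative - (- q * z powr (- 1 - q) * Z z)) (at z)"
      using W_deriv[of z] z assms by (intro DERIV_minus) auto
    moreover have "0 \<le> - (- q * z powr (- 1 - q) * Z z)" using q Z_nonneg[of z] z assms by simp
    ultimately show "\<exists>w. ((\<lambda>x. - W x) has_real_derivative w) (at z) \<and> 0 \<le> w" by blast
  qed (use assms in auto)
  then show ?thesis by simp
qed

lemma W_le_1: "0 \<le> x \<Longrightarrow> W x \<le> 1"
  using W_antimono[of 0 x] by simp

lemma Z_upper: assumes "0 \<le> x" shows "Z x \<le> q / (1 + q) * x powr (1 + q)"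
proof -
  let ?f = "\<lambda>x. q / (1 + q) * x powr (1 + q) - Z x"
  have "?f 0 \<le> ?f x"
  proof (rule DERIV_nonneg_imp_increasing_open[of 0 x ?f])
    show "continuous_on {0..x} ?f" using q
      by (intro continuous_intros continuous_on_powr' continuous_on_subset[OF Z_cont]) auto
    fix z assume z: "0 < z" "z < x"
    have "(?f has_real_derivative q / (1 + q) * ((1 + q) * z powr q) - q * z powr q * g (W z)) (at z)"
      using z by (intro DERIV_diff Z_deriv DERIV_cmult) (auto intro!: derivative_eq_intros)
    moreover have "q / (1 + q) * ((1 + q) * z powr q) - q * z powr q * g (W z) \<ge> 0"
      using q p cut_powr_le_1[of p "W z"] mult_left_mono[of "g (W z)" 1 "q * z powr q"] by simp
    ultimately show "\<exists>w. (?f has_real_derivative w) (at z) \<and> 0 \<le> w" by blast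
  qed fact
  then show ?thesis using q by simp
qed

text \<open>\<open>W\<close> is decreasing, so on \<open>[0, x]\<close> the source can be bounded
  below by replacing \<open>W z\<close> with the end value \<open>W x\<close>, and the remaining
  power is integrated.\<close>

lemma Z_lower: assumes "0 \<le> x" "0 \<le> W x" shows "q / (1 + q) * x powr (1 + q) * W x powr p \<le> Z x"
proof -
  let ?f = "\<lambda>y. Z y - q / (1 + q) * y powr (1 + q) * W x powr p"
  have "?f 0 \<le> ?f x"
  proof (rule DERIV_nonneg_imp_increasing_open[of 0 x ?f])
    show "continuous_on {0..x} ?f" using q
      by (intro continuous_intros continuous_on_powr' continuous_on_subset[OF Z_cont]) auto
    fix z assume z: "0 < z" "z < x"
    have "(?f has_real_derivative q * z powr q * g (W z) - q / (1 + q) * ((1 + q) * z powr q) * W x powr p) (at z)"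
      using z by (intro DERIV_diff Z_deriv DERIV_cmult DERIV_cmult_right) (auto intro!: derivative_eq_intros)
    moreover have "q * z powr q * g (W z) - q / (1 + q) * ((1 + q) * z powr q) * W x powr p \<ge> 0"
    proof -
      have "W x \<le> W z" "W z \<le> 1" using W_antimono[of z x] W_le_1 z by auto
      then have "W x powr p \<le> g (W z)" using assms p by (subst cut_powr_eq) (auto intro: powr_mono2)
      then show ?thesis using q mult_left_mono[of "W x powr p" "g (W z)" "q * z powr q"] by simp
    qed
    ultimately show "\<exists>w. (?f has_real_derivative w) (at z) \<and> 0 \<le> w" by blast
  qed fact
  then show ?thesis using q by simp
qed

text \<open>If \<open>Z x\<close> vanished, so would \<open>Z\<close> on all of
  \<open>[0, x]\<close>, and \<open>W\<close> would stay equal to 1, against the lower bound for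
  \<open>Z\<close>.\<close>

lemma Z_pos: assumes "0 < x" shows "0 < Z x"
proof (rule ccontr)
  assume "\<not> 0 < Z x"
  then have 0: "Z y = 0" if "0 \<le> y" "y \<le> x" for y
    using Z_nonneg[of y] Z_mono[of y x] that by auto
  have "W x = W 0"
  proof (rule DERIV_isconst_end[of 0 x W])
    show "continuous_on {0..x} W" by (rule continuous_on_subset[OF W_cont]) auto
    fix z assume "0 < z" "z < x" then show "(W has_real_derivative 0) (at z)" using W_deriv[of z] 0[of z] by simp
  qed fact
  moreover have "q * x powr (1 + q) / (1 + q) > 0" using q assms by simp
  ultimately show False using Z_lower[of x] 0[of x] assms by simp
qed

lemma W_strict_antimono: assumes "0 \<le> x" "x < y" shows "W y < W x"
proof -
  have "- W x < - W y"
  proof (rule DERIV_pos_imp_increasing_open[of x y "\<lambda>x. - W x"])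
    show "continuous_on {x..y} (\<lambda>x. - W x)"
      by (intro continuous_intros continuous_on_subset[OF W_cont]) (use assms in auto)
    fix z assume z: "x < z" "z < y"
    have "((\<lambda>x. - W x) has_real_derivative - (- q * z powr (- 1 - q) * Z z)) (at z)"
      using W_deriv[of z] z assms by (intro DERIV_minus) auto
    moreover have "0 < - (- q * z powr (- 1 - q) * Z z)" using q Z_pos[of z] z assms by simp
    ultimately show "\<exists>w. ((\<lambda>x. - W x) has_real_derivative w) (at z) \<and> 0 < w" by blast
  qed fact
  then show ?thesis by simp
qed

text \<open>Concavity of \<open>t \<mapsto> W (t powr -k)\<close>, whose derivative is \<open>Z\<close>.\<close>

lemma Z_le_W:
  assumes pos: "\<And>x. x \<ge> 0 \<Longrightarrow> W x > 0" and x: "x > 0"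
  shows "x powr (- q) * Z x \<le> W x"
proof -
  have *: "- (y powr (- q)) * Z x \<le> W x - x powr (- q) * Z x" if y: "y > x" for y
  proof -
    let ?f = "\<lambda>y. y powr (- q) * Z x - W y"
    have "?f x \<le> ?f y"
    proof (rule DERIV_nonneg_imp_nondecreasing[of x y ?f])
      fix z assume z: "x \<le> z" "z \<le> y"
      have "(?f has_real_derivative (- q * z powr (- q - 1)) * Z x - (- q * z powr (- 1 - q) * Z z)) (at z)"
        using z x by (intro DERIV_diff W_deriv DERIV_cmult_right) (auto intro!: derivative_eq_intros)
      moreover have "- q * z powr (- q - 1) * Z x - (- q * z powr (- 1 - q) * Z z) = q * z powr (- 1 - q) * (Z z - Z x)"
        by (subst minus_diff_commute) (simp add: algebra_simps)
      moreover have "q * z powr (- 1 - q) * (Z z - Z x) \<ge> 0" using q Z_mono[of x z] z x by simp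
      ultimately show "\<exists>w. (?f has_real_derivative w) (at z) \<and> 0 \<le> w" by metis
    qed (use y in auto)
    then show ?thesis using pos[of y] x y by linarith
  qed
  \<comment> \<open>The tangent at \<open>x\<close>, as a function of \<open>t = y powr -q\<close>,
    lies above \<open>W y > 0\<close>; as \<open>y\<close> grows, its abscissa \<open>t\<close>
    tends to 0.\<close>
  have lim: "((\<lambda>y. - (y powr (- q)) * Z x) \<longlongrightarrow> - 0 * Z x) at_top"
    using q by (intro tendsto_intros tendsto_neg_powr filterlim_ident) auto
  have "- 0 * Z x \<le> W x - x powr (- q) * Z x"
    by (rule tendsto_upperbound[OF lim])
      (use * in \<open>auto intro: eventually_mono[OF eventually_gt_at_top[of x]]\<close>)
  then show ?thesis by simp
qed

text \<open>The lower bound of \<open>Z\<close> by \<open>W powr p\<close> meets the upper bound by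
  \<open>x powr q * W\<close>; the constant is \<open>(1 + q) / q = k + 1\<close>.\<close>

lemma W_decay:
  assumes pos: "\<And>x. x \<ge> 0 \<Longrightarrow> W x > 0" and x: "x > 0"
  shows "x * W x powr (p - 1) \<le> k + 1"
proof -
  have "q / (1 + q) * x powr (1 + q) * W x powr p \<le> x powr q * W x"
  proof -
    have "Z x = x powr q * (x powr (- q) * Z x)" using x by (simp add: powr_minus)
    also have "\<dots> \<le> x powr q * W x" using Z_le_W[OF pos x] by (intro mult_left_mono) auto
    finally show ?thesis using Z_lower[of x] pos[of x] x by simp
  qed
  also have "q / (1 + q) * x powr (1 + q) * W x powr p = x powr q * W x * (q / (1 + q) * (x * W x powr (p - 1)))"
    using x pos[of x] by (simp add: powr_add powr_diff)
  finally have "q / (1 + q) * (x * W x powr (p - 1)) \<le> 1"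
    using x pos[of x] mult_le_cancel_left_pos[of "x powr q * W x" "q / (1 + q) * (x * W x powr (p - 1))" 1] by simp
  then show ?thesis using q k by (simp add: q_def field_simps)
qed

text \<open>With \<open>x = s^2\<close> and derivatives in \<open>s\<close>, this is
  \<open>1 / (4 * q^2)\<close> times the classical functional \<open>s^N w'^2 / 2 + (N - 2) / 2 s^(N
  - 1) w w' + 4 q^2 s^N w^(p + 1) / (p + 1)\<close> in dimension
  \<open>N = 2 + 2 * q\<close>.\<close>

definition pohozaev :: "real \<Rightarrow> real" where
  "pohozaev x = x powr (- q) * (Z x)\<^sup>2 / 2 - W x * Z x / 2 + x powr (1 + q) * W x powr (p + 1) / (p + 1)"

text \<open>The terms in \<open>Z^2\<close> cancel, and so do those in \<open>W powr p * Z\<close>.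
  By \<open>k * q = 1\<close> the remaining factor \<open>(1 + q) / (p + 1) - q / 2\<close> is
  positive exactly for \<open>p < 2 * k + 1\<close>.\<close>

lemma pohozaev_deriv:
  assumes x: "x > 0" and Wx: "W x > 0"
  shows "(pohozaev has_real_derivative x powr q * W x powr (p + 1) * ((1 + q) / (p + 1) - q / 2)) (at x)"
proof -
  have gW: "g (W x) = W x powr p" using cut_powr_eq W_le_1[of x] x Wx by simp
  define a where "a = x powr q"
  define w where "w = W x powr p"
  have a: "a > 0" using x by (simp add: a_def)
  have e: "x powr (- q) = 1 / a" "x powr (- q - 1) = 1 / (a * x)" "x powr (- 1 - q) = 1 / (a * x)"
     "x powr (1 + q) = a * x" "W x powr (p + 1) = w * W x"
    using x Wx by (auto simp: a_def w_def powr_diff powr_add powr_minus field_simps)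
  have "(pohozaev has_real_derivative
     (((- q * x powr (- q - 1)) * (Z x)\<^sup>2 + 2 * Z x * (q * x powr q * g (W x)) * x powr (- q)) / 2
     - (- q * x powr (- 1 - q) * Z x * Z x + q * x powr q * g (W x) * W x) / 2)
     + ((1 + q) * x powr q * W x powr (p + 1) + ((p + 1) * W x powr p * (- q * x powr (- 1 - q) * Z x)) * x powr (1 + q)) / (p + 1)) (at x)"
    unfolding pohozaev_def[abs_def]
    using x Wx
    by (intro DERIV_add DERIV_diff DERIV_cdivide DERIV_mult W_deriv Z_deriv)
      (auto intro!: derivative_eq_intros W_deriv Z_deriv simp: e)
  moreover have "(((- q * x powr (- q - 1)) * (Z x)\<^sup>2 + 2 * Z x * (q * x powr q * g (W x)) * x powr (- q)) / 2
     - (- q * x powr (- 1 - q) * Z x * Z x + q * x powr q * g (W x) * W x) / 2)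
     + ((1 + q) * x powr q * W x powr (p + 1) + ((p + 1) * W x powr p * (- q * x powr (- 1 - q) * Z x)) * x powr (1 + q)) / (p + 1)
     = x powr q * W x powr (p + 1) * ((1 + q) / (p + 1) - q / 2)"
    unfolding e gW a_def[symmetric] w_def[symmetric] using a x p
    by (simp add: divide_simps power2_eq_square) algebra
  ultimately show ?thesis by simp
qed

text \<open>\<open>Z\<close> is of order \<open>x powr (1 + q)\<close> at 0, which outweighs the
  factor \<open>x powr -q\<close> in front of its square.\<close>

lemma pohozaev_lim: "(pohozaev \<longlongrightarrow> 0) (at_right 0)"
proof -
  define C where "C = q / (1 + q)"
  have pw: "((\<lambda>x::real. x powr a) \<longlongrightarrow> 0) (at_right 0)" if "a > 0" for a
  proof -
    have "((\<lambda>x::real. x powr a) \<longlongrightarrow> 0 powr a) (at_right 0)"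
      using that by (intro tendsto_powr') (auto intro!: tendsto_intros eventually_at_right_less simp: eventually_at_filter)
    then show ?thesis by simp
  qed
  have 1: "((\<lambda>x. x powr (- q) * (Z x)\<^sup>2) \<longlongrightarrow> 0) (at_right 0)"
  proof (rule tendsto_sandwich[where f="\<lambda>_. 0" and h="\<lambda>x. C\<^sup>2 * x powr (2 + q)"])
    show "\<forall>\<^sub>F x in at_right 0. x powr (- q) * (Z x)\<^sup>2 \<le> C\<^sup>2 * x powr (2 + q)"
      using eventually_at_right_less[of "0::real"]
    proof eventually_elim
      case (elim x)
      have "(Z x)\<^sup>2 \<le> (C * x powr (1 + q))\<^sup>2"
        using Z_upper[of x] Z_nonneg[of x] elim by (intro power_mono) (auto simp: C_def)
      then have "x powr (- q) * (Z x)\<^sup>2 \<le> x powr (- q) * (C * x powr (1 + q))\<^sup>2"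
        by (intro mult_left_mono) auto
      also have "\<dots> = C\<^sup>2 * (x powr (- q) * x powr (1 + q) * x powr (1 + q))" by (simp add: power2_eq_square)
      also have "x powr (- q) * x powr (1 + q) * x powr (1 + q) = x powr (- q + (1 + q) + (1 + q))"
        by (simp only: powr_add)
      also have "\<dots> = x powr (2 + q)" by (simp add: algebra_simps)
      finally show ?case .
    qed
    show "((\<lambda>x. C\<^sup>2 * x powr (2 + q)) \<longlongrightarrow> 0) (at_right 0)"
      using q by (intro tendsto_mult_right_zero pw) auto
  qed (auto intro!: always_eventually)
  have 2: "((\<lambda>x. W x powr (p + 1)) \<longlongrightarrow> 1 powr (p + 1)) (at_right 0)"
    by (intro tendsto_powr W_lim tendsto_const) auto
  have "(pohozaev \<longlongrightarrow> 0 / 2 - 1 * 0 / 2 + 0 * 1 powr (p + 1) / (p + 1)) (at_right 0)"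
    unfolding pohozaev_def[abs_def] using p q
    by (intro tendsto_intros 1 2 W_lim Z_lim pw) auto
  then show ?thesis by simp
qed

text \<open>The functional starts at 0 and does not increase while \<open>W > 0\<close>. At a zero
  of \<open>W\<close> it reduces to \<open>x powr -q * Z^2 / 2\<close>, which is positive.\<close>

lemma W_pos_supercritical:
  assumes pc: "p \<ge> 2 * k + 1" and "x \<ge> 0"
  shows "W x > 0"
proof (rule ccontr)
  assume "\<not> W x > 0"
  then have "\<exists>z. 0 \<le> z \<and> z \<le> x \<and> W z = 0"
    using assms by (intro IVT2' continuous_on_subset[OF W_cont]) auto
  then obtain z where z: "z > 0" "W z = 0" by (metis W_0 less_eq_real_def zero_neq_one)
  have E: "pohozaev y \<le> 0" if "0 < y" "y < z" for y
  proof -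
    have "0 \<le> - pohozaev y"
    proof (rule nonneg_deriv_ge_limit[where f="\<lambda>x. - pohozaev x" and b=z])
      fix x assume x: "0 < x" "x < z"
      then have "W x > 0" using W_strict_antimono[of x z] z by simp
      from pohozaev_deriv[OF x(1) this]
      show "((\<lambda>x. - pohozaev x) has_real_derivative - (x powr q * W x powr (p + 1) * ((1 + q) / (p + 1) - q / 2))) (at x)"
        by (rule DERIV_minus)
      have "2 * (1 + q) = q * (2 * k + 2)" using kq by (simp add: algebra_simps)
      also have "\<dots> \<le> q * (p + 1)" using pc q by (intro mult_left_mono) auto
      finally have "(1 + q) / (p + 1) \<le> q / 2" using p by (simp add: divide_simps algebra_simps)
      then show "0 \<le> - (x powr q * W x powr (p + 1) * ((1 + q) / (p + 1) - q / 2))"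
        by (simp add: mult_nonneg_nonpos)
    next
      show "((\<lambda>x. - pohozaev x) \<longlongrightarrow> 0) (at_right 0)" using tendsto_minus[OF pohozaev_lim] by simp
    qed (use that in auto)
    then show ?thesis by simp
  qed
  have contZ: "continuous_on {z/2..z} Z" and contW: "continuous_on {z/2..z} W"
    using Z_cont W_cont z by (auto intro!: continuous_on_subset[of "{0..}"])
  have "continuous_on {z/2..z} pohozaev"
    unfolding pohozaev_def[abs_def] using p q W_antimono[of _ z] z
    by (intro continuous_intros contZ contW continuous_on_powr') auto
  then have "(pohozaev \<longlongrightarrow> pohozaev z) (at z within {z/2..z})"
    using z by (auto simp: continuous_on_def)
  then have "(pohozaev \<longlongrightarrow> pohozaev z) (at_left z)"
    using z at_within_Icc_at_left[of "z/2" z] by simp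
  then have "pohozaev z \<le> 0"
    by (rule tendsto_upperbound) (use z E in \<open>auto simp: eventually_at_left_field intro!: exI[of _ 0]\<close>)
  moreover have "pohozaev z > 0" using z Z_pos[of z] p by (simp add: pohozaev_def)
  ultimately show False by simp
qed

text \<open>If \<open>W\<close> had no zero, the functional would increase strictly from 0. But
  \<open>Z_le_W\<close> and \<open>W_decay\<close> bound it by a multiple of
  \<open>x powr (q - 2 / (p - 1))\<close>, which tends to 0 at infinity, since
  \<open>q < 2 / (p - 1)\<close> is the condition \<open>p < 2 * k + 1\<close>.\<close>

lemma W_zero_subcritical:
  assumes pc: "p < 2 * k + 1"
  shows "\<exists>x>0. W x = 0"
proof (rule ccontr)
  assume no0: "\<not> (\<exists>x>0. W x = 0)"
  have pos: "W x > 0" if x: "x \<ge> 0" for x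
  proof (rule ccontr)
    assume "\<not> W x > 0"
    then have "\<exists>z. 0 \<le> z \<and> z \<le> x \<and> W z = 0"
      using x by (intro IVT2' continuous_on_subset[OF W_cont]) auto
    then show False using no0 by (metis W_0 less_eq_real_def zero_neq_one)
  qed
  have "q * (p + 1) < q * (2 * k + 2)" using pc q by (intro mult_strict_left_mono) auto
  also have "\<dots> = 2 * (1 + q)" using kq by (simp add: algebra_simps)
  finally have c: "(1 + q) / (p + 1) - q / 2 > 0" using p by (simp add: divide_simps algebra_simps)
  let ?E' = "\<lambda>x. x powr q * W x powr (p + 1) * ((1 + q) / (p + 1) - q / 2)"
  have E'pos: "?E' x > 0" if "x > 0" for x using pos[of x] that c by simp
  have E1: "pohozaev 1 \<ge> 0"
    by (rule nonneg_deriv_ge_limit[where b=2 and f'="?E'"])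
      (use pohozaev_deriv pos E'pos pohozaev_lim in \<open>auto simp: less_imp_le\<close>)
  have inc: "pohozaev x < pohozaev y" if "0 < x" "x < y" for x y
  proof (rule DERIV_pos_imp_increasing[of x y pohozaev])
    fix z assume "x \<le> z" "z \<le> y"
    then show "\<exists>w. (pohozaev has_real_derivative w) (at z) \<and> 0 < w"
      using pohozaev_deriv[of z] E'pos[of z] pos[of z] that by auto
  qed fact
  have E2: "pohozaev 2 > 0" using E1 inc[of 1 2] by linarith
  \<comment> \<open>The two summands come from the first and the last term of the functional, the
    middle one being dropped as nonpositive; the power of \<open>k + 1\<close> comes from the bound
    of \<open>W^2\<close> by \<open>W_decay\<close>.\<close>
  define C where "C = (1 / 2 + (k + 1) / (p + 1)) * (k + 1) powr (2 / (p - 1))"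
  have up: "pohozaev x \<le> C * x powr (- (2 / (p - 1) - q))" if x: "x > 0" for x
  proof -
    have W: "W x > 0" using pos x by simp
    have Zx: "Z x \<le> x powr q * W x"
      using Z_le_W[OF pos x] x by (simp add: powr_minus field_simps)
    have "x powr (- q) * (Z x)\<^sup>2 \<le> x powr (- q) * (x powr q * W x)\<^sup>2"
      using Zx Z_nonneg[of x] x by (intro mult_left_mono power_mono) auto
    also have "\<dots> = x powr q * (W x)\<^sup>2" using x by (simp add: powr_minus power2_eq_square)
    finally have 1: "x powr (- q) * (Z x)\<^sup>2 / 2 \<le> 1 / 2 * (x powr q * (W x)\<^sup>2)" by simp
    have "x powr (1 + q) * W x powr (p + 1) = (x * W x powr (p - 1)) * (x powr q * (W x)\<^sup>2)"
    proof -
      have "W x powr (p + 1) = W x powr (p - 1) * W x powr 2"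
        by (simp add: add.commute flip: powr_add)
      then show ?thesis using x W by (simp add: powr_add)
    qed
    also have "\<dots> \<le> (k + 1) * (x powr q * (W x)\<^sup>2)"
      using W_decay[OF pos x] by (intro mult_right_mono) auto
    finally have 2: "x powr (1 + q) * W x powr (p + 1) / (p + 1) \<le> (k + 1) / (p + 1) * (x powr q * (W x)\<^sup>2)"
      using p by (simp add: divide_right_mono)
    have 3: "W x * Z x / 2 \<ge> 0" using W Z_nonneg[of x] x by simp
    have "pohozaev x \<le> (1 / 2 + (k + 1) / (p + 1)) * (x powr q * (W x)\<^sup>2)"
      unfolding pohozaev_def distrib_right using 1 2 3 by linarith
    also have "(W x)\<^sup>2 \<le> (k + 1) powr (2 / (p - 1)) * x powr (- (2 / (p - 1)))"
    proof -
      have e: "(p - 1) * (2 / (p - 1)) = 2" using p by (simp add: field_simps)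
      have "(W x)\<^sup>2 = (W x powr (p - 1)) powr (2 / (p - 1))" unfolding powr_powr e using W by simp
      also have "\<dots> \<le> ((k + 1) / x) powr (2 / (p - 1))"
        using W_decay[OF pos x] x p by (intro powr_mono2) (auto simp: field_simps)
      also have "\<dots> = (k + 1) powr (2 / (p - 1)) * x powr (- (2 / (p - 1)))"
        using x k by (simp add: powr_divide powr_minus_divide)
      finally show ?thesis .
    qed
    finally have "pohozaev x \<le> (1 / 2 + (k + 1) / (p + 1)) * (x powr q * ((k + 1) powr (2 / (p - 1)) * x powr (- (2 / (p - 1)))))"
      using k p by (simp add: mult_left_mono)
    also have "\<dots> = C * (x powr q * x powr (- (2 / (p - 1))))" by (simp add: C_def)
    also have "x powr q * x powr (- (2 / (p - 1))) = x powr (- (2 / (p - 1) - q))" by (simp flip: powr_add)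
    finally show ?thesis .
  qed
  have ex: "2 / (p - 1) - q > 0" using pc k p by (simp add: q_def field_simps)
  have lim: "((\<lambda>x::real. C * x powr (- (2 / (p - 1) - q))) \<longlongrightarrow> C * 0) at_top"
    by (intro tendsto_intros tendsto_neg_powr filterlim_ident) (use ex in auto)
  have "pohozaev 2 \<le> C * 0"
  proof (rule tendsto_lowerbound[OF lim])
    show "\<forall>\<^sub>F x in at_top. pohozaev 2 \<le> C * x powr (- (2 / (p - 1) - q))"
      using eventually_gt_at_top[of 2]
    proof eventually_elim
      case (elim x) then show ?case using inc[of 2 x] up[of x] by simp
    qed
  qed auto
  then show False using E2 by simp
qed

text \<open>Both \<open>D - x powr -q * Y\<close> and \<open>x powr -q * Y\<close> are bounded by the integral of \<open>\<bar>D\<bar>\<close>, so that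
  Gronwall's inequality applies to \<open>D\<close> in spite of the singular coefficient.\<close>

lemma profile_unique:
  fixes om ze :: "real \<Rightarrow> real"
  assumes X: "X > 0" and om_cont: "continuous_on {0..1} om" and om_0: "om 0 = 1"
    and om_deriv: "\<And>x. 0 < x \<Longrightarrow> x < 1 \<Longrightarrow> (om has_real_derivative - q * x powr (- 1 - q) * ze x) (at x)"
    and ze_deriv: "\<And>x. 0 < x \<Longrightarrow> x < 1 \<Longrightarrow> (ze has_real_derivative q * X * x powr q * g (om x)) (at x)"
    and ze_lim: "(ze \<longlongrightarrow> 0) (at_right 0)" and x: "0 \<le> x" "x \<le> 1"
  shows "om x = W (X * x)"
proof -
  \<comment> \<open>\<open>W (X * x)\<close> and \<open>X powr -q * Z (X * x)\<close> solve the same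
    system as \<open>om\<close> and \<open>ze\<close>.\<close>
  define D where "D = (\<lambda>x. om x - W (X * x))"
  define Y where "Y = (\<lambda>x. ze x - X powr (- q) * Z (X * x))"
  define J where "J = (\<lambda>x. integral {0..x} (\<lambda>x. \<bar>D x\<bar>))"
  define G where "G = (\<lambda>x. g (om x) - g (W (X * x)))"
  define C where "C = q * X * p"
  have C: "C > 0" using q X p by (simp add: C_def)
  have D_cont: "continuous_on {0..1} D"
    unfolding D_def using X by (intro continuous_intros om_cont continuous_on_compose2[OF W_cont]) auto
  have DY: "(D has_real_derivative - q * x powr (- 1 - q) * Y x) (at x)"
    "(Y has_real_derivative q * X * x powr q * G x) (at x)"
    "(J has_real_derivative \<bar>D x\<bar>) (at x)" if x: "0 < x" "x < 1" for x
  proof -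
    have Xx: "X * x > 0" using X x by simp
    have pw: "(X * x) powr (- 1 - q) * X = x powr (- 1 - q) * X powr (- q)" "X powr (- q) * (X * x) powr q = x powr q"
      using X x by (auto simp: powr_mult powr_diff powr_minus field_simps)
    have "((\<lambda>x. W (X * x)) has_real_derivative - q * (X * x) powr (- 1 - q) * Z (X * x) * X) (at x)"
      by (rule DERIV_chain2[where f=W and g="\<lambda>x. X * x", OF W_deriv[OF Xx]]) (auto intro!: derivative_eq_intros)
    from DERIV_diff[OF om_deriv[OF x] this]
    show "(D has_real_derivative - q * x powr (- 1 - q) * Y x) (at x)"
      unfolding D_def
    proof (rule DERIV_cong)
      have "- q * (X * x) powr (- 1 - q) * Z (X * x) * X = - q * Z (X * x) * ((X * x) powr (- 1 - q) * X)" by simp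
      also have "\<dots> = - q * x powr (- 1 - q) * (X powr (- q) * Z (X * x))" unfolding pw by simp
      finally show "- q * x powr (- 1 - q) * ze x - - q * (X * x) powr (- 1 - q) * Z (X * x) * X =
        - q * x powr (- 1 - q) * Y x" by (simp only: Y_def right_diff_distrib)
    qed
    have "((\<lambda>x. Z (X * x)) has_real_derivative q * (X * x) powr q * g (W (X * x)) * X) (at x)"
      by (rule DERIV_chain2[where f=Z and g="\<lambda>x. X * x", OF Z_deriv[OF Xx]]) (auto intro!: derivative_eq_intros)
    from DERIV_diff[OF ze_deriv[OF x] DERIV_cmult[OF this, of "X powr (- q)"]]
    show "(Y has_real_derivative q * X * x powr q * G x) (at x)"
      unfolding Y_def
    proof (rule DERIV_cong)
      have "X powr (- q) * (q * (X * x) powr q * g (W (X * x)) * X) =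
        q * (X powr (- q) * (X * x) powr q) * g (W (X * x)) * X" by simp
      then show "q * X * x powr q * g (om x) - X powr (- q) * (q * (X * x) powr q * g (W (X * x)) * X) = q * X * x powr q * G x"
        unfolding pw by (simp add: G_def right_diff_distrib)
    qed
    have "(J has_real_derivative \<bar>D x\<bar>) (at x within {0..1})"
      unfolding J_def by (rule integral_has_real_derivative) (use D_cont x in \<open>auto intro!: continuous_intros\<close>)
    then show "(J has_real_derivative \<bar>D x\<bar>) (at x)"
      using x by (subst (asm) at_within_interior) auto
  qed
  have lim0: "(f \<longlongrightarrow> f 0) (at_right 0)" if "continuous_on {0..1} f" for f :: "real \<Rightarrow> real"
  proof -
    have "(f \<longlongrightarrow> f 0) (at 0 within {0..1})" using that by (auto simp: continuous_on_def)
    then show ?thesis by (simp add: at_within_Icc_at_right)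
  qed
  have J_lim: "(J \<longlongrightarrow> 0) (at_right 0)"
  proof -
    have "continuous_on {0..1} J" unfolding J_def
      using D_cont by (intro indefinite_integral_continuous_1 integrable_continuous_real continuous_intros)
    from lim0[OF this] show ?thesis by (simp add: J_def)
  qed
  have D_lim: "(D \<longlongrightarrow> 0) (at_right 0)" using lim0[OF D_cont] om_0 by (simp add: D_def)
  have Y_lim: "(Y \<longlongrightarrow> 0) (at_right 0)"
  proof -
    have "continuous_on {0..1} (\<lambda>x. Z (X * x))"
      using X by (intro continuous_on_compose2[OF Z_cont] continuous_intros) auto
    from tendsto_diff[OF ze_lim tendsto_mult_left[OF lim0[OF this], of "X powr (- q)"]]
    show ?thesis by (simp add: Y_def)
  qed
  have J_nonneg: "J x \<ge> 0" if "0 < x" "x < 1" for x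
    by (rule nonneg_deriv_ge_limit[OF DY(3) _ J_lim]) (use that in auto)
  have G: "\<bar>G x\<bar> \<le> p * \<bar>D x\<bar>" for x
    unfolding G_def D_def using p by (intro cut_powr_lipschitz) auto
  have sG: "0 \<le> C * \<bar>D x\<bar> + s * (q * X * G x)" if "\<bar>s\<bar> = 1" for x s
  proof -
    have "\<bar>s * (q * X * G x)\<bar> = q * X * \<bar>G x\<bar>" using that q X by (simp add: abs_mult)
    also have "\<dots> \<le> q * X * (p * \<bar>D x\<bar>)" using q X G by (intro mult_left_mono) auto
    finally show ?thesis by (simp add: C_def mult.assoc)
  qed
  have Y_le: "\<bar>Y x\<bar> \<le> C * (x powr q * J x)" if x: "0 < x" "x < 1" for x
  proof -
    \<comment> \<open>The two choices of the sign \<open>s\<close> together bound the absolute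
      value.\<close>
    have "0 \<le> C * (x powr q * J x) + s * Y x" if s: "\<bar>s\<bar> = 1" for s
    proof (rule nonneg_deriv_ge_limit[where f="\<lambda>x. C * (x powr q * J x) + s * Y x" and b=1])
      fix x :: real assume x: "0 < x" "x < 1"
      show "((\<lambda>x. C * (x powr q * J x) + s * Y x) has_real_derivative
          C * (q * x powr (q - 1) * J x + \<bar>D x\<bar> * x powr q) + s * (q * X * x powr q * G x)) (at x)"
        using x by (intro DERIV_add DERIV_cmult DERIV_mult DY) (auto intro!: derivative_eq_intros)
      have "C * (q * x powr (q - 1) * J x + \<bar>D x\<bar> * x powr q) + s * (q * X * x powr q * G x)
        = C * (q * x powr (q - 1) * J x) + x powr q * (C * \<bar>D x\<bar> + s * (q * X * G x))"
        by (simp add: algebra_simps)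
      also have "\<dots> \<ge> 0"
        using C q J_nonneg[OF x] mult_nonneg_nonneg[OF powr_ge_zero sG[OF s, of x]] by (intro add_nonneg_nonneg) auto
      finally show "0 \<le> C * (q * x powr (q - 1) * J x + \<bar>D x\<bar> * x powr q) + s * (q * X * x powr q * G x)" .
    next
      have "((\<lambda>x::real. x powr q) \<longlongrightarrow> 0 powr q) (at_right 0)"
        using q by (intro tendsto_powr') (auto intro!: tendsto_intros simp: eventually_at_filter)
      then have "((\<lambda>x. C * (x powr q * J x) + s * Y x) \<longlongrightarrow> C * (0 powr q * 0) + s * 0) (at_right 0)"
        by (intro tendsto_add tendsto_mult tendsto_const J_lim Y_lim)
      then show "((\<lambda>x. C * (x powr q * J x) + s * Y x) \<longlongrightarrow> 0) (at_right 0)" by simp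
    qed (use x in auto)
    from this[of 1] this[of "-1"] show ?thesis by auto
  qed
  have xY: "\<bar>x powr (- q) * Y x\<bar> \<le> C * J x" if x: "0 < x" "x < 1" for x
  proof -
    have "\<bar>x powr (- q) * Y x\<bar> \<le> x powr (- q) * (C * (x powr q * J x))"
      unfolding abs_mult using Y_le[OF x] by (simp add: mult_left_mono)
    also have "\<dots> = C * J x" using x by (simp add: powr_minus)
    finally show ?thesis .
  qed
  have N_le: "\<bar>D x - x powr (- q) * Y x\<bar> \<le> C * J x" if x: "0 < x" "x < 1" for x
  proof -
    have "0 \<le> C * J x + s * (D x - x powr (- q) * Y x)" if s: "\<bar>s\<bar> = 1" for s
    proof (rule nonneg_deriv_ge_limit[where f="\<lambda>x. C * J x + s * (D x - x powr (- q) * Y x)" and b=1])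
      fix x :: real assume x: "0 < x" "x < 1"
      \<comment> \<open>Subtracting \<open>x powr -q * Y\<close> removes the singular term
        \<open>x powr (- 1 - q) * Y\<close> from the derivative; what is left is
        \<open>q * X * G\<close>, bounded by a multiple of \<open>\<bar>D\<bar>\<close>.\<close>
      have "((\<lambda>x. C * J x + s * (D x - x powr (- q) * Y x)) has_real_derivative
          C * \<bar>D x\<bar> + s * (- q * x powr (- 1 - q) * Y x -
            (- q * x powr (- q - 1) * Y x + q * X * x powr q * G x * x powr (- q)))) (at x)"
        using x by (intro DERIV_add DERIV_diff DERIV_cmult DERIV_mult DY) (auto intro!: derivative_eq_intros)
      then show "((\<lambda>x. C * J x + s * (D x - x powr (- q) * Y x)) has_real_derivative
          C * \<bar>D x\<bar> + (- s) * (q * X * G x)) (at x)"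
      proof (rule DERIV_cong)
        have "x powr (- q - 1) = x powr (- 1 - q)" by (simp only: minus_diff_commute)
        moreover have "q * X * x powr q * G x * x powr (- q) = q * X * G x" using x by (simp add: powr_minus)
        ultimately show "C * \<bar>D x\<bar> + s * (- q * x powr (- 1 - q) * Y x -
            (- q * x powr (- q - 1) * Y x + q * X * x powr q * G x * x powr (- q))) = C * \<bar>D x\<bar> + (- s) * (q * X * G x)"
          by simp
      qed
      show "0 \<le> C * \<bar>D x\<bar> + (- s) * (q * X * G x)" using sG[of "- s" x] s by simp
    next
      have "((\<lambda>x. x powr (- q) * Y x) \<longlongrightarrow> 0) (at_right 0)"
        by (rule tendsto_0_le[OF J_lim, where K=C])
          (use xY J_nonneg in \<open>auto simp: eventually_at_right_field mult.commute intro!: exI[of _ 1]\<close>)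
      then have "((\<lambda>x. C * J x + s * (D x - x powr (- q) * Y x)) \<longlongrightarrow> C * 0 + s * (0 - 0)) (at_right 0)"
        by (intro tendsto_intros J_lim D_lim)
      then show "((\<lambda>x. C * J x + s * (D x - x powr (- q) * Y x)) \<longlongrightarrow> 0) (at_right 0)" by simp
    qed (use x in auto)
    from this[of 1] this[of "-1"] show ?thesis by auto
  qed
  have D_le: "\<bar>D x\<bar> \<le> 2 * C * J x" if x: "0 < x" "x < 1" for x
    using N_le[OF x] xY[OF x] by linarith
  have D0: "D x = 0" if x: "x \<in> {0<..<1}" for x
  proof -
    \<comment> \<open>From \<open>J' = \<bar>D\<bar> \<le> 2 * C * J\<close> the product
      \<open>J * exp (- 2 * C * x)\<close> is nonincreasing, and it starts at 0.\<close>
    have "0 \<le> - (J x * exp (- 2 * C * x))"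
    proof (rule nonneg_deriv_ge_limit[where f="\<lambda>x. - (J x * exp (- 2 * C * x))" and b=1])
      fix x :: real assume x: "0 < x" "x < 1"
      show "((\<lambda>x. - (J x * exp (- 2 * C * x))) has_real_derivative
        - (\<bar>D x\<bar> * exp (- 2 * C * x) + exp (- 2 * C * x) * (- 2 * C) * J x)) (at x)"
        using x by (intro DERIV_minus DERIV_mult DY) (auto intro!: derivative_eq_intros)
      have "- (\<bar>D x\<bar> * exp (- 2 * C * x) + exp (- 2 * C * x) * (- 2 * C) * J x) = (2 * C * J x - \<bar>D x\<bar>) * exp (- 2 * C * x)"
        by (simp add: algebra_simps)
      then show "0 \<le> - (\<bar>D x\<bar> * exp (- 2 * C * x) + exp (- 2 * C * x) * (- 2 * C) * J x)"
        using D_le[OF x] by simp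
    next
      have "((\<lambda>x. - (J x * exp (- 2 * C * x))) \<longlongrightarrow> - (0 * exp (- 2 * C * 0))) (at_right 0)"
        by (intro tendsto_intros J_lim)
      then show "((\<lambda>x. - (J x * exp (- 2 * C * x))) \<longlongrightarrow> 0) (at_right 0)" by simp
    qed (use x in auto)
    then have "J x \<le> 0" by (simp add: mult_le_0_iff)
    then have "2 * C * J x \<le> 0" using C by (simp add: mult_le_0_iff)
    then show "D x = 0" using D_le[of x] x by auto
  qed
  have "D x = 0"
    by (rule continuous_constant_on_closure[of "{0<..<1::real}" D]) (use D_cont D0 x in auto)
  then show ?thesis by (simp add: D_def)
qed

end

section \<open>The solution curve\<close>

context emden_profile begin

definition lam :: "real \<Rightarrow> real" where "lam X = X * W X powr (p - 1)"

definition alpha :: "real \<Rightarrow> real" where "alpha X = 1 / W X - 1"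

definition dom :: "real set" where "dom = {b. 0 < b \<and> 0 < W (b powr (p - 1))}"

lemma W_value_attained:
  assumes "0 \<le> b" "W b \<le> y" "y < 1"
  shows "\<exists>x>0. W x = y"
proof -
  have "\<exists>x. 0 \<le> x \<and> x \<le> b \<and> W x = y"
    using assms by (intro IVT2' continuous_on_subset[OF W_cont]) auto
  then obtain x where x: "0 \<le> x" "W x = y" by blast
  then have "x \<noteq> 0" using assms by auto
  then have "x > 0" using x by simp
  then show ?thesis using x by blast
qed

lemma W_pos_or_zero: "(\<forall>x\<ge>0. W x > 0) \<or> (\<exists>x>0. W x = 0)"
  using W_value_attained[of _ 0] by (meson not_le zero_less_one)

text \<open>\<open>dom\<close> is an initial interval because \<open>W\<close> is strictly
  decreasing. It is the whole half-line if \<open>W\<close> has no zero; otherwise it ends where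
  \<open>\<beta> powr (p - 1)\<close> reaches the zero of \<open>W\<close>.\<close>

lemma beta_star_exists:
  "\<exists>\<beta>s :: ereal. \<beta>s > 0 \<and> {b. 0 < b \<and> ereal b < \<beta>s} = dom \<and>
    (p \<ge> 2 * k + 1 \<longrightarrow> \<beta>s = \<infinity>) \<and> (p < 2 * k + 1 \<longrightarrow> \<beta>s < \<infinity>)"
proof (cases "\<forall>x\<ge>0. W x > 0")
  case True
  have "\<not> p < 2 * k + 1"
  proof
    assume "p < 2 * k + 1"
    then obtain x where "x > 0" "W x = 0" using W_zero_subcritical by blast
    then show False using True by (auto dest: spec[of _ x])
  qed
  moreover have "dom = {0<..}" using True by (auto simp: dom_def)
  ultimately show ?thesis by (intro exI[of _ \<infinity>]) auto
next
  case False
  then obtain x0 where x0: "x0 > 0" "W x0 = 0" using W_pos_or_zero by blast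
  then have "\<not> p \<ge> 2 * k + 1" using W_pos_supercritical[of x0] by auto
  define b0 where "b0 = x0 powr (1 / (p - 1))"
  have b0: "b0 > 0" "b0 powr (p - 1) = x0" using x0 p by (auto simp: b0_def powr_powr)
  have "b \<in> dom \<longleftrightarrow> b < b0" if "b > 0" for b
  proof -
    have "b < b0 \<longleftrightarrow> b powr (p - 1) < b0 powr (p - 1)"
      using that b0 p powr_less_mono2[of "p - 1" b b0] powr_mono2[of "p - 1" b0 b] by linarith
    also have "\<dots> \<longleftrightarrow> W (b powr (p - 1)) > 0"
      using W_strict_antimono[of "b powr (p - 1)" x0] W_antimono[of x0 "b powr (p - 1)"] x0 b0 by force
    finally show ?thesis using that by (simp add: dom_def)
  qed
  then have "{b. 0 < b \<and> ereal b < ereal b0} = dom" by (auto simp: dom_def)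
  then show ?thesis using b0 \<open>\<not> p \<ge> 2 * k + 1\<close> by (intro exI[of _ "ereal b0"]) auto
qed

text \<open>Without a zero of \<open>W\<close> this is the decay estimate; with a zero
  \<open>x0\<close> it follows from \<open>X < x0\<close> and \<open>W \<le> 1\<close>.\<close>

lemma lam_bounded: "\<exists>C>0. \<forall>X>0. W X > 0 \<longrightarrow> lam X \<le> C"
proof (cases "\<forall>x\<ge>0. W x > 0")
  case True
  then show ?thesis using W_decay k by (intro exI[of _ "k + 1"]) (auto simp: lam_def)
next
  case False
  then obtain x0 where x0: "x0 > 0" "W x0 = 0" using W_pos_or_zero by blast
  have "lam X \<le> x0" if "X > 0" "W X > 0" for X
  proof -
    have "X < x0" using W_antimono[of x0 X] x0 that by force
    moreover have "W X powr (p - 1) \<le> 1" using that W_le_1[of X] p by (intro powr_le1) auto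
    ultimately show ?thesis using that mult_mono[of X x0 "W X powr (p - 1)" 1] by (simp add: lam_def)
  qed
  then show ?thesis using x0 by blast
qed

lemma W_small: assumes "e > 0" shows "\<exists>X>0. 0 < W X \<and> W X < e"
proof (cases "\<forall>x\<ge>0. W x > 0")
  case True
  \<comment> \<open>At this \<open>X\<close> the decay estimate gives
    \<open>W X powr (p - 1) \<le> e powr (p - 1) / 2\<close>.\<close>
  define X where "X = 2 * (k + 1) / e powr (p - 1)"
  have X: "X > 0" using k assms by (simp add: X_def)
  have "X * W X powr (p - 1) \<le> k + 1" using W_decay True X by auto
  also have "\<dots> < X * e powr (p - 1)" using assms k by (simp add: X_def)
  finally have "W X powr (p - 1) < e powr (p - 1)" using X by simp
  then have "W X < e" using powr_mono2[of "p - 1" e "W X"] assms p by force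
  then show ?thesis using X True by auto
next
  case False
  then obtain x0 where x0: "x0 > 0" "W x0 = 0" using W_pos_or_zero by blast
  have "0 \<le> x0" "W x0 \<le> min e 1 / 2" "min e 1 / 2 < 1" using x0 assms by auto
  from W_value_attained[OF this] obtain X where "X > 0" "W X = min e 1 / 2" by blast
  then show ?thesis using assms by (intro exI[of _ X]) auto
qed

lemma W_power_lim: "((\<lambda>b. W (b powr (p - 1))) \<longlongrightarrow> 1) (at_right 0)"
  and power_lim: "((\<lambda>b. b powr (p - 1)) \<longlongrightarrow> 0) (at_right 0)"
proof -
  have "((\<lambda>b::real. b powr (p - 1)) \<longlongrightarrow> 0 powr (p - 1)) (at_right 0)"
    using p by (intro tendsto_powr') (auto intro!: tendsto_intros simp: eventually_at_filter)
  then show lim: "((\<lambda>b. b powr (p - 1)) \<longlongrightarrow> 0) (at_right 0)" by simp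
  then have "filterlim (\<lambda>b. b powr (p - 1)) (at_right 0) (at_right 0)"
    by (auto simp: filterlim_at eventually_at_filter)
  then show "((\<lambda>b. W (b powr (p - 1))) \<longlongrightarrow> 1) (at_right 0)"
    by (rule filterlim_compose[OF W_lim])
qed

lemma curve_lim: "((\<lambda>b. (lam (b powr (p - 1)), alpha (b powr (p - 1)))) \<longlongrightarrow> (0, 0)) (at_right 0)"
proof -
  have 1: "((\<lambda>b. W (b powr (p - 1)) powr (p - 1)) \<longlongrightarrow> 1 powr (p - 1)) (at_right 0)"
    by (intro tendsto_powr W_power_lim tendsto_const) auto
  have 2: "((\<lambda>b. lam (b powr (p - 1))) \<longlongrightarrow> 0 * (1 powr (p - 1))) (at_right 0)"
    unfolding lam_def by (intro tendsto_mult power_lim 1)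
  have 3: "((\<lambda>b. alpha (b powr (p - 1))) \<longlongrightarrow> 1 / 1 - 1) (at_right 0)"
    unfolding alpha_def by (intro tendsto_diff tendsto_divide W_power_lim tendsto_const) auto
  show ?thesis using tendsto_Pair[OF 2 3] by simp
qed

lemma open_dom: "open dom"
proof -
  have "continuous_on {0<..} (\<lambda>b. W (b powr (p - 1)))"
    by (intro continuous_on_compose2[OF W_cont] continuous_intros) auto
  then have "open ((\<lambda>b. W (b powr (p - 1))) -` {0<..} \<inter> {0<..})"
    by (rule continuous_on_open_vimage[OF open_greaterThan, THEN iffD1, rule_format]) auto
  moreover have "dom = (\<lambda>b. W (b powr (p - 1))) -` {0<..} \<inter> {0<..}" by (auto simp: dom_def)
  ultimately show ?thesis by simp
qed

text \<open>With \<open>A = X powr -q * Z X / W X\<close>, the functions \<open>A / \<beta>\<close>, \<open>lam / \<beta>\<close>, \<open>1 / \<beta>\<close>, \<open>lam\<close> and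
  \<open>1 / W\<close> of \<open>\<beta> = X powr (1 / (p - 1))\<close> solve a homogeneous quadratic system.\<close>

definition quad :: "real \<times> real \<times> real \<times> real \<times> real \<Rightarrow> real \<times> real \<times> real \<times> real \<times> real \<Rightarrow>
    real \<times> real \<times> real \<times> real \<times> real" where
  "quad = (\<lambda>(a, b, g, l, u) (a', b', g', l', u').
     (- g * a' - (p - 1) * q * (g * a' - g * b' - a * a'),
      - g * b' + (p - 1) * b * (g' - (p - 1) * q * a'),
      - g * g',
      (p - 1) * l * (g' - (p - 1) * q * a'),
      (p - 1) * q * a * u'))"

lemma bounded_bilinear_quad: "bounded_bilinear quad"
  unfolding bilinear_conv_bounded_bilinear[symmetric] bilinear_def
  by (auto simp: quad_def split_beta intro!: linearI simp: algebra_simps)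

definition quad_sol :: "real \<Rightarrow> real \<times> real \<times> real \<times> real \<times> real" where
  "quad_sol b = (let X = b powr (p - 1) in
     (X powr (- q) * Z X / W X / b, lam X / b, 1 / b, lam X, 1 / W X))"

text \<open>Since the logarithmic derivative \<open>X * W' / W\<close> is \<open>- q * A\<close>,
  the derivatives in \<open>\<beta>\<close> are polynomial:
  \<open>\<beta> * A' = (p - 1) * q * (lam - A + A^2)\<close> and
  \<open>\<beta> * lam' = (p - 1) * lam * (1 - (p - 1) * q * A)\<close>. Dividing by
  \<open>\<beta>\<close>, with \<open>1 / \<beta>\<close> as a further unknown, makes the system
  homogeneous of degree two.\<close>

lemma quad_sol_deriv:
  assumes "b \<in> dom"
  shows "(quad_sol has_vector_derivative quad (quad_sol b) (quad_sol b)) (at b)"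
proof -
  define X where "X = b powr (p - 1)"
  have b: "b > 0" and X: "X > 0" and W: "W X > 0" using assms by (auto simp: dom_def X_def)
  have gW: "g (W X) = W X powr p" using cut_powr_eq W_le_1[of X] X W by simp
  define P where "P = (\<lambda>b. b powr (p - 1))"
  have PX: "P b = X" by (simp add: P_def X_def)
  have dP: "(P has_real_derivative (p - 1) * X / b) (at b)"
  proof -
    have e: "(p - 1) * X / b = (p - 1) * b powr (p - 1 - 1)" using b by (simp add: X_def powr_diff power2_eq_square)
    show ?thesis unfolding P_def e using b by (auto intro!: derivative_eq_intros)
  qed
  define x where "x = X powr (- q)"
  define w where "w = W X powr (p - 1)"
  have x: "x > 0" using X by (simp add: x_def)
  have xx: "X powr (- q - 1) = x / X" "X powr (- 1 - q) = x / X" "X powr q = 1 / x"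
    using X by (auto simp: x_def powr_diff powr_minus field_simps)
  have ww: "W X powr p = w * W X" "W X powr (p - 1 - 1) = w / W X" using W by (auto simp: w_def powr_diff power2_eq_square)
  have dW: "((\<lambda>b. W (P b)) has_real_derivative (- q * (x / X) * Z X) * ((p - 1) * X / b)) (at b)"
    using DERIV_chain2[OF W_deriv dP] X unfolding PX xx by simp
  have dZ: "((\<lambda>b. Z (P b)) has_real_derivative (q * (1 / x) * (w * W X)) * ((p - 1) * X / b)) (at b)"
    using DERIV_chain2[OF Z_deriv dP] X unfolding PX xx gW ww by simp
  have dq: "((\<lambda>b. P b powr (- q)) has_real_derivative (- q * (x / X)) * ((p - 1) * X / b)) (at b)"
  proof -
    have "((\<lambda>x. x powr (- q)) has_real_derivative - q * (x / X)) (at (P b))"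
      unfolding PX xx(1)[symmetric] using X by (auto intro!: derivative_eq_intros)
    from DERIV_chain2[OF this dP] show ?thesis .
  qed
  have dl: "((\<lambda>b. lam (P b)) has_real_derivative
      ((p - 1) * X / b) * w + ((p - 1) * (w / W X) * ((- q * (x / X) * Z X) * ((p - 1) * X / b))) * X) (at b)"
  proof -
    have "((\<lambda>b. W (P b) powr (p - 1)) has_real_derivative
        (p - 1) * (w / W X) * ((- q * (x / X) * Z X) * ((p - 1) * X / b))) (at b)"
    proof -
      have "((\<lambda>x. x powr (p - 1)) has_real_derivative (p - 1) * (w / W X)) (at (W (P b)))"
        unfolding PX ww(2)[symmetric] using W by (auto intro!: derivative_eq_intros)
      from DERIV_chain2[OF this dW] show ?thesis .
    qed
    from DERIV_mult[OF dP this] show ?thesis unfolding lam_def PX w_def by simp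
  qed
  have lamX: "lam X = X * w" by (simp add: lam_def w_def)
  define A where "A = x * Z X / W X"
  have sol: "quad_sol b = (A / b, X * w / b, 1 / b, X * w, 1 / W X)"
    by (simp add: quad_sol_def Let_def X_def[symmetric] x_def[symmetric] lamX A_def)
  have nz: "b \<noteq> 0" "X \<noteq> 0" "W X \<noteq> 0" "x \<noteq> 0" using b X W x by auto
  have alg: "(((((- q * (x / X)) * (c * X / b)) * Z + (q * (1 / x) * (w * W)) * (c * X / b) * x) * W
        - (x * Z) * ((- q * (x / X) * Z) * (c * X / b))) / (W * W) * b - (x * Z / W) * 1) / (b * b)
     = - (1 / b) * (x * Z / W / b) - c * q * ((1 / b) * (x * Z / W / b) - (1 / b) * (X * w / b) - (x * Z / W / b) * (x * Z / W / b))"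
    if "W \<noteq> 0" for c W Z w :: real
    using that nz by (simp add: field_simps)
  have 1: "((\<lambda>b. P b powr (- q) * Z (P b) / W (P b) / b) has_real_derivative
      fst (quad (quad_sol b) (quad_sol b))) (at b)"
  proof -
    have "((\<lambda>b. P b powr (- q) * Z (P b) / W (P b) / b) has_real_derivative
      (((((- q * (x / X)) * ((p - 1) * X / b)) * Z X + (q * (1 / x) * (w * W X)) * ((p - 1) * X / b) * x) * W X
        - (x * Z X) * ((- q * (x / X) * Z X) * ((p - 1) * X / b))) / (W X * W X) * b - (x * Z X / W X) * 1) / (b * b)) (at b)"
      using DERIV_divide[OF DERIV_divide[OF DERIV_mult[OF dq dZ] dW] DERIV_ident[of "at b"]] nz
      unfolding PX x_def by blast
    then show ?thesis unfolding alg[OF nz(3)] by (simp add: sol quad_def A_def mult_ac)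
  qed
  have dl': "((\<lambda>b. lam (P b)) has_real_derivative (p - 1) * (X * w) * (1 / b - (p - 1) * q * (A / b))) (at b)"
  proof (rule DERIV_cong[OF dl])
    show "((p - 1) * X / b) * w + ((p - 1) * (w / W X) * ((- q * (x / X) * Z X) * ((p - 1) * X / b))) * X
      = (p - 1) * (X * w) * (1 / b - (p - 1) * q * (A / b))"
    proof -
      have "(c * X / b) * w + (c * (w / W X) * ((- q * (x / X) * Z X) * (c * X / b))) * X
        = c * (X * w) * (1 / b - c * q * (A / b))" for c
        unfolding A_def using nz by (simp add: field_simps)
      then show ?thesis .
    qed
  qed
  have 4: "((\<lambda>b. lam (P b)) has_real_derivative fst (snd (snd (snd (quad (quad_sol b) (quad_sol b)))))) (at b)"
    using dl' by (simp add: sol quad_def)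
  have 2: "((\<lambda>b. lam (P b) / b) has_real_derivative fst (snd (quad (quad_sol b) (quad_sol b)))) (at b)"
  proof (rule DERIV_cong[OF DERIV_divide[OF dl' DERIV_ident]])
    show "((p - 1) * (X * w) * (1 / b - (p - 1) * q * (A / b)) * b - lam (P b) * 1) / (b * b) =
        fst (snd (quad (quad_sol b) (quad_sol b)))"
    proof -
      have "(c * (X * w) * (1 / b - c * q * (A / b)) * b - X * w * 1) / (b * b) =
          - (1 / b) * (X * w / b) + c * (X * w / b) * (1 / b - c * q * (A / b))" for c
        using nz by (simp add: field_simps)
      then show ?thesis by (simp add: sol quad_def PX lamX)
    qed
  qed (use b in auto)
  have 3: "((\<lambda>b. 1 / b) has_real_derivative fst (snd (snd (quad (quad_sol b) (quad_sol b))))) (at b)"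
    using b by (auto intro!: derivative_eq_intros simp: sol quad_def)
  have 5: "((\<lambda>b. 1 / W (P b)) has_real_derivative snd (snd (snd (snd (quad (quad_sol b) (quad_sol b)))))) (at b)"
  proof (rule DERIV_cong[OF DERIV_divide[OF DERIV_const dW]])
    show "(0 * W (P b) - 1 * ((- q * (x / X) * Z X) * ((p - 1) * X / b))) / (W (P b) * W (P b)) =
        snd (snd (snd (snd (quad (quad_sol b) (quad_sol b)))))"
      unfolding PX using nz by (simp add: sol quad_def A_def mult_ac)
  qed (use W PX in auto)
  have eq: "quad_sol = (\<lambda>b. (P b powr (- q) * Z (P b) / W (P b) / b, lam (P b) / b, 1 / b, lam (P b), 1 / W (P b)))"
    by (auto simp: quad_sol_def Let_def P_def)
  have "(quad_sol has_vector_derivative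
      (fst (quad (quad_sol b) (quad_sol b)), fst (snd (quad (quad_sol b) (quad_sol b))),
       fst (snd (snd (quad (quad_sol b) (quad_sol b)))), fst (snd (snd (snd (quad (quad_sol b) (quad_sol b))))),
       snd (snd (snd (snd (quad (quad_sol b) (quad_sol b))))))) (at b)"
    by (subst eq) (intro has_vector_derivative_Pair
        1[unfolded has_real_derivative_iff_has_vector_derivative]
        2[unfolded has_real_derivative_iff_has_vector_derivative]
        3[unfolded has_real_derivative_iff_has_vector_derivative]
        4[unfolded has_real_derivative_iff_has_vector_derivative]
        5[unfolded has_real_derivative_iff_has_vector_derivative])
  then show ?thesis by simp
qed

lemma curve_analytic:
  "real_analytic_on (\<lambda>b. (lam (b powr (p - 1)), alpha (b powr (p - 1)))) dom"
proof -
  have an: "real_analytic_on quad_sol dom"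
    by (rule real_analytic_quadratic_ODE[OF bounded_bilinear_quad open_dom quad_sol_deriv])
  have bl: "bounded_linear (\<lambda>z :: real \<times> real \<times> real \<times> real \<times> real. snd (snd (snd z)))"
    by (intro bounded_linear_compose[OF bounded_linear_snd] bounded_linear_ident)
  have "real_analytic_on (\<lambda>b. snd (snd (snd (quad_sol b))) - (0, 1)) dom"
    by (rule real_analytic_on_diff_const[OF real_analytic_on_bounded_linear[OF bl an]])
  then show ?thesis
    by (simp add: quad_sol_def Let_def alpha_def)
qed

end

section \<open>Smooth functions\<close>

primrec Cm :: "nat \<Rightarrow> real set \<Rightarrow> (real \<Rightarrow> real) \<Rightarrow> bool" where
  "Cm 0 S f \<longleftrightarrow> continuous_on S f"
| "Cm (Suc m) S f \<longleftrightarrow> (\<forall>x\<in>S. (f has_real_derivative deriv f x) (at x)) \<and> Cm m S (deriv f)"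

lemma Cm_cong: "open S \<Longrightarrow> (\<And>x. x \<in> S \<Longrightarrow> f x = g x) \<Longrightarrow> Cm m S f \<Longrightarrow> Cm m S g"
proof (induction m arbitrary: f g)
  case 0
  then show ?case using continuous_on_cong[of S S f g] by simp
next
  case (Suc m)
  have d: "(g has_real_derivative deriv f x) (at x)" if "x \<in> S" for x
    using Suc.prems that has_field_derivative_transform_within_open[of f "deriv f x" x S g] by auto
  have e: "deriv f x = deriv g x" if "x \<in> S" for x using d[OF that] by (simp add: DERIV_imp_deriv)
  show ?case using d e Suc.IH[of "deriv f" "deriv g"] Suc.prems by auto
qed

lemma Cm_SucI:
  assumes "open S" "\<And>x. x \<in> S \<Longrightarrow> (f has_real_derivative f' x) (at x)" "Cm m S f'"
  shows "Cm (Suc m) S f"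
proof -
  have e: "f' x = deriv f x" if "x \<in> S" for x using assms(2)[OF that] by (simp add: DERIV_imp_deriv)
  show ?thesis using assms e Cm_cong[OF assms(1), of f' "deriv f" m] by auto
qed

lemma Cm_SucD: "Cm (Suc m) S f \<Longrightarrow> Cm m S f"
proof (induction m arbitrary: f)
  case 0
  then have "\<forall>x\<in>S. (f has_real_derivative deriv f x) (at x)" by simp
  then show ?case
    by (auto intro!: continuous_at_imp_continuous_on dest: DERIV_isCont)
qed auto

lemma Cm_const: "open S \<Longrightarrow> Cm m S (\<lambda>x. c)"
  by (induction m arbitrary: c) (auto intro!: Cm_SucI[where f'="\<lambda>_. 0"] simp del: Cm.simps(2))

lemma Cm_ident: "open S \<Longrightarrow> Cm m S (\<lambda>x. x)"
  by (cases m) (auto intro!: Cm_SucI[where f'="\<lambda>_. 1"] Cm_const simp del: Cm.simps(2))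

lemma Cm_add: "open S \<Longrightarrow> Cm m S f \<Longrightarrow> Cm m S g \<Longrightarrow> Cm m S (\<lambda>x. f x + g x)"
proof (induction m arbitrary: f g)
  case (Suc m)
  then show ?case
    by (intro Cm_SucI[where f'="\<lambda>x. deriv f x + deriv g x"]) (auto intro!: derivative_intros)
qed (auto intro: continuous_intros)

lemma Cm_mult: "open S \<Longrightarrow> Cm m S f \<Longrightarrow> Cm m S g \<Longrightarrow> Cm m S (\<lambda>x. f x * g x)"
proof (induction m arbitrary: f g)
  case (Suc m)
  then show ?case using Suc.prems(2,3)[THEN Cm_SucD]
    by (intro Cm_SucI[where f'="\<lambda>x. deriv f x * g x + deriv g x * f x"] Cm_add)
      (auto intro!: DERIV_mult)
qed (auto intro: continuous_intros)

lemma Cm_cmult: "open S \<Longrightarrow> Cm m S f \<Longrightarrow> Cm m S (\<lambda>x. c * f x)"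
  by (intro Cm_mult Cm_const)

lemma Cm_diff: "open S \<Longrightarrow> Cm m S f \<Longrightarrow> Cm m S g \<Longrightarrow> Cm m S (\<lambda>x. f x - g x)"
  using Cm_add[of S m f "\<lambda>x. (-1) * g x"] Cm_cmult[of S m g "-1"] by simp

lemma Cm_compose:
  "open S \<Longrightarrow> Cm m T f \<Longrightarrow> Cm m S h \<Longrightarrow> (\<And>x. x \<in> S \<Longrightarrow> h x \<in> T) \<Longrightarrow> Cm m S (\<lambda>x. f (h x))"
proof (induction m arbitrary: f h)
  case 0
  then show ?case by (auto intro: continuous_on_compose2[of T f])
next
  case (Suc m)
  then show ?case using Suc.prems(3)[THEN Cm_SucD]
    by (intro Cm_SucI[where f'="\<lambda>x. deriv f (h x) * deriv h x"] Cm_mult)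
      (auto intro!: DERIV_chain2[where f=f and g=h])
qed

lemma Cm_subset: "Cm m S f \<Longrightarrow> T \<subseteq> S \<Longrightarrow> Cm m T f"
  by (induction m arbitrary: f) (auto intro: continuous_on_subset)

lemma Cm_Un: "open S \<Longrightarrow> open T \<Longrightarrow> Cm m S f \<Longrightarrow> Cm m T f \<Longrightarrow> Cm m (S \<union> T) f"
  by (induction m arbitrary: f) (auto intro: continuous_on_open_Un)

lemma Cm_powr: "Cm m {0<..} (\<lambda>x. x powr a)"
proof (induction m arbitrary: a)
  case (Suc m)
  show ?case
    by (intro Cm_SucI[where f'="\<lambda>x. a * x powr (a - 1)"] Cm_cmult Suc)
      (auto intro!: derivative_eq_intros)
qed (auto intro!: continuous_intros)

lemma Cm_ln: "Cm m {0<..} ln"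
proof (cases m)
  case (Suc n)
  then show ?thesis
    by (auto intro!: Cm_SucI[where f'="\<lambda>x. x powr - 1"] Cm_powr derivative_eq_intros
        simp: powr_minus inverse_eq_divide simp del: Cm.simps(2))
qed (auto intro!: continuous_intros)

text \<open>The powers of \<open>1 / x\<close> make the family closed under differentiation up to
  linear combinations, so that smoothness is one induction over all indices.\<close>

definition flat_exp :: "nat \<Rightarrow> real \<Rightarrow> real" where
  "flat_exp n x = (if x \<le> 0 then 0 else (1 / x) ^ n * exp (- 1 / x))"

lemma flat_exp_deriv:
  "(flat_exp n has_real_derivative flat_exp (n + 2) x - real n * flat_exp (n + 1) x) (at x)"
proof -
  consider "x < 0" | "x > 0" | "x = 0" by linarith
  then show ?thesis
  proof cases
    case 1
    have "(flat_exp n has_real_derivative 0) (at x)"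
      by (rule has_field_derivative_transform_within_open[of "\<lambda>_. 0" _ _ "{..<0}"])
        (use 1 in \<open>auto simp: flat_exp_def\<close>)
    then show ?thesis using 1 by (simp add: flat_exp_def)
  next
    case 2
    have "((\<lambda>x. (1 / x) ^ n * exp (- 1 / x)) has_real_derivative
        real n * ((1 / x) ^ (n - 1) * (- 1 / x\<^sup>2)) * exp (- 1 / x) + exp (- 1 / x) * (1 / x\<^sup>2) * (1 / x) ^ n) (at x)"
      using 2 by (intro DERIV_mult) (auto intro!: derivative_eq_intros simp: power2_eq_square)
    also have "real n * ((1 / x) ^ (n - 1) * (- 1 / x\<^sup>2)) * exp (- 1 / x) + exp (- 1 / x) * (1 / x\<^sup>2) * (1 / x) ^ n
        = flat_exp (n + 2) x - real n * flat_exp (n + 1) x"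
      using 2 by (cases n) (auto simp: flat_exp_def field_simps power2_eq_square)
    finally show ?thesis
      by (rule has_field_derivative_transform_within_open[of _ _ _ "{0<..}"]) (use 2 in \<open>auto simp: flat_exp_def\<close>)
  next
    case 3
    \<comment> \<open>At the junction the difference quotient from the right is
      \<open>flat_exp (n + 1)\<close>; the exponential beats every power of
      \<open>1 / x\<close>.\<close>
    have "((\<lambda>x. inverse x ^ Suc n / exp (inverse x)) \<longlongrightarrow> (0::real)) (at_right 0)"
      by (rule filterlim_compose[OF tendsto_power_div_exp_0 filterlim_inverse_at_top_right])
    then have R: "((\<lambda>h. flat_exp n h / h) \<longlongrightarrow> 0) (at_right 0)"
      by (rule Lim_transform_eventually)
        (auto simp: eventually_at_right_field flat_exp_def exp_minus field_simps intro!: exI[of _ 1])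
    have L: "((\<lambda>h. flat_exp n h / h) \<longlongrightarrow> 0) (at_left 0)"
      by (rule Lim_transform_eventually[OF tendsto_const])
        (auto simp: eventually_at_left_field flat_exp_def intro!: exI[of _ "-1"])
    have "((\<lambda>h. (flat_exp n (0 + h) - flat_exp n 0) / h) \<longlongrightarrow> 0) (at 0)"
      using filterlim_split_at[OF L R] by (simp add: flat_exp_def)
    then have "(flat_exp n has_real_derivative 0) (at 0)" by (simp add: DERIV_def)
    then show ?thesis using 3 by (simp add: flat_exp_def)
  qed
qed

lemma Cm_flat_exp: "Cm m UNIV (flat_exp n)"
proof (induction m arbitrary: n)
  case 0
  then show ?case using flat_exp_deriv[of n]
    by (auto intro!: continuous_at_imp_continuous_on dest: DERIV_isCont)
next
  case (Suc m)
  then show ?case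
    by (intro Cm_SucI[OF _ flat_exp_deriv] Cm_diff Cm_cmult) auto
qed

text \<open>\<open>y \<mapsto> \<theta> (n * y) / n\<close> is a smooth approximation of the positive part, exact away from
  the origin and with derivatives bounded uniformly in \<open>n\<close>.\<close>

lemma smooth_truncation_exists:
  "\<exists>\<theta> K. (\<forall>m. Cm m UNIV \<theta>) \<and> (\<forall>y\<le>1. \<theta> y = 0) \<and> (\<forall>y\<ge>2. \<theta> y = y) \<and>
     (\<forall>y. \<bar>\<theta> y\<bar> \<le> \<bar>y\<bar>) \<and> (\<forall>y. \<bar>deriv \<theta> y\<bar> \<le> K)"
proof -
  define e where "e = flat_exp 0"
  have e_nn: "e x \<ge> 0" and e0: "x \<le> 0 \<Longrightarrow> e x = 0" and e_pos: "x > 0 \<Longrightarrow> e x > 0" for x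
    by (auto simp: e_def flat_exp_def)
  have den: "e x + e (1 - x) > 0" for x
    using e_nn[of x] e_nn[of "1 - x"] e_pos[of x] e_pos[of "1 - x"] by (cases "x > 0") auto
  \<comment> \<open>A smooth step, 0 for \<open>x \<le> 0\<close> and 1 for
    \<open>x \<ge> 1\<close>. The quotient is written with \<open>powr - 1\<close> so that
    smoothness follows from \<open>Cm_powr\<close>.\<close>
  define s where "s = (\<lambda>x. e x * (e x + e (1 - x)) powr - 1)"
  have s: "s x = e x / (e x + e (1 - x))" for x
    using den[of x] by (simp add: s_def powr_minus divide_inverse)
  have Ce: "Cm m UNIV e" for m unfolding e_def by (rule Cm_flat_exp)
  have Ce1: "Cm m UNIV (\<lambda>x. e (1 - x))" for m
    by (rule Cm_compose[OF _ Ce]) (auto intro!: Cm_diff Cm_const Cm_ident)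
  have Cs: "Cm m UNIV s" for m unfolding s_def
    by (intro Cm_mult Ce Cm_compose[OF _ Cm_powr] Cm_add Ce1) (auto simp: den)
  define \<theta> where "\<theta> = (\<lambda>y. y * s (y - 1))"
  have C: "Cm m UNIV \<theta>" for m unfolding \<theta>_def
    by (intro Cm_mult Cm_ident Cm_compose[OF _ Cs] Cm_diff Cm_const) auto
  have th0: "\<theta> y = 0" if "y \<le> 1" for y using that by (simp add: \<theta>_def s e0)
  have th1: "\<theta> y = y" if "y \<ge> 2" for y
    using that den[of "y - 1"] by (simp add: \<theta>_def s e0)
  have s01: "0 \<le> s x" "s x \<le> 1" for x using e_nn[of x] e_nn[of "1 - x"] den[of x] by (auto simp: s)
  have le: "\<bar>\<theta> y\<bar> \<le> \<bar>y\<bar>" for y unfolding \<theta>_def abs_mult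
    using s01[of "y - 1"] by (simp add: mult_left_le)
  have "continuous_on UNIV (deriv \<theta>)" using C[of "Suc 0"] by simp
  then have "compact (deriv \<theta> ` {1..2})"
    by (intro compact_continuous_image) (auto intro: continuous_on_subset)
  then obtain K where K: "\<And>y. y \<in> {1..2} \<Longrightarrow> \<bar>deriv \<theta> y\<bar> \<le> K"
    using compact_imp_bounded bounded_iff by (metis image_eqI real_norm_def)
  \<comment> \<open>Outside the compact transition interval \<open>[1, 2]\<close> the derivative is
    0 or 1.\<close>
  have "\<bar>deriv \<theta> y\<bar> \<le> max K 1" for y
  proof -
    consider "y < 1" | "y > 2" | "y \<in> {1..2}" by force
    then show ?thesis
    proof cases
      case 1
      have "(\<theta> has_real_derivative 0) (at y)"
        by (rule has_field_derivative_transform_within_open[of "\<lambda>_. 0" _ _ "{..<1}"]) (use 1 th0 in auto)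
      then show ?thesis by (simp add: DERIV_imp_deriv)
    next
      case 2
      have "(\<theta> has_real_derivative 1) (at y)"
        by (rule has_field_derivative_transform_within_open[of "\<lambda>x. x" _ _ "{2<..}"]) (use 2 th1 in auto)
      then show ?thesis by (simp add: DERIV_imp_deriv)
    qed (use K in fastforce)
  qed
  then show ?thesis using C th0 th1 le by blast
qed

section \<open>Smooth functions of several variables and their gradients\<close>

lemma Ck_SucI:
  assumes "\<And>x. (f has_derivative f' x) (at x)" "\<And>b. b \<in> Basis \<Longrightarrow> Ck m (\<lambda>x. f' x b)"
  shows "Ck (Suc m) f"
proof -
  have "frechet_derivative f (at x) = f' x" for x using assms(1) frechet_derivative_at by metis
  then show ?thesis using assms by (auto simp: differentiable_on_def intro: differentiableI)
qed

lemma Ck_has_derivative: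
  assumes "Ck (Suc m) f"
  shows "(f has_derivative frechet_derivative f (at x)) (at x)"
  using assms frechet_derivative_works[of f "at x"] by (auto simp: differentiable_on_def)

lemma Ck_SucD: "Ck (Suc m) f \<Longrightarrow> Ck m f"
proof (induction m arbitrary: f)
  case 0
  then show ?case by (auto intro: differentiable_imp_continuous_on)
qed auto

lemma Ck_const: "Ck m (\<lambda>x. c)"
  by (induction m arbitrary: c) (auto intro!: Ck_SucI[where f'="\<lambda>_ _. 0"] simp del: Ck.simps(2))

lemma Ck_inner: "Ck m (\<lambda>x. c * (x \<bullet> b))"
proof (cases m)
  case (Suc n)
  have "((\<lambda>x. c * (x \<bullet> b)) has_derivative (\<lambda>h. c * (h \<bullet> b))) (at x)" for x
    by (auto intro!: derivative_eq_intros)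
  then show ?thesis unfolding Suc by (rule Ck_SucI) (rule Ck_const)
qed (auto intro!: continuous_intros)

lemma Ck_add: "Ck m f \<Longrightarrow> Ck m g \<Longrightarrow> Ck m (\<lambda>x. f x + g x)"
proof (induction m arbitrary: f g)
  case (Suc m)
  show ?case
    by (rule Ck_SucI[OF has_derivative_add[OF Suc.prems[THEN Ck_has_derivative]]])
      (use Suc in auto)
qed (auto intro: continuous_intros)

lemma Ck_mult: "Ck m f \<Longrightarrow> Ck m g \<Longrightarrow> Ck m (\<lambda>x. f x * g x)"
proof (induction m arbitrary: f g)
  case (Suc m)
  show ?case
    by (rule Ck_SucI[OF has_derivative_mult[OF Suc.prems[THEN Ck_has_derivative]]])
      (use Suc Suc.prems[THEN Ck_SucD] in \<open>auto intro!: Ck_add\<close>)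
qed (auto intro: continuous_intros)

text \<open>The argument is \<open>x \<bullet> x\<close> and not the norm, since only the former is
  smooth at the origin. A partial derivative is a function of \<open>x \<bullet> x\<close> times a
  linear one, and the former satisfies the same hypothesis, which asks for all orders at
  once.\<close>

lemma Ck_radial: "(\<And>m. Cm m UNIV \<Phi>) \<Longrightarrow> Ck m (\<lambda>x. \<Phi> (x \<bullet> x))"
proof (induction m arbitrary: \<Phi>)
  case 0
  have "continuous_on UNIV \<Phi>" using 0[of 0] by simp
  then show ?case by (auto intro!: continuous_on_compose2[where g=\<Phi> and t=UNIV] continuous_intros)
next
  case (Suc m)
  have d: "(\<Phi> has_real_derivative deriv \<Phi> s) (at s)" for s using Suc.prems[of "Suc 0"] by simp
  have "((\<lambda>x. \<Phi> (x \<bullet> x)) has_derivative (\<lambda>h. deriv \<Phi> (x \<bullet> x) * (2 * (x \<bullet> h)))) (at x)" for x :: 'a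
  proof -
    have "((\<lambda>x. x \<bullet> x) has_derivative (\<lambda>h. 2 * (x \<bullet> h))) (at x)"
      by (auto intro!: derivative_eq_intros simp: inner_commute)
    from has_derivative_compose[OF this d[unfolded has_field_derivative_def]] show ?thesis .
  qed
  then show ?case
  proof (rule Ck_SucI)
    fix b :: 'a
    show "Ck m (\<lambda>x. deriv \<Phi> (x \<bullet> x) * (2 * (x \<bullet> b)))"
      using Suc.prems[of "Suc _"] by (intro Ck_mult Ck_inner Suc.IH) auto
  qed
qed

lemma grad_eq:
  assumes "(f has_derivative (\<lambda>h. v \<bullet> h)) (at x)"
  shows "grad f x = v"
  unfolding grad_def frechet_derivative_at[OF assms, symmetric]
  by (simp add: euclidean_representation)

lemma has_derivative_grad:
  assumes "Ck (Suc m) f"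
  shows "(f has_derivative (\<lambda>h. grad f x \<bullet> h)) (at x)"
proof -
  note d = Ck_has_derivative[OF assms, of x]
  interpret bounded_linear "frechet_derivative f (at x)" using d by (rule has_derivative_bounded_linear)
  have "frechet_derivative f (at x) h = grad f x \<bullet> h" for h
  proof -
    have "frechet_derivative f (at x) h = frechet_derivative f (at x) (\<Sum>b\<in>Basis. (h \<bullet> b) *\<^sub>R b)"
      by (simp add: euclidean_representation)
    also have "\<dots> = (\<Sum>b\<in>Basis. (h \<bullet> b) * frechet_derivative f (at x) b)" by (simp add: sum scaleR)
    also have "\<dots> = grad f x \<bullet> h"
      unfolding grad_def inner_sum_left by (intro sum.cong) (auto simp: inner_commute)
    finally show ?thesis .
  qed
  then have "frechet_derivative f (at x) = (\<lambda>h. grad f x \<bullet> h)" by (rule ext)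
  with d show ?thesis by simp
qed

lemma continuous_on_grad:
  assumes "Ck (Suc 0) f" shows "continuous_on UNIV (grad f)"
  unfolding grad_def[abs_def] using assms by (auto intro!: continuous_intros)

section \<open>Radial vector fields on the disc\<close>

text \<open>Turns uniform bounds of integrals into integrability of the almost everywhere limit, for
  the steps in which no dominating function is at hand.\<close>

lemma integrable_Fatou:
  fixes f :: "nat \<Rightarrow> 'a \<Rightarrow> real"
  assumes f: "\<And>n. integrable M (f n)" and nn: "\<And>n. AE x in M. 0 \<le> f n x"
    and bd: "\<And>n. integral\<^sup>L M (f n) \<le> C"
    and lim: "AE x in M. (\<lambda>n. f n x) \<longlonglongrightarrow> u x" and u: "u \<in> borel_measurable M"
  shows "integrable M u" and "integral\<^sup>L M u \<le> C"
proof -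
  have C: "C \<ge> 0" using integral_nonneg_AE[OF nn[of 0]] bd[of 0] by linarith
  have u0: "AE x in M. 0 \<le> u x"
  proof -
    have "AE x in M. \<forall>n. 0 \<le> f n x" using nn by (simp add: AE_all_countable)
    then show ?thesis using lim
      by eventually_elim (rule LIMSEQ_le_const, auto)
  qed
  have "(\<integral>\<^sup>+x. ennreal (u x) \<partial>M) = (\<integral>\<^sup>+x. liminf (\<lambda>n. ennreal (f n x)) \<partial>M)"
  proof (rule nn_integral_cong_AE)
    show "AE x in M. ennreal (u x) = liminf (\<lambda>n. ennreal (f n x))"
      using lim
    proof eventually_elim
      case (elim x)
      then have "(\<lambda>n. ennreal (f n x)) \<longlonglongrightarrow> ennreal (u x)" by (rule tendsto_ennrealI)
      then show ?case by (rule lim_imp_Liminf[symmetric, rotated]) auto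
    qed
  qed
  also have "\<dots> \<le> liminf (\<lambda>n. \<integral>\<^sup>+x. ennreal (f n x) \<partial>M)"
    using f by (intro nn_integral_liminf) (auto intro!: measurable_compose[OF _ measurable_ennreal])
  also have "\<dots> \<le> ennreal C"
  proof (rule Liminf_le, simp, rule always_eventually, rule allI)
    fix n
    have "(\<integral>\<^sup>+x. ennreal (f n x) \<partial>M) = ennreal (integral\<^sup>L M (f n))"
      by (rule nn_integral_eq_integral[OF f nn])
    then show "(\<integral>\<^sup>+x. ennreal (f n x) \<partial>M) \<le> ennreal C" using bd[of n] by (simp add: ennreal_leI)
  qed
  finally have le: "(\<integral>\<^sup>+x. ennreal (u x) \<partial>M) \<le> ennreal C" .
  show "integrable M u"
    by (rule integrableI_nonneg[OF u u0]) (use le in \<open>auto simp: ennreal_less_top order_le_less_trans\<close>)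
  show "integral\<^sup>L M u \<le> C"
    unfolding integral_eq_nn_integral[OF u u0] using le C by (simp add: enn2real_leI)
qed

text \<open>The difference quotients have integral zero by translation invariance.\<close>

lemma integral_partial_derivative_compact_support:
  fixes \<psi> :: "'a::euclidean_space \<Rightarrow> real"
  assumes d: "\<And>x. (\<psi> has_derivative \<psi>' x) (at x)" and c: "continuous_on UNIV (\<lambda>x. \<psi>' x b)"
    and K: "compact K" "\<And>x. x \<notin> K \<Longrightarrow> \<psi> x = 0" "\<And>x. x \<notin> K \<Longrightarrow> \<psi>' x b = 0"
  shows "has_bochner_integral lborel (\<lambda>x. \<psi>' x b) 0"
proof -
  have \<psi>c: "continuous_on UNIV \<psi>"
    using d by (auto intro!: continuous_at_imp_continuous_on has_derivative_continuous)
  have int_supp: "integrable lborel f" if "continuous_on UNIV f" "\<And>x. x \<notin> K \<Longrightarrow> f x = 0" for f :: "'a \<Rightarrow> real"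
  proof -
    have "integrable lborel (\<lambda>x. indicator K x *\<^sub>R f x)"
      by (rule borel_integrable_compact) (use K that in \<open>auto intro: continuous_on_subset\<close>)
    also have "(\<lambda>x. indicator K x *\<^sub>R f x) = f" using that by (auto simp: indicator_def fun_eq_iff)
    finally show ?thesis .
  qed
  have "bounded ((\<lambda>x. \<psi>' x b) ` K)"
    by (intro compact_imp_bounded compact_continuous_image continuous_on_subset[OF c] K) auto
  then obtain M where "M > 0" "\<And>x. x \<in> K \<Longrightarrow> \<bar>\<psi>' x b\<bar> \<le> M"
    by (auto simp: bounded_pos)
  then have M: "M > 0" "\<bar>\<psi>' x b\<bar> \<le> M" for x using K(3)[of x] by (cases "x \<in> K", auto)+
  obtain R where R: "\<And>x. x \<in> K \<Longrightarrow> norm x \<le> R" using K compact_imp_bounded bounded_iff by metis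
  define f where "f = (\<lambda>n x. real (Suc n) * (\<psi> (x + (1 / real (Suc n)) *\<^sub>R b) - \<psi> x))"
  have line: "((\<lambda>s. \<psi> (x + s *\<^sub>R b)) has_real_derivative \<psi>' (x + s *\<^sub>R b) b) (at s)" for x s
  proof -
    have "((\<lambda>s. x + s *\<^sub>R b) has_derivative (\<lambda>h. h *\<^sub>R b)) (at s)" by (auto intro!: derivative_eq_intros)
    from has_derivative_compose[OF this d]
    have "((\<lambda>s. \<psi> (x + s *\<^sub>R b)) has_derivative (\<lambda>h. \<psi>' (x + s *\<^sub>R b) (h *\<^sub>R b))) (at s)" .
    moreover have "(\<lambda>h. \<psi>' (x + s *\<^sub>R b) (h *\<^sub>R b)) = (*) (\<psi>' (x + s *\<^sub>R b) b)"
      using linear_scale[OF has_derivative_linear[OF d]] by (auto simp: mult.commute)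
    ultimately show ?thesis by (simp add: has_field_derivative_def)
  qed
  \<comment> \<open>By the mean value theorem the quotient is a value of the derivative; it vanishes
    outside the enlarged ball because the translations have length at most
    \<open>norm b\<close>.\<close>
  have bound: "\<bar>f n x\<bar> \<le> M * indicator (cball 0 (R + norm b)) x" for n x
  proof (cases "x \<in> cball 0 (R + norm b)")
    case True
    define e where "e = 1 / real (Suc n)"
    have e: "e > 0" by (simp add: e_def)
    have "\<exists>z>0. z < e \<and> \<psi> (x + e *\<^sub>R b) - \<psi> (x + 0 *\<^sub>R b) = (e - 0) * \<psi>' (x + z *\<^sub>R b) b"
      by (rule MVT2[OF e]) (use line in auto)
    then obtain z where "\<psi> (x + e *\<^sub>R b) - \<psi> x = e * \<psi>' (x + z *\<^sub>R b) b" by auto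
    then have "f n x = \<psi>' (x + z *\<^sub>R b) b" by (simp add: f_def e_def field_simps)
    then show ?thesis using M True by simp
  next
    case False
    then have "x \<notin> K" using R[of x] norm_ge_zero[of b] by auto
    moreover have "x + (1 / real (Suc n)) *\<^sub>R b \<notin> K"
    proof
      assume "x + (1 / real (Suc n)) *\<^sub>R b \<in> K"
      then have "norm (x + (1 / real (Suc n)) *\<^sub>R b) \<le> R" by (rule R)
      moreover have "norm x \<le> norm (x + (1 / real (Suc n)) *\<^sub>R b) + norm ((1 / real (Suc n)) *\<^sub>R b)"
        using norm_triangle_ineq4[of "x + (1 / real (Suc n)) *\<^sub>R b" "(1 / real (Suc n)) *\<^sub>R b"] by simp
      moreover have "norm ((1 / real (Suc n)) *\<^sub>R b) \<le> 1 * norm b"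
        unfolding norm_scaleR by (intro mult_right_mono) auto
      ultimately show False using False by simp
    qed
    ultimately show ?thesis using K False by (simp add: f_def)
  qed
  have tr: "integral\<^sup>L lborel (\<lambda>x. \<psi> (x + a)) = integral\<^sup>L lborel \<psi>" "integrable lborel (\<lambda>x. \<psi> (x + a))" for a
  proof -
    have m: "\<psi> \<in> borel_measurable borel" by (rule borel_measurable_continuous_onI[OF \<psi>c])
    have "integral\<^sup>L (distr lborel borel ((+) a)) \<psi> = integral\<^sup>L lborel (\<lambda>x. \<psi> (a + x))"
      by (rule integral_distr) (use m in auto)
    then show "integral\<^sup>L lborel (\<lambda>x. \<psi> (x + a)) = integral\<^sup>L lborel \<psi>"
      by (simp add: lborel_distr_plus add.commute)
    have "integrable (distr lborel borel ((+) a)) \<psi>" using int_supp[OF \<psi>c K(2)] by (simp add: lborel_distr_plus)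
    then show "integrable lborel (\<lambda>x. \<psi> (x + a))"
      by (subst (asm) integrable_distr_eq) (use m in \<open>auto simp: add.commute\<close>)
  qed
  have f0: "integral\<^sup>L lborel (f n) = 0" for n
    unfolding f_def using tr[of "(1 / real (Suc n)) *\<^sub>R b"] int_supp[OF \<psi>c K(2)] by simp
  have lim: "(\<lambda>n. f n x) \<longlonglongrightarrow> \<psi>' x b" for x
  proof -
    have "((\<lambda>h. (\<psi> (x + h *\<^sub>R b) - \<psi> x) / h) \<longlongrightarrow> \<psi>' x b) (at 0)"
      using line[of x 0] by (simp add: DERIV_def)
    moreover have "filterlim (\<lambda>n. 1 / real (Suc n)) (at 0) sequentially"
      using LIMSEQ_inverse_real_of_nat by (auto simp: filterlim_at inverse_eq_divide)
    ultimately have "(\<lambda>n. (\<psi> (x + (1 / real (Suc n)) *\<^sub>R b) - \<psi> x) / (1 / real (Suc n))) \<longlonglongrightarrow> \<psi>' x b"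
      by (rule filterlim_compose)
    then show ?thesis by (simp add: f_def mult.commute)
  qed
  have "(\<lambda>n. integral\<^sup>L lborel (f n)) \<longlonglongrightarrow> integral\<^sup>L lborel (\<lambda>x. \<psi>' x b)"
  proof (rule integral_dominated_convergence[where w="\<lambda>x. M * indicator (cball 0 (R + norm b)) x"])
    show "integrable lborel (\<lambda>x. M * indicator (cball 0 (R + norm b)) x)"
      using emeasure_lborel_cball_finite[of 0 "R + norm b"]
      by (intro integrable_mult_right integrable_real_indicator) auto
    show "(\<lambda>x. \<psi>' x b) \<in> borel_measurable lborel" using borel_measurable_continuous_onI[OF c] by simp
    show "f n \<in> borel_measurable lborel" for n unfolding f_def
      by (auto intro!: borel_measurable_continuous_onI continuous_intros continuous_on_compose2[OF \<psi>c])
  qed (use bound lim in auto)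
  then have "integral\<^sup>L lborel (\<lambda>x. \<psi>' x b) = 0" by (simp add: f0 LIMSEQ_const_iff)
  then show ?thesis using int_supp[OF c K(3)] by (simp add: has_bochner_integral_iff)
qed

section \<open>Integration over the disc and compactly supported functions\<close>

abbreviation D :: "plane measure" where "D \<equiv> lebesgue_on B1"

lemma AE_D: "AE x in D. 0 < norm x \<and> norm x < 1"
proof -
  have "AE x in lebesgue. x \<noteq> (0::plane)"
    using AE_lborel_singleton[of "0::plane"] by (rule AE_completion)
  then have "AE x in D. x \<noteq> 0" by (simp add: AE_restrict_space_iff eventually_mono)
  moreover have "AE x in D. x \<in> B1" by (auto intro!: AE_I2)
  ultimately show ?thesis by eventually_elim auto
qed

lemma finite_measure_D: "finite_measure D"
  using emeasure_lborel_ball_finite[of "0::plane" 1]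
  by (intro finite_measureI) (simp add: emeasure_restrict_space less_top)

lemma integrable_const_D [simp]: "integrable D (\<lambda>_. c :: 'b::{banach,second_countable_topology})"
  by (rule finite_measure.integrable_const[OF finite_measure_D])

lemma measurable_D_punctured:
  fixes f :: "plane \<Rightarrow> 'b::euclidean_space"
  assumes "continuous_on (B1 - {0}) f"
  shows "f \<in> borel_measurable D"
proof -
  have "f \<in> borel_measurable (lebesgue_on (B1 - {0}))"
    by (rule continuous_imp_measurable_on_sets_lebesgue[OF assms]) auto
  then have "(\<lambda>x. if x \<in> B1 - {0} then f x else 0) \<in> borel_measurable lebesgue"
    by (subst borel_measurable_if) auto
  moreover have "(\<lambda>x. if x = 0 then f 0 else 0) \<in> borel_measurable lebesgue"
    by (intro measurable_If) auto
  ultimately have "(\<lambda>x. (if x \<in> B1 - {0} then f x else 0) + (if x = 0 then f 0 else 0)) \<in> borel_measurable lebesgue"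
    by (rule borel_measurable_add)
  also have "(\<lambda>x. (if x \<in> B1 - {0} then f x else 0) + (if x = 0 then f 0 else 0)) = (\<lambda>x. if x \<in> B1 then f x else 0)"
    by auto
  finally show ?thesis by (subst (asm) borel_measurable_if) auto
qed

lemma measurable_D_radial:
  fixes f :: "real \<Rightarrow> real"
  assumes "continuous_on {0<..<1} f"
  shows "(\<lambda>x. f (norm x)) \<in> borel_measurable D"
  by (rule measurable_D_punctured, rule continuous_on_compose2[OF assms]) (auto intro!: continuous_intros)

lemma has_bochner_integral_D:
  fixes f :: "plane \<Rightarrow> real"
  assumes f: "has_bochner_integral lborel f I" and "\<And>x. x \<notin> B1 \<Longrightarrow> f x = 0"
    and eq: "\<And>x. x \<in> B1 - {0} \<Longrightarrow> f x = g x"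
  shows "has_bochner_integral D g I"
proof -
  \<comment> \<open>The two functions may differ at the origin, a null set; the indicator term
    corrects the value there.\<close>
  have "has_bochner_integral lborel (\<lambda>x. f x + indicator {0} x * (g 0 - f 0)) (I + measure lborel {0::plane} * (g 0 - f 0))"
    by (intro has_bochner_integral_add f has_bochner_integral_mult_left has_bochner_integral_real_indicator) auto
  also have "(\<lambda>x. f x + indicator {0} x * (g 0 - f 0)) = (\<lambda>x. indicator B1 x *\<^sub>R g x)"
    using assms by (auto simp: indicator_def fun_eq_iff)
  finally have *: "has_bochner_integral lborel (\<lambda>x. indicator B1 x *\<^sub>R g x) I" by simp
  then have m: "(\<lambda>x. indicator B1 x *\<^sub>R g x) \<in> borel_measurable lborel" by (auto dest: has_bochner_integral_integrable)
  from * have "has_bochner_integral lebesgue (\<lambda>x. indicator B1 x *\<^sub>R g x) I"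
    using integrable_completion[OF m] integral_completion[OF m] by (simp add: has_bochner_integral_iff)
  then show ?thesis by (subst has_bochner_integral_restrict_space) auto
qed

text \<open>For functions that may be singular at the origin: the support is a compact subset of the
  punctured disc, so the derivative extends continuously by 0 to the whole plane.\<close>

lemma integral_partial_derivative_D:
  fixes \<psi> :: "plane \<Rightarrow> real"
  assumes d: "\<And>x. x \<in> B1 - {0} \<Longrightarrow> (\<psi> has_derivative \<psi>' x) (at x)"
    and c: "continuous_on (B1 - {0}) (\<lambda>x. \<psi>' x b)"
    and K: "compact K" "K \<subseteq> B1 - {0}" "\<And>x. x \<notin> K \<Longrightarrow> \<psi> x = 0"
  shows "has_bochner_integral D (\<lambda>x. \<psi>' x b) 0"
proof -
  define \<Psi>' where "\<Psi>' = (\<lambda>x. if x \<in> K then \<psi>' x else (\<lambda>_. 0))"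
  have d0: "(\<psi> has_derivative (\<lambda>_. 0)) (at x)" if "x \<notin> K" for x
    by (rule has_derivative_transform_within_open[of "\<lambda>_. 0" _ _ _ "- K"])
      (use that K in \<open>auto intro!: compact_imp_closed\<close>)
  have eq: "\<psi>' x = \<Psi>' x" if "x \<in> B1 - {0}" for x
    using has_derivative_unique[OF d[OF that] d0[of x]] by (auto simp: \<Psi>'_def)
  have D: "(\<psi> has_derivative \<Psi>' x) (at x)" for x
    using d[of x] d0[of x] subsetD[OF K(2), of x] by (cases "x \<in> K") (auto simp: \<Psi>'_def)
  have c1: "continuous_on (B1 - {0}) (\<lambda>x. \<Psi>' x b)"
    using c by (rule continuous_on_cong[THEN iffD1, rotated 2]) (auto simp: eq)
  have c2: "continuous_on (- K) (\<lambda>x. \<Psi>' x b)"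
    by (rule continuous_on_cong[THEN iffD1, OF refl _ continuous_on_const[of _ 0]]) (auto simp: \<Psi>'_def)
  have "continuous_on ((B1 - {0}) \<union> - K) (\<lambda>x. \<Psi>' x b)"
    by (rule continuous_on_open_Un[OF _ _ c1 c2]) (use K in \<open>auto intro: compact_imp_closed\<close>)
  moreover have "(B1 - {0}) \<union> - K = UNIV" using K by auto
  ultimately have C: "continuous_on UNIV (\<lambda>x. \<Psi>' x b)" by simp
  have "has_bochner_integral lborel (\<lambda>x. \<Psi>' x b) 0"
    by (rule integral_partial_derivative_compact_support[OF D C K(1) K(3)]) (auto simp: \<Psi>'_def)
  then show ?thesis
    by (rule has_bochner_integral_D) (use K eq in \<open>auto simp: \<Psi>'_def\<close>)
qed

text \<open>Class \<open>C^1\<close> instead of smooth functions, because the functions inserted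
  into the divergence identities, such as \<open>(max 0 (3/4 - x \<bullet> x))^2\<close>, have no
  more regularity.\<close>

definition C1c :: "(plane \<Rightarrow> real) \<Rightarrow> (plane \<Rightarrow> plane) \<Rightarrow> bool" where
  "C1c \<phi> G \<longleftrightarrow> (\<forall>x. (\<phi> has_derivative (\<lambda>v. G x \<bullet> v)) (at x)) \<and> continuous_on UNIV G \<and>
     (\<exists>K. compact K \<and> K \<subseteq> B1 \<and> (\<forall>x. x \<notin> K \<longrightarrow> \<phi> x = 0))"

lemma C1c_continuous: "C1c \<phi> G \<Longrightarrow> continuous_on UNIV \<phi>" "C1c \<phi> G \<Longrightarrow> continuous_on UNIV G"
  by (auto simp: C1c_def intro!: continuous_at_imp_continuous_on has_derivative_continuous)

lemma C1c_support:
  assumes "C1c \<phi> G"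
  obtains K where "compact K" "K \<subseteq> B1" "\<And>x. x \<notin> K \<Longrightarrow> \<phi> x = 0" "\<And>x. x \<notin> K \<Longrightarrow> G x = 0"
proof -
  obtain K where K: "compact K" "K \<subseteq> B1" "\<And>x. x \<notin> K \<Longrightarrow> \<phi> x = 0"
    using assms by (auto simp: C1c_def)
  have "G x = 0" if "x \<notin> K" for x
  proof -
    have "(\<phi> has_derivative (\<lambda>_. 0)) (at x)"
      by (rule has_derivative_transform_within_open[of "\<lambda>_. 0" _ _ _ "- K"])
        (use that K in \<open>auto intro!: compact_imp_closed\<close>)
    then have "(\<lambda>v. G x \<bullet> v) = (\<lambda>_. 0)"
      using assms has_derivative_unique unfolding C1c_def by blast
    then show ?thesis by (metis inner_eq_zero_iff)
  qed
  with K show ?thesis using that by blast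
qed

lemma C1c_bounded:
  assumes "C1c \<phi> G"
  obtains M where "M > 0" "\<And>x. \<bar>\<phi> x\<bar> \<le> M" "\<And>x. norm (G x) \<le> M"
proof -
  obtain K where K: "compact K" "\<And>x. x \<notin> K \<Longrightarrow> \<phi> x = 0" "\<And>x. x \<notin> K \<Longrightarrow> G x = 0"
    using C1c_support[OF assms] by metis
  have "bounded (\<phi> ` K)" "bounded (G ` K)"
    using C1c_continuous[OF assms] K(1)
    by (auto intro!: compact_imp_bounded compact_continuous_image intro: continuous_on_subset)
  then obtain M1 M2 where M: "M1 > 0" "M2 > 0" "\<And>x. x \<in> K \<Longrightarrow> \<bar>\<phi> x\<bar> \<le> M1" "\<And>x. x \<in> K \<Longrightarrow> norm (G x) \<le> M2"
    by (auto simp: bounded_pos)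
  show ?thesis
  proof (rule that[of "max M1 M2"])
    fix x
    show "\<bar>\<phi> x\<bar> \<le> max M1 M2" using M K(2)[of x] by (cases "x \<in> K") (auto simp: le_max_iff_disj)
    show "norm (G x) \<le> max M1 M2" using M K(3)[of x] by (cases "x \<in> K") (auto simp: le_max_iff_disj)
  qed (use M in auto)
qed

lemma test_function_C1c:
  assumes "test_function B1 \<phi>" shows "C1c \<phi> (grad \<phi>)"
  unfolding C1c_def
proof (intro conjI allI)
  have "Ck (Suc 0) \<phi>" using assms by (auto simp: test_function_def simp del: Ck.simps)
  then show "(\<phi> has_derivative (\<lambda>v. grad \<phi> x \<bullet> v)) (at x)" "continuous_on UNIV (grad \<phi>)" for x
    by (rule has_derivative_grad continuous_on_grad)+
  show "\<exists>K. compact K \<and> K \<subseteq> B1 \<and> (\<forall>x. x \<notin> K \<longrightarrow> \<phi> x = 0)"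
    using assms closure_subset[of "{x. \<phi> x \<noteq> 0}"]
    by (intro exI[of _ "closure {x. \<phi> x \<noteq> 0}"]) (auto simp: test_function_def)
qed

lemma max_0_square_deriv: "((\<lambda>s::real. (max 0 s)\<^sup>2) has_real_derivative 2 * max 0 s) (at s)"
proof -
  consider "s < 0" | "s > 0" | "s = 0" by linarith
  then show ?thesis
  proof cases
    case 1
    have "((\<lambda>s::real. (max 0 s)\<^sup>2) has_real_derivative 0) (at s)"
      by (rule has_field_derivative_transform_within_open[of "\<lambda>_. 0" _ _ "{..<0}"]) (use 1 in auto)
    then show ?thesis using 1 by simp
  next
    case 2
    have "((\<lambda>s::real. s\<^sup>2) has_real_derivative 2 * s) (at s)" by (auto intro!: derivative_eq_intros)
    then have "((\<lambda>s::real. (max 0 s)\<^sup>2) has_real_derivative 2 * s) (at s)"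
      by (rule has_field_derivative_transform_within_open[of _ _ _ "{0<..}"]) (use 2 in auto)
    then show ?thesis using 2 by simp
  next
    case 3
    have "((\<lambda>h::real. (max 0 h)\<^sup>2 / h) \<longlongrightarrow> 0) (at 0)"
      by (rule tendsto_0_le[where f="\<lambda>h. h" and K=1])
        (auto intro!: always_eventually tendsto_ident_at simp: max_def power2_eq_square)
    then show ?thesis using 3 by (simp add: DERIV_def)
  qed
qed

text \<open>A \<open>C^1\<close> cut-off of the identity on the positive axis: it vanishes up to 1,
  and its derivative \<open>soft'\<close> stays in \<open>[0, 1]\<close>. The rescalings
  \<open>soft (N * y) / N\<close> tend to \<open>y\<close> from below, which provides both
  convergence and majorants.\<close>

definition soft :: "real \<Rightarrow> real" where "soft y = (max 0 (y - 1))\<^sup>2 / y"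

definition soft' :: "real \<Rightarrow> real" where "soft' y = max 0 (1 - 1 / y\<^sup>2)"

lemma soft_deriv: assumes "y > 0" shows "(soft has_real_derivative soft' y) (at y)"
proof -
  have "((\<lambda>y. (max 0 (y - 1))\<^sup>2) has_real_derivative 2 * max 0 (y - 1)) (at y)"
  proof -
    have "((\<lambda>y. y - 1) has_real_derivative 1) (at y)" by (auto intro!: derivative_eq_intros)
    from DERIV_chain2[OF max_0_square_deriv this] show ?thesis by simp
  qed
  from DERIV_divide[OF this DERIV_ident] assms
  have d: "(soft has_real_derivative (2 * max 0 (y - 1) * y - (max 0 (y - 1))\<^sup>2 * 1) / (y * y)) (at y)"
    unfolding soft_def[abs_def] by simp
  have "(2 * max 0 (y - 1) * y - (max 0 (y - 1))\<^sup>2 * 1) / (y * y) = soft' y"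
  proof (cases "y \<le> 1")
    case True
    then have "1 \<le> 1 / y\<^sup>2" using assms by (simp add: power_le_one)
    then show ?thesis using True by (simp add: soft'_def)
  next
    case False
    then have "1 / y\<^sup>2 \<le> 1" by (simp add: one_le_power)
    then show ?thesis using False by (simp add: soft'_def field_simps power2_eq_square)
  qed
  with d show ?thesis by simp
qed

lemma continuous_on_soft: "continuous_on {0<..} soft" "continuous_on {0<..} soft'"
proof -
  show "continuous_on {0<..} soft"
    using soft_deriv by (auto intro!: continuous_at_imp_continuous_on DERIV_isCont)
  show "continuous_on {0<..} soft'" unfolding soft'_def[abs_def] by (intro continuous_intros) auto
qed

lemma soft_bounds: "y > 0 \<Longrightarrow> 0 \<le> soft y" "y > 0 \<Longrightarrow> soft y \<le> y" "0 \<le> soft' y" "soft' y \<le> 1"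
proof -
  assume y: "y > 0"
  then have "(max 0 (y - 1))\<^sup>2 \<le> y\<^sup>2" by (intro power_mono) auto
  then show "soft y \<le> y" using y by (simp add: soft_def field_simps power2_eq_square)
qed (auto simp: soft_def soft'_def)

lemma soft_lim:
  assumes "y > 0"
  shows "(\<lambda>n. soft (real (Suc n) * y) / real (Suc n)) \<longlonglongrightarrow> y" "(\<lambda>n. soft' (real (Suc n) * y)) \<longlonglongrightarrow> 1"
proof -
  have i: "(\<lambda>n. 1 / real (Suc n)) \<longlonglongrightarrow> 0" using LIMSEQ_inverse_real_of_nat by (simp add: inverse_eq_divide)
  have "(\<lambda>n. (max 0 (y - 1 / real (Suc n)))\<^sup>2 / y) \<longlonglongrightarrow> (max 0 (y - 0))\<^sup>2 / y"
    using assms by (intro tendsto_intros i) auto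
  also have "(max 0 (y - 0))\<^sup>2 / y = y" using assms by (simp add: power2_eq_square)
  also have "(\<lambda>n. (max 0 (y - 1 / real (Suc n)))\<^sup>2 / y) = (\<lambda>n. soft (real (Suc n) * y) / real (Suc n))"
  proof
    fix n
    define N where "N = real (Suc n)"
    have N: "N > 0" by (simp add: N_def)
    have "max 0 (N * y - 1) = N * max 0 (y - 1 / N)"
      using N by (simp add: max_mult_distrib_left right_diff_distrib)
    then show "(max 0 (y - 1 / real (Suc n)))\<^sup>2 / y = soft (real (Suc n) * y) / real (Suc n)"
      unfolding soft_def N_def[symmetric] using N by (simp add: power_mult_distrib power2_eq_square)
  qed
  finally show "(\<lambda>n. soft (real (Suc n) * y) / real (Suc n)) \<longlonglongrightarrow> y" .
  have "(\<lambda>n. max 0 (1 - (1 / real (Suc n))\<^sup>2 / y\<^sup>2)) \<longlonglongrightarrow> max 0 (1 - 0\<^sup>2 / y\<^sup>2)"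
    using assms by (intro tendsto_intros i) auto
  then show "(\<lambda>n. soft' (real (Suc n) * y)) \<longlonglongrightarrow> 1"
    by (simp add: soft'_def power_mult_distrib power_divide)
qed

text \<open>A radial field \<open>h (norm x) / (norm x)\<^sup>2 *\<^sub>R x\<close> on the disc has divergence \<open>h' r / r\<close>; it is cut
  off near the origin by applying \<open>soft\<close> to \<open>h\<close>.\<close>

locale radial_field =
  fixes h h' :: "real \<Rightarrow> real"
  assumes h_pos: "\<And>r. 0 < r \<Longrightarrow> r < 1 \<Longrightarrow> h r > 0"
    and h_deriv: "\<And>r. 0 < r \<Longrightarrow> r < 1 \<Longrightarrow> (h has_real_derivative h' r) (at r)"
    and h'_nonneg: "\<And>r. 0 < r \<Longrightarrow> r < 1 \<Longrightarrow> 0 \<le> h' r"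
    and h'_cont: "continuous_on {0<..<1} h'"
    and h_lim: "(h \<longlongrightarrow> 0) (at_right 0)"
begin

lemma h_cont: "continuous_on {0<..<1} h"
  using h_deriv by (auto intro!: continuous_at_imp_continuous_on DERIV_isCont)

text \<open>Near the origin \<open>N * h \<le> 1\<close>, so the cut-off field vanishes there, and
  its product with \<open>\<phi>\<close> has compact support in the punctured disc. Adding the
  integrals of the partial derivatives of its components gives the divergence theorem.\<close>

lemma cutoff_divergence:
  assumes \<phi>: "C1c \<phi> G" and N: "N > 0"
  shows "has_bochner_integral D (\<lambda>x. soft' (N * h (norm x)) * (h' (norm x) / norm x) * \<phi> x +
    soft (N * h (norm x)) / N / (norm x)\<^sup>2 * (x \<bullet> G x)) 0"
proof -
  define c where "c = (\<lambda>r. soft (N * h r) / N / r\<^sup>2)"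
  define c' where "c' = (\<lambda>r. soft' (N * h r) * h' r / r\<^sup>2 - 2 * soft (N * h r) / N / r ^ 3)"
  have c: "(c has_real_derivative c' r) (at r)" if r: "0 < r" "r < 1" for r
  proof -
    have "((\<lambda>r. N * h r) has_real_derivative N * h' r) (at r)" by (intro DERIV_cmult h_deriv r)
    from DERIV_chain2[OF soft_deriv this] N h_pos[OF r]
    have "((\<lambda>r. soft (N * h r)) has_real_derivative soft' (N * h r) * (N * h' r)) (at r)" by simp
    then show ?thesis unfolding c_def
    proof (rule DERIV_cong[OF DERIV_divide[OF DERIV_cdivide[of _ _ _ _ N] DERIV_power[OF DERIV_ident, of 2]]])
      show "(soft' (N * h r) * (N * h' r) / N * r\<^sup>2 - soft (N * h r) / N * (real 2 * (1 * r ^ (2 - Suc 0)))) / (r\<^sup>2 * r\<^sup>2) = c' r"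
        using r N by (simp add: c'_def field_simps power2_eq_square power3_eq_cube)
    qed (use r in auto)
  qed
  have Nh: "continuous_on {0<..<1} (\<lambda>r. N * h r)" by (intro continuous_intros h_cont)
  have sc: "continuous_on {0<..<1} (\<lambda>r. soft (N * h r))" "continuous_on {0<..<1} (\<lambda>r. soft' (N * h r))"
    using N h_pos
    by (auto intro!: continuous_on_compose2[OF continuous_on_soft(1) Nh] continuous_on_compose2[OF continuous_on_soft(2) Nh])
  have cc: "continuous_on {0<..<1} c" "continuous_on {0<..<1} c'"
    unfolding c_def c'_def using N by (intro continuous_intros sc h'_cont; auto)+
  have cn: "continuous_on (B1 - {0}) (\<lambda>x. c (norm x))" "continuous_on (B1 - {0}) (\<lambda>x. c' (norm x))"
    by (auto intro!: continuous_on_compose2[OF cc(1)] continuous_on_compose2[OF cc(2)] continuous_intros)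
  obtain K where K: "compact K" "K \<subseteq> B1" "\<And>x. x \<notin> K \<Longrightarrow> \<phi> x = 0" using C1c_support[OF \<phi>] by metis
  have "\<forall>\<^sub>F r in at_right 0. h r < 1 / N" using order_tendstoD(2)[OF h_lim] N by simp
  then obtain \<delta> where \<delta>: "\<delta> > 0" "\<And>r. 0 < r \<Longrightarrow> r < \<delta> \<Longrightarrow> h r < 1 / N"
    by (auto simp: eventually_at_right_field)
  have c0: "c r = 0" if "r \<ge> 0" "r < \<delta>" for r
  proof (cases "r = 0")
    case False
    then have "N * h r \<le> 1" using \<delta>(2)[of r] that N by (simp add: field_simps less_imp_le)
    then show ?thesis by (simp add: c_def soft_def)
  qed (simp add: c_def)
  define \<psi> where "\<psi> = (\<lambda>b x. c (norm x) * (x \<bullet> b) * \<phi> x)"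
  define \<psi>' where "\<psi>' = (\<lambda>b x v. c (norm x) * (x \<bullet> b) * (G x \<bullet> v) +
      (c (norm x) * (v \<bullet> b) + c' (norm x) * (v \<bullet> sgn x) * (x \<bullet> b)) * \<phi> x)"
  have "has_bochner_integral D (\<lambda>x. \<psi>' b x b) 0" for b
  proof (rule integral_partial_derivative_D[where \<psi>="\<psi> b" and \<psi>'="\<psi>' b" and b=b and K="K \<inter> - ball 0 \<delta>"])
    fix x :: plane assume x: "x \<in> B1 - {0}"
    have 1: "((\<lambda>x. c (norm x)) has_derivative (\<lambda>v. c' (norm x) * (v \<bullet> sgn x))) (at x)"
      using has_derivative_compose[OF has_derivative_norm c[of "norm x", unfolded has_field_derivative_def]] x by auto
    have 2: "((\<lambda>x. x \<bullet> b) has_derivative (\<lambda>v. v \<bullet> b)) (at x)" by (auto intro!: derivative_eq_intros)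
    have 3: "(\<phi> has_derivative (\<lambda>v. G x \<bullet> v)) (at x)" using \<phi> by (auto simp: C1c_def)
    show "(\<psi> b has_derivative \<psi>' b x) (at x)"
      unfolding \<psi>_def \<psi>'_def by (rule has_derivative_mult[OF has_derivative_mult[OF 1 2] 3])
  next
    show "continuous_on (B1 - {0}) (\<lambda>x. \<psi>' b x b)"
      unfolding \<psi>'_def sgn_div_norm
      by (intro continuous_intros cn continuous_on_subset[OF C1c_continuous(1)[OF \<phi>]]
          continuous_on_subset[OF C1c_continuous(2)[OF \<phi>]]) auto
    show "compact (K \<inter> - ball 0 \<delta>)" using K by (intro compact_Int_closed) auto
    show "K \<inter> - ball 0 \<delta> \<subseteq> B1 - {0}" using K \<delta> by auto
    fix x assume "x \<notin> K \<inter> - ball 0 \<delta>"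
    then show "\<psi> b x = 0" using K c0[of "norm x"] by (auto simp: \<psi>_def)
  qed
  then have "has_bochner_integral D (\<lambda>x. \<Sum>b\<in>Basis. \<psi>' b x b) (\<Sum>b\<in>(Basis::plane set). 0)"
    by (intro has_bochner_integral_sum)
  also have "(\<lambda>x. \<Sum>b\<in>Basis. \<psi>' b x b) = (\<lambda>x. soft' (N * h (norm x)) * (h' (norm x) / norm x) * \<phi> x +
    soft (N * h (norm x)) / N / (norm x)\<^sup>2 * (x \<bullet> G x))"
  proof
    fix x :: plane
    have s1: "(\<Sum>b\<in>Basis. (x \<bullet> b) * (G x \<bullet> b)) = x \<bullet> G x" by (simp add: euclidean_inner[of x "G x"])
    have s2: "(\<Sum>b\<in>Basis. (b \<bullet> sgn x) * (x \<bullet> b)) = norm x"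
    proof -
      have "(\<Sum>b\<in>Basis. (b \<bullet> sgn x) * (x \<bullet> b)) = sgn x \<bullet> x"
        unfolding euclidean_inner[of "sgn x" x] by (intro sum.cong) (auto simp: inner_commute)
      also have "\<dots> = norm x"
        by (cases "x = 0") (auto simp: sgn_div_norm power2_norm_eq_inner[symmetric] power2_eq_square)
      finally show ?thesis .
    qed
    have s3: "(\<Sum>b\<in>(Basis::plane set). b \<bullet> b) = 2" by (simp add: inner_same_Basis)
    have "(\<Sum>b\<in>Basis. \<psi>' b x b) = c (norm x) * (\<Sum>b\<in>Basis. (x \<bullet> b) * (G x \<bullet> b)) +
       (c (norm x) * (\<Sum>b\<in>(Basis::plane set). b \<bullet> b) + c' (norm x) * (\<Sum>b\<in>Basis. (b \<bullet> sgn x) * (x \<bullet> b))) * \<phi> x"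
      unfolding \<psi>'_def sum.distrib sum_distrib_left sum_distrib_right distrib_right by (simp add: mult.assoc)
    also have "\<dots> = c (norm x) * (x \<bullet> G x) + (c (norm x) * 2 + c' (norm x) * norm x) * \<phi> x"
      unfolding s1 s2 s3 ..
    \<comment> \<open>The divergence of \<open>c r * x\<close> in the plane is
      \<open>r * c' + 2 * c\<close>. The factor \<open>1 / r^2\<close> inside \<open>c\<close> is
      chosen so that the terms without \<open>soft'\<close> cancel.\<close>
    also have "c (norm x) * 2 + c' (norm x) * norm x = soft' (N * h (norm x)) * (h' (norm x) / norm x)"
    proof (cases "norm x = 0")
      case False
      then show ?thesis using N by (simp add: c_def c'_def field_simps power2_eq_square power3_eq_cube)
    qed (simp add: c_def c'_def)
    finally show "(\<Sum>b\<in>Basis. \<psi>' b x b) = soft' (N * h (norm x)) * (h' (norm x) / norm x) * \<phi> x +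
      soft (N * h (norm x)) / N / (norm x)\<^sup>2 * (x \<bullet> G x)" by (simp add: c_def)
  qed
  finally show ?thesis by simp
qed

lemma measurable_cutoff:
  assumes "N > 0"
  shows "(\<lambda>x. soft' (N * h (norm x))) \<in> borel_measurable D" "(\<lambda>x. soft (N * h (norm x))) \<in> borel_measurable D"
    "(\<lambda>x. h (norm x)) \<in> borel_measurable D" "(\<lambda>x. h' (norm x)) \<in> borel_measurable D"
proof -
  have Nh: "continuous_on {0<..<1} (\<lambda>r. N * h r)" by (intro continuous_intros h_cont)
  show "(\<lambda>x. soft' (N * h (norm x))) \<in> borel_measurable D" "(\<lambda>x. soft (N * h (norm x))) \<in> borel_measurable D"
    "(\<lambda>x. h (norm x)) \<in> borel_measurable D" "(\<lambda>x. h' (norm x)) \<in> borel_measurable D"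
    using assms h_pos
    by (auto intro!: measurable_D_radial continuous_on_compose2[OF continuous_on_soft(1) Nh]
        continuous_on_compose2[OF continuous_on_soft(2) Nh] h_cont h'_cont)
qed

end

section \<open>The weight and a Hardy inequality\<close>

lemma Vk_eq: "r > 0 \<Longrightarrow> Vk k r = (1 - ln r) powr (- 2 - k) / r\<^sup>2"
proof -
  assume r: "r > 0"
  then have "- ln (r / exp 1) = 1 - ln r" by (simp add: ln_div)
  moreover have "- 2 - k = - (2 + k)" by simp
  ultimately show ?thesis by (simp only: Vk_def powr_minus) (simp add: divide_inverse)
qed

lemma Vk_nonneg: "0 \<le> Vk k r"
  by (simp add: Vk_def)

lemma continuous_on_Vk: "continuous_on {0<..1} (Vk k)"
proof -
  have "1 - ln r \<noteq> 0" if "0 < r" "r \<le> 1" for r :: real using that ln_le_zero_iff[of r] by linarith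
  then have "continuous_on {0<..1} (\<lambda>r::real. (1 - ln r) powr (- 2 - k) / r\<^sup>2)"
    by (intro continuous_intros) auto
  then show ?thesis
    by (rule continuous_on_cong[THEN iffD1, rotated 2]) (auto simp: Vk_eq)
qed

lemma measurable_Vk: "(\<lambda>x. Vk k (norm x)) \<in> borel_measurable D"
  by (rule measurable_D_radial, rule continuous_on_subset[OF continuous_on_Vk]) auto

text \<open>The primitive of \<open>r * Vk k r\<close> with limit 0 at the origin; hence the radial
  field built from it has divergence \<open>Vk k\<close>.\<close>

definition log_field :: "real \<Rightarrow> real \<Rightarrow> real" where
  "log_field k r = (1 - ln r) powr (- 1 - k) / (1 + k)"

text \<open>The last bound makes the field square integrable once the weight is integrable: the base
  \<open>1 - ln r\<close> exceeds 1 and the exponent \<open>- 2 - 2 * k\<close> is below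
  \<open>- 2 - k\<close>.\<close>

lemma log_field_bounds:
  assumes "k > 0" "0 < r" "r < 1"
  shows "0 < log_field k r" "log_field k r \<le> 1" "(log_field k r / r)\<^sup>2 \<le> Vk k r"
proof -
  have L: "1 - ln r > 1" using assms by simp
  have "0 < (1 - ln r) powr (- 1 - k)" unfolding powr_gt_zero using L by linarith
  then show "0 < log_field k r" using assms by (simp add: log_field_def)
  have "(1 - ln r) powr (- 1 - k) \<le> (1 - ln r) powr 0" using L assms by (intro powr_mono) auto
  then have "(1 - ln r) powr (- 1 - k) \<le> 1" using L by simp
  then show "log_field k r \<le> 1" using assms by (simp add: log_field_def field_simps)
  have "(log_field k r)\<^sup>2 = ((1 - ln r) powr (- 1 - k))\<^sup>2 / (1 + k)\<^sup>2"
    by (simp add: log_field_def power_divide)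
  also have "\<dots> \<le> ((1 - ln r) powr (- 1 - k))\<^sup>2 / 1"
    using assms by (intro divide_left_mono) (auto simp: one_le_power)
  also have "\<dots> = (1 - ln r) powr (- 2 - 2 * k)"
    using L by (simp add: power2_eq_square flip: powr_add)
  also have "\<dots> \<le> (1 - ln r) powr (- 2 - k)" using L assms by (intro powr_mono) auto
  finally show "(log_field k r / r)\<^sup>2 \<le> Vk k r"
    using assms by (simp add: Vk_eq power_divide divide_right_mono)
qed

lemma log_field_deriv:
  assumes "k > 0" "0 < r" "r < 1"
  shows "(log_field k has_real_derivative r * Vk k r) (at r)"
proof -
  have L: "1 - ln r > 0" using assms by (simp add: ln_less_zero_iff order_less_trans[of _ 0])
  have "((\<lambda>r. (1 - ln r) powr (- 1 - k)) has_real_derivative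
      (- 1 - k) * (1 - ln r) powr (- 1 - k - 1) * (- (1 / r))) (at r)"
  proof -
    have d: "((\<lambda>r. 1 - ln r) has_real_derivative - (1 / r)) (at r)"
      using assms by (auto intro!: derivative_eq_intros simp: divide_inverse)
    have "((\<lambda>y. y powr (- 1 - k)) has_real_derivative (- 1 - k) * (1 - ln r) powr (- 1 - k - 1)) (at (1 - ln r))"
      using L by (auto intro!: derivative_eq_intros)
    from DERIV_chain2[OF this d] show ?thesis .
  qed
  from DERIV_cdivide[OF this, of "1 + k"] show ?thesis unfolding log_field_def[abs_def]
  proof (rule DERIV_cong)
    have e: "- 1 - k - 1 = - 2 - k" by simp
    have "(- 1 - k) * a * (- (1 / r)) / (1 + k) = r * (a / r\<^sup>2)" for a
    proof -
      define c where "c = 1 + k"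
      have c: "- 1 - k = - c" "1 + k = c" "c \<noteq> 0" using assms by (auto simp: c_def)
      show ?thesis unfolding c(1,2) using c(3) assms(2) by (simp add: power2_eq_square)
    qed
    then show "(- 1 - k) * (1 - ln r) powr (- 1 - k - 1) * (- (1 / r)) / (1 + k) = r * Vk k r"
      unfolding e Vk_eq[OF assms(2)] .
  qed
qed

lemma log_powr_tendsto_0: "a > 0 \<Longrightarrow> ((\<lambda>r::real. (1 - ln r) powr (- a)) \<longlongrightarrow> 0) (at_right 0)"
proof -
  assume a: "a > 0"
  have lim: "filterlim (\<lambda>r::real. 1 - ln r) at_top (at_right 0)"
    using filterlim_tendsto_add_at_top[OF tendsto_const[of 1], of "\<lambda>r. - ln r"]
      ln_at_0[unfolded filterlim_uminus_at_bot] by simp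
  show ?thesis by (rule tendsto_neg_powr[OF _ lim]) (use a in auto)
qed

lemma radial_field_log:
  assumes "k > 0" shows "radial_field (log_field k) (\<lambda>r. r * Vk k r)"
proof
  show "continuous_on {0<..<1} (\<lambda>r. r * Vk k r)"
    by (intro continuous_intros continuous_on_subset[OF continuous_on_Vk]) auto
  have "((\<lambda>r. (1 - ln r) powr (- (1 + k)) / (1 + k)) \<longlongrightarrow> 0 / (1 + k)) (at_right 0)"
    using assms by (intro tendsto_divide log_powr_tendsto_0 tendsto_const) auto
  then show "(log_field k \<longlongrightarrow> 0) (at_right 0)" by (simp add: log_field_def[abs_def])
qed (use assms log_field_bounds log_field_deriv Vk_nonneg in auto)

text \<open>The divergence identity is tested with one fixed nonnegative bump. The flux term is
  bounded by 4 uniformly in the cut-off, so Fatou's lemma gives integrability of the weight times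
  the bump; outside radius \<open>1/2\<close> the weight itself is at most 4.\<close>

lemma integrable_Vk:
  assumes k: "k > 0" shows "integrable D (\<lambda>x. Vk k (norm x))"
proof -
  interpret radial_field "log_field k" "\<lambda>r. r * Vk k r" by (rule radial_field_log[OF k])
  \<comment> \<open>The radius of the support is \<open>sqrt (3/4) < 1\<close>, and the value is at
    least \<open>(1/2)^2\<close> up to radius \<open>1/2\<close>; this is the factor 4 of the final
    majorant.\<close>
  define \<phi> where "\<phi> = (\<lambda>x :: plane. (max 0 (3/4 - x \<bullet> x))\<^sup>2)"
  define G where "G = (\<lambda>x :: plane. (- 4 * max 0 (3/4 - x \<bullet> x)) *\<^sub>R x)"
  have \<phi>: "C1c \<phi> G"
    unfolding C1c_def
  proof (intro conjI allI exI)
    fix x :: plane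
    have "((\<lambda>x. 3/4 - x \<bullet> x) has_derivative (\<lambda>v. - 2 * (x \<bullet> v))) (at x)"
      by (auto intro!: derivative_eq_intros simp: inner_commute)
    from has_derivative_compose[OF this max_0_square_deriv[unfolded has_field_derivative_def]]
    show "(\<phi> has_derivative (\<lambda>v. G x \<bullet> v)) (at x)" by (simp add: \<phi>_def G_def mult.assoc)
    show "continuous_on UNIV G" unfolding G_def by (intro continuous_intros)
    show "compact (cball 0 (sqrt (3/4)) :: plane set)" by simp
    have "sqrt (3/4) < 1" by (simp add: real_sqrt_lt_1_iff)
    then show "cball 0 (sqrt (3/4)) \<subseteq> B1"
      by (intro subsetI) (metis mem_ball_0 mem_cball_0 order_le_less_trans)
    show "x \<notin> cball 0 (sqrt (3/4)) \<longrightarrow> \<phi> x = 0"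
    proof
      assume "x \<notin> cball 0 (sqrt (3/4))"
      then have "sqrt (3/4) < norm x" by simp
      then have "3/4 < x \<bullet> x" by (simp add: norm_eq_sqrt_inner)
      then show "\<phi> x = 0" by (simp add: \<phi>_def)
    qed
  qed
  have \<phi>01: "0 \<le> \<phi> x" for x by (simp add: \<phi>_def)
  have m\<phi>: "\<phi> \<in> borel_measurable D" "(\<lambda>x. x \<bullet> G x) \<in> borel_measurable D"
    using C1c_continuous[OF \<phi>] by (auto intro!: measurable_D_punctured continuous_intros intro: continuous_on_subset)
  define f where "f = (\<lambda>n x. soft' (real (Suc n) * log_field k (norm x)) * Vk k (norm x) * \<phi> x)"
  have f: "integrable D (f n)" "integral\<^sup>L D (f n) \<le> integral\<^sup>L D (\<lambda>_. 4)" for n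
  proof -
    define N where "N = real (Suc n)"
    have N: "N > 0" by (simp add: N_def)
    define s where "s = (\<lambda>x. soft (N * log_field k (norm x)) / N / (norm x)\<^sup>2 * (x \<bullet> G x))"
    have sb: "AE x in D. \<bar>s x\<bar> \<le> 4"
      using AE_D
    proof eventually_elim
      case (elim x)
      note lf = log_field_bounds[OF k, of "norm x"]
      have "\<bar>soft (N * log_field k (norm x)) / N\<bar> \<le> 1"
      proof -
        have "N * log_field k (norm x) > 0" using lf N elim by auto
        then have "0 \<le> soft (N * log_field k (norm x))" "soft (N * log_field k (norm x)) \<le> N * log_field k (norm x)"
          using soft_bounds by auto
        moreover have "N * log_field k (norm x) \<le> N * 1" using lf N elim by (intro mult_left_mono) auto
        ultimately have "soft (N * log_field k (norm x)) \<le> N" by linarith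
        then show ?thesis using N \<open>0 \<le> soft (N * log_field k (norm x))\<close> by simp
      qed
      moreover have "3 / 4 - x \<bullet> x \<le> 1" using inner_ge_zero[of x] by linarith
      then have "\<bar>(x \<bullet> G x) / (norm x)\<^sup>2\<bar> \<le> 4"
        using elim by (simp add: G_def power2_norm_eq_inner abs_mult)
      ultimately have "\<bar>soft (N * log_field k (norm x)) / N\<bar> * \<bar>(x \<bullet> G x) / (norm x)\<^sup>2\<bar> \<le> 1 * 4"
        by (intro mult_mono) auto
      then show ?case by (simp add: s_def abs_mult)
    qed
    have "s \<in> borel_measurable D"
      unfolding s_def using measurable_cutoff(2)[OF N] m\<phi>
      by (intro borel_measurable_times borel_measurable_divide borel_measurable_const borel_measurable_power
          measurable_D_radial[of "\<lambda>r. r"] continuous_on_id)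
    then have si: "integrable D s" using sb by (intro Bochner_Integration.integrable_bound[OF integrable_const_D[of "4::real"]]) auto
    have Vr: "r * Vk k r / r = Vk k r" for r by (cases "r = 0") (auto simp: Vk_def)
    have fs: "has_bochner_integral D (\<lambda>x. f n x + s x) 0"
      using cutoff_divergence[OF \<phi> N] unfolding Vr f_def s_def N_def .
    have "has_bochner_integral D (\<lambda>x. (f n x + s x) - s x) (0 - integral\<^sup>L D s)"
      by (intro has_bochner_integral_diff fs has_bochner_integral_integrable si)
    then have fn: "has_bochner_integral D (f n) (- integral\<^sup>L D s)" by simp
    then show "integrable D (f n)" by (simp add: has_bochner_integral_iff)
    have "- integral\<^sup>L D s = integral\<^sup>L D (\<lambda>x. - s x)" by simp
    also have "\<dots> \<le> integral\<^sup>L D (\<lambda>_. 4)"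
    proof (rule integral_mono_AE)
      show "AE x in D. - s x \<le> 4" using sb by eventually_elim auto
    qed (use si in auto)
    finally show "integral\<^sup>L D (f n) \<le> integral\<^sup>L D (\<lambda>_. 4)" using fn by (simp add: has_bochner_integral_iff)
  qed
  have I: "integrable D (\<lambda>x. Vk k (norm x) * \<phi> x)"
  proof (rule integrable_Fatou(1)[OF f(1) _ f(2)])
    show "AE x in D. 0 \<le> f n x" for n
      by (intro AE_I2) (simp add: f_def soft_bounds Vk_nonneg \<phi>01)
    show "AE x in D. (\<lambda>n. f n x) \<longlonglongrightarrow> Vk k (norm x) * \<phi> x"
      using AE_D
    proof eventually_elim
      case (elim x)
      have "(\<lambda>n. f n x) \<longlonglongrightarrow> 1 * Vk k (norm x) * \<phi> x"
        unfolding f_def using log_field_bounds[OF k] elim by (intro tendsto_mult soft_lim tendsto_const) auto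
      then show ?case by simp
    qed
    show "(\<lambda>x. Vk k (norm x) * \<phi> x) \<in> borel_measurable D"
      by (intro borel_measurable_times measurable_Vk m\<phi>)
  qed
  show ?thesis
  proof (rule Bochner_Integration.integrable_bound)
    show "integrable D (\<lambda>x. 4 * (Vk k (norm x) * \<phi> x) + 4)" using I by simp
    show "AE x in D. norm (Vk k (norm x)) \<le> norm (4 * (Vk k (norm x) * \<phi> x) + 4)"
      using AE_D
    proof eventually_elim
      case (elim x)
      have "Vk k (norm x) \<le> 4 * (Vk k (norm x) * \<phi> x) + 4"
      proof (cases "norm x \<le> 1/2")
        case True
        then have "(norm x)\<^sup>2 \<le> (1/2)\<^sup>2" by (intro power_mono) auto
        then have "x \<bullet> x \<le> 1/4" by (simp add: dot_square_norm power_divide)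
        then have "1/2 \<le> max 0 (3/4 - x \<bullet> x)" unfolding le_max_iff_disj by linarith
        then have "(1/2)\<^sup>2 \<le> \<phi> x" unfolding \<phi>_def by (rule power_mono) auto
        then have "1 \<le> 4 * \<phi> x" by (simp add: power2_eq_square)
        then have "Vk k (norm x) * 1 \<le> Vk k (norm x) * (4 * \<phi> x)"
          by (intro mult_left_mono) (auto simp: Vk_nonneg)
        then show ?thesis by simp
      next
        case False
        then have "(1/2)\<^sup>2 \<le> (norm x)\<^sup>2" by (intro power_mono) auto
        have L: "1 \<le> 1 - ln (norm x)" using elim by simp
        then have "(1 - ln (norm x)) powr (- 2 - k) \<le> (1 - ln (norm x)) powr 0" using k by (intro powr_mono) auto
        then have "(1 - ln (norm x)) powr (- 2 - k) \<le> 1" using L by simp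
        then have "Vk k (norm x) \<le> 1 / (norm x)\<^sup>2" using elim by (simp add: Vk_eq divide_right_mono)
        also have "\<dots> \<le> 1 / (1/2)\<^sup>2" using \<open>(1/2)\<^sup>2 \<le> (norm x)\<^sup>2\<close> elim by (intro divide_left_mono) auto
        finally have "Vk k (norm x) \<le> 4" by (simp add: power2_eq_square)
        moreover have "0 \<le> Vk k (norm x) * \<phi> x" using Vk_nonneg \<phi>01 by simp
        ultimately show ?thesis by simp
      qed
      then show ?case using Vk_nonneg[of k "norm x"] by simp
    qed
  qed (rule measurable_Vk)
qed

text \<open>The cut-off identity in the limit of large \<open>N\<close>. The bounds with
  \<open>C\<close> dominate its two terms by multiples of \<open>Vk k\<close> and
  \<open>1 + Vk k\<close>, which are integrable on the disc.\<close>

lemma (in radial_field) divergence: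
  assumes k: "k > 0" and \<phi>: "C1c \<phi> G"
    and C: "\<And>r. 0 < r \<Longrightarrow> r < 1 \<Longrightarrow> h' r / r \<le> C * Vk k r" "\<And>r. 0 < r \<Longrightarrow> r < 1 \<Longrightarrow> h r / r \<le> C * (1 + Vk k r)"
  shows "integrable D (\<lambda>x. h' (norm x) / norm x * \<phi> x)"
    and "integrable D (\<lambda>x. h (norm x) / (norm x)\<^sup>2 * (x \<bullet> G x))"
    and "integral\<^sup>L D (\<lambda>x. h' (norm x) / norm x * \<phi> x) = - integral\<^sup>L D (\<lambda>x. h (norm x) / (norm x)\<^sup>2 * (x \<bullet> G x))"
proof -
  obtain M where M: "M > 0" "\<And>x. \<bar>\<phi> x\<bar> \<le> M" "\<And>x. norm (G x) \<le> M" using C1c_bounded[OF \<phi>] by metis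
  have m\<phi>: "\<phi> \<in> borel_measurable D" "(\<lambda>x. x \<bullet> G x) \<in> borel_measurable D" "(\<lambda>x. norm x) \<in> borel_measurable D"
    using C1c_continuous[OF \<phi>] by (auto intro!: measurable_D_punctured continuous_intros intro: continuous_on_subset)
  define a where "a = (\<lambda>x. h' (norm x) / norm x * \<phi> x)"
  define b where "b = (\<lambda>x. h (norm x) / (norm x)\<^sup>2 * (x \<bullet> G x))"
  define w where "w = (\<lambda>x :: plane. C * Vk k (norm x) * M + C * (1 + Vk k (norm x)) * M)"
  have w: "integrable D w" unfolding w_def using integrable_Vk[OF k] by simp
  \<comment> \<open>\<open>s\<close> and \<open>t\<close> stand for the cut-off factors
    \<open>soft'\<close> and \<open>soft / N\<close>, so that one estimate covers the approximations
    and the limit \<open>s = 1\<close>, \<open>t = h\<close>.\<close>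
  have bd: "\<bar>s * a x\<bar> \<le> C * Vk k (norm x) * M" "\<bar>t / h (norm x) * b x\<bar> \<le> C * (1 + Vk k (norm x)) * M"
    if x: "0 < norm x" "norm x < 1" and s: "0 \<le> s" "s \<le> 1" and t: "0 \<le> t" "t \<le> h (norm x)" for x s t
  proof -
    have C0: "0 \<le> C * Vk k (norm x)" "0 \<le> C * (1 + Vk k (norm x))"
      using C[OF x] h'_nonneg[OF x] h_pos[OF x] x
      by (meson divide_nonneg_pos order_trans less_imp_le)+
    have "\<bar>s * a x\<bar> = s * (h' (norm x) / norm x) * \<bar>\<phi> x\<bar>"
      using s x h'_nonneg[OF x] by (simp add: a_def abs_mult)
    also have "\<dots> \<le> 1 * (C * Vk k (norm x)) * M"
      using s x h'_nonneg[OF x] M C(1)[OF x] C0 by (intro mult_mono) auto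
    finally show "\<bar>s * a x\<bar> \<le> C * Vk k (norm x) * M" by simp
    have "\<bar>x \<bullet> G x\<bar> \<le> norm x * M"
      using Cauchy_Schwarz_ineq2[of x "G x"] mult_left_mono[OF M(3)[of x], of "norm x"] by simp
    then have xG: "\<bar>x \<bullet> G x\<bar> / norm x \<le> M" using x by (simp add: pos_divide_le_eq mult.commute)
    have "\<bar>t / h (norm x) * b x\<bar> = (t / h (norm x)) * (h (norm x) / norm x) * (\<bar>x \<bullet> G x\<bar> / norm x)"
      using t x h_pos[OF x] by (simp add: b_def abs_mult power2_eq_square)
    also have "\<dots> \<le> 1 * (C * (1 + Vk k (norm x))) * M"
      using t x h_pos[OF x] C(2)[OF x] xG C0 by (intro mult_mono) auto
    finally show "\<bar>t / h (norm x) * b x\<bar> \<le> C * (1 + Vk k (norm x)) * M" by simp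
  qed
  have wb: "\<bar>s * a x + t / h (norm x) * b x\<bar> \<le> w x"
    if "0 < norm x" "norm x < 1" "0 \<le> s" "s \<le> 1" "0 \<le> t" "t \<le> h (norm x)" for x s t
    unfolding w_def by (rule order_trans[OF abs_triangle_ineq add_mono[OF bd(1)[OF that] bd(2)[OF that]]])
  have mab: "a \<in> borel_measurable D" "b \<in> borel_measurable D"
    unfolding a_def b_def using measurable_cutoff(3,4)[of 1] m\<phi>
    by (intro borel_measurable_times borel_measurable_divide borel_measurable_power; simp)+
  have ia: "integrable D a"
  proof (rule Bochner_Integration.integrable_bound)
    show "integrable D (\<lambda>x. C * Vk k (norm x) * M)" using integrable_Vk[OF k] by simp
    show "AE x in D. norm (a x) \<le> norm (C * Vk k (norm x) * M)"
      using AE_D by eventually_elim (use bd(1)[where s=1 and t=0] h_pos in \<open>force simp: less_imp_le\<close>)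
  qed (rule mab)
  have ib: "integrable D b"
  proof (rule Bochner_Integration.integrable_bound)
    show "integrable D (\<lambda>x. C * (1 + Vk k (norm x)) * M)" using integrable_Vk[OF k] by simp
    show "AE x in D. norm (b x) \<le> norm (C * (1 + Vk k (norm x)) * M)"
      using AE_D
    proof eventually_elim
      case (elim x)
      then show ?case using bd(2)[of x 1 "h (norm x)"] h_pos[of "norm x"] by auto
    qed
  qed (rule mab)
  define F where "F = (\<lambda>n x. soft' (real (Suc n) * h (norm x)) * a x + soft (real (Suc n) * h (norm x)) / real (Suc n) / h (norm x) * b x)"
  have F0: "integral\<^sup>L D (F n) = 0" "F n \<in> borel_measurable D" for n
  proof -
    have N: "real (Suc n) > 0" by simp
    have m: "F n \<in> borel_measurable D"
      unfolding F_def using measurable_cutoff[OF N] mab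
      by (intro borel_measurable_add borel_measurable_times borel_measurable_divide; simp)
    then show "F n \<in> borel_measurable D" .
    note cd = cutoff_divergence[OF \<phi> N]
    have "has_bochner_integral D (F n) 0"
    proof (rule has_bochner_integral_cong_AE[THEN iffD1, OF _ m _ cd])
      show "AE x in D. soft' (real (Suc n) * h (norm x)) * (h' (norm x) / norm x) * \<phi> x +
          soft (real (Suc n) * h (norm x)) / real (Suc n) / (norm x)\<^sup>2 * (x \<bullet> G x) = F n x"
        using AE_D
      proof eventually_elim
        case (elim x)
        then have "h (norm x) \<noteq> 0" using h_pos[of "norm x"] by auto
        then show ?case by (simp add: F_def a_def b_def)
      qed
    qed (use cd in \<open>auto dest: has_bochner_integral_integrable\<close>)
    then show "integral\<^sup>L D (F n) = 0" by (rule has_bochner_integral_integral_eq)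
  qed
  have "(\<lambda>n. integral\<^sup>L D (F n)) \<longlonglongrightarrow> integral\<^sup>L D (\<lambda>x. a x + b x)"
  proof (rule integral_dominated_convergence[OF _ _ w])
    show "AE x in D. (\<lambda>n. F n x) \<longlonglongrightarrow> a x + b x"
      using AE_D
    proof eventually_elim
      case (elim x)
      then have h: "h (norm x) > 0" using h_pos[of "norm x"] by auto
      have "(\<lambda>n. F n x) \<longlonglongrightarrow> 1 * a x + h (norm x) / h (norm x) * b x"
        unfolding F_def using h by (intro tendsto_intros soft_lim) auto
      then show ?case using h by simp
    qed
    show "AE x in D. norm (F n x) \<le> w x" for n
      using AE_D
    proof eventually_elim
      case (elim x)
      then have h: "h (norm x) > 0" using h_pos[of "norm x"] by auto
      then have "real (Suc n) * h (norm x) > 0" by simp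
      note sb = soft_bounds(1,2)[OF this]
      have "soft (real (Suc n) * h (norm x)) / real (Suc n) \<le> h (norm x)"
        using sb by (simp add: field_simps)
      moreover have "0 \<le> soft (real (Suc n) * h (norm x)) / real (Suc n)" using sb by simp
      ultimately show ?case unfolding F_def real_norm_def
        by (intro wb soft_bounds(3,4)) (use elim in auto)
    qed
  qed (use F0 mab in auto)
  then have "integral\<^sup>L D (\<lambda>x. a x + b x) = 0" by (simp add: F0 LIMSEQ_const_iff)
  then show "integrable D (\<lambda>x. h' (norm x) / norm x * \<phi> x)"
    "integrable D (\<lambda>x. h (norm x) / (norm x)\<^sup>2 * (x \<bullet> G x))"
    "integral\<^sup>L D (\<lambda>x. h' (norm x) / norm x * \<phi> x) = - integral\<^sup>L D (\<lambda>x. h (norm x) / (norm x)\<^sup>2 * (x \<bullet> G x))"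
    using ia ib by (simp_all add: a_def b_def)
qed

lemma Young_ineq: "c > 0 \<Longrightarrow> \<bar>a * b\<bar> \<le> c / 2 * a\<^sup>2 + 1 / (2 * c) * b\<^sup>2" for a b c :: real
proof -
  assume c: "c > 0"
  have "0 \<le> (c * \<bar>a\<bar> - \<bar>b\<bar>)\<^sup>2 / (2 * c)" using c by simp
  also have "\<dots> = c / 2 * a\<^sup>2 + 1 / (2 * c) * b\<^sup>2 - \<bar>a * b\<bar>"
    using c by (simp add: power2_diff power_mult_distrib abs_mult) (simp add: field_simps power2_eq_square)
  finally show ?thesis by simp
qed

text \<open>The divergence identity for \<open>log_field\<close> is applied to the \<open>C\<^sup>1\<close> approximation
  \<open>sqrt (\<phi>\<^sup>2 + e\<^sup>2) - e\<close> of \<open>\<bar>\<phi>\<bar>\<close>.\<close>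

lemma Hardy_C1c:
  assumes k: "k > 0" and \<phi>: "C1c \<phi> G" and c: "c > 0"
  shows "integral\<^sup>L D (\<lambda>x. Vk k (norm x) * \<bar>\<phi> x\<bar>) \<le>
    c / 2 * integral\<^sup>L D (\<lambda>x. Vk k (norm x)) + 1 / (2 * c) * integral\<^sup>L D (\<lambda>x. (norm (G x))\<^sup>2)"
proof -
  interpret radial_field "log_field k" "\<lambda>r. r * Vk k r" by (rule radial_field_log[OF k])
  obtain M where M: "M > 0" "\<And>x. \<bar>\<phi> x\<bar> \<le> M" "\<And>x. norm (G x) \<le> M" using C1c_bounded[OF \<phi>] by metis
  have mG: "\<phi> \<in> borel_measurable D" "G \<in> borel_measurable D"
    using C1c_continuous[OF \<phi>] by (auto intro!: measurable_D_punctured intro: continuous_on_subset)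
  have iG: "integrable D (\<lambda>x. (norm (G x))\<^sup>2)"
    by (rule Bochner_Integration.integrable_bound[OF integrable_const_D[of "M\<^sup>2"]])
      (use M mG in \<open>auto intro!: AE_I2 power_mono\<close>)
  define B where "B = c / 2 * integral\<^sup>L D (\<lambda>x. Vk k (norm x)) + 1 / (2 * c) * integral\<^sup>L D (\<lambda>x. (norm (G x))\<^sup>2)"
  define \<psi> where "\<psi> = (\<lambda>e x. sqrt ((\<phi> x)\<^sup>2 + e\<^sup>2) - e)"
  have \<psi>0: "0 \<le> \<psi> e x" if "e > 0" for e x
  proof -
    have "sqrt (e\<^sup>2) \<le> sqrt ((\<phi> x)\<^sup>2 + e\<^sup>2)" by (intro real_sqrt_le_mono) auto
    then show ?thesis using that by (simp add: \<psi>_def)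
  qed
  have step: "integrable D (\<lambda>x. Vk k (norm x) * \<psi> e x)" "integral\<^sup>L D (\<lambda>x. Vk k (norm x) * \<psi> e x) \<le> B"
    if e: "e > 0" for e
  proof -
    have pos: "(\<phi> x)\<^sup>2 + e\<^sup>2 > 0" for x using e by (simp add: add_nonneg_pos)
    define H where "H = (\<lambda>x. (\<phi> x / sqrt ((\<phi> x)\<^sup>2 + e\<^sup>2)) *\<^sub>R G x)"
    have HG: "norm (H x) \<le> norm (G x)" for x
    proof -
      have "sqrt ((\<phi> x)\<^sup>2) \<le> sqrt ((\<phi> x)\<^sup>2 + e\<^sup>2)" by (intro real_sqrt_le_mono) auto
      then have "\<bar>\<phi> x / sqrt ((\<phi> x)\<^sup>2 + e\<^sup>2)\<bar> \<le> 1" using pos[of x] by (simp add: divide_le_eq_1)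
      then show ?thesis by (simp add: H_def mult_left_le_one_le del: abs_divide)
    qed
    have \<psi>: "C1c (\<psi> e) H"
      unfolding C1c_def
    proof (intro conjI allI)
      fix x
      have d\<phi>: "(\<phi> has_derivative (\<lambda>v. G x \<bullet> v)) (at x)" using \<phi> by (auto simp: C1c_def)
      have "((\<lambda>s. sqrt (s\<^sup>2 + e\<^sup>2) - e) has_real_derivative \<phi> x / sqrt ((\<phi> x)\<^sup>2 + e\<^sup>2)) (at (\<phi> x))"
      proof -
        have "((\<lambda>s. s\<^sup>2 + e\<^sup>2) has_real_derivative 2 * \<phi> x) (at (\<phi> x))" by (auto intro!: derivative_eq_intros)
        from DERIV_diff[OF DERIV_chain2[OF DERIV_real_sqrt[OF pos[of x]] this] DERIV_const[of e]]
        show ?thesis by (rule DERIV_cong) (simp add: field_simps)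
      qed
      from has_derivative_compose[OF d\<phi> this[unfolded has_field_derivative_def]]
      show "(\<psi> e has_derivative (\<lambda>v. H x \<bullet> v)) (at x)" by (simp add: \<psi>_def H_def)
      show "continuous_on UNIV H" unfolding H_def using pos
        by (intro continuous_intros C1c_continuous[OF \<phi>]) (auto simp: less_imp_neq[THEN not_sym])
      obtain K where "compact K" "K \<subseteq> B1" "\<And>x. x \<notin> K \<Longrightarrow> \<phi> x = 0" using C1c_support[OF \<phi>] by metis
      then show "\<exists>K. compact K \<and> K \<subseteq> B1 \<and> (\<forall>x. x \<notin> K \<longrightarrow> \<psi> e x = 0)"
        using e by (intro exI[of _ K]) (auto simp: \<psi>_def)
    qed
    have C1: "r * Vk k r / r \<le> 1 * Vk k r" if "0 < r" for r using that by simp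
    have C2: "log_field k r / r \<le> 1 * (1 + Vk k r)" if "0 < r" "r < 1" for r
    proof -
      have "log_field k r / r \<le> 1 + (log_field k r / r)\<^sup>2"
        using zero_le_power2[of "log_field k r / r - 1/2"] by (simp add: power2_eq_square algebra_simps)
      then show ?thesis using log_field_bounds(3)[OF k that] by simp
    qed
    note dv = divergence[OF k \<psi> C1 C2]
    have Vr: "r * Vk k r / r = Vk k r" for r by (cases "r = 0") (auto simp: Vk_def)
    show "integrable D (\<lambda>x. Vk k (norm x) * \<psi> e x)" using dv(1) unfolding Vr .
    have "integral\<^sup>L D (\<lambda>x. Vk k (norm x) * \<psi> e x) = integral\<^sup>L D (\<lambda>x. - (log_field k (norm x) / (norm x)\<^sup>2 * (x \<bullet> H x)))"
      using dv(3) unfolding Vr by simp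
    \<comment> \<open>Young's inequality splits the product of the field with
      \<open>norm (G x)\<close>, and the square of the field is absorbed by the weight.\<close>
    also have "\<dots> \<le> integral\<^sup>L D (\<lambda>x. c / 2 * Vk k (norm x) + 1 / (2 * c) * (norm (G x))\<^sup>2)"
    proof (rule integral_mono_AE)
      show "AE x in D. - (log_field k (norm x) / (norm x)\<^sup>2 * (x \<bullet> H x)) \<le> c / 2 * Vk k (norm x) + 1 / (2 * c) * (norm (G x))\<^sup>2"
        using AE_D
      proof eventually_elim
        case (elim x)
        note lf = log_field_bounds[OF k, of "norm x"]
        have "\<bar>x \<bullet> H x\<bar> \<le> norm x * norm (G x)"
          using Cauchy_Schwarz_ineq2[of x "H x"] mult_left_mono[OF HG[of x], of "norm x"] by simp
        then have "\<bar>x \<bullet> H x\<bar> / norm x \<le> norm (G x)" using elim by (simp add: pos_divide_le_eq mult.commute)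
        then have "log_field k (norm x) / norm x * (\<bar>x \<bullet> H x\<bar> / norm x) \<le> log_field k (norm x) / norm x * norm (G x)"
          using lf elim by (intro mult_left_mono) auto
        moreover have "- (log_field k (norm x) / (norm x)\<^sup>2 * (x \<bullet> H x)) \<le> log_field k (norm x) / norm x * (\<bar>x \<bullet> H x\<bar> / norm x)"
        proof -
          have "- (log_field k (norm x) / (norm x)\<^sup>2 * (x \<bullet> H x)) \<le> \<bar>log_field k (norm x) / (norm x)\<^sup>2 * (x \<bullet> H x)\<bar>" by linarith
          also have "\<dots> = log_field k (norm x) / norm x * (\<bar>x \<bullet> H x\<bar> / norm x)"
            using lf elim by (simp add: abs_mult power2_eq_square)
          finally show ?thesis .
        qed
        moreover have "log_field k (norm x) / norm x * norm (G x) \<le> c / 2 * (log_field k (norm x) / norm x)\<^sup>2 + 1 / (2 * c) * (norm (G x))\<^sup>2"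
          using Young_ineq[OF c, of "log_field k (norm x) / norm x" "norm (G x)"] by linarith
        moreover have "c / 2 * (log_field k (norm x) / norm x)\<^sup>2 \<le> c / 2 * Vk k (norm x)"
          using lf elim c by (intro mult_left_mono) auto
        ultimately show ?case by linarith
      qed
    qed (use dv(2) integrable_Vk[OF k] iG in auto)
    also have "\<dots> = B" using integrable_Vk[OF k] iG by (simp add: B_def)
    finally show "integral\<^sup>L D (\<lambda>x. Vk k (norm x) * \<psi> e x) \<le> B" .
  qed
  \<comment> \<open>The bound \<open>B\<close> does not depend on \<open>e\<close>, so Fatou's lemma
    applies as \<open>e = 1 / Suc n\<close> tends to 0.\<close>
  have "integral\<^sup>L D (\<lambda>x. Vk k (norm x) * \<bar>\<phi> x\<bar>) \<le> B"
  proof (rule integrable_Fatou(2)[where f="\<lambda>n x. Vk k (norm x) * \<psi> (1 / real (Suc n)) x"])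
    have i: "(\<lambda>n. 1 / real (Suc n)) \<longlonglongrightarrow> 0" using LIMSEQ_inverse_real_of_nat by (simp add: inverse_eq_divide)
    show "AE x in D. (\<lambda>n. Vk k (norm x) * \<psi> (1 / real (Suc n)) x) \<longlonglongrightarrow> Vk k (norm x) * \<bar>\<phi> x\<bar>"
    proof (rule AE_I2)
      fix x
      have "(\<lambda>n. Vk k (norm x) * \<psi> (1 / real (Suc n)) x) \<longlonglongrightarrow> Vk k (norm x) * (sqrt ((\<phi> x)\<^sup>2 + 0\<^sup>2) - 0)"
        unfolding \<psi>_def by (intro tendsto_intros i)
      then show "(\<lambda>n. Vk k (norm x) * \<psi> (1 / real (Suc n)) x) \<longlonglongrightarrow> Vk k (norm x) * \<bar>\<phi> x\<bar>" by simp
    qed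
    show "(\<lambda>x. Vk k (norm x) * \<bar>\<phi> x\<bar>) \<in> borel_measurable D"
      by (intro borel_measurable_times measurable_Vk borel_measurable_abs mG)
  qed (use step \<psi>0 Vk_nonneg in \<open>auto intro!: AE_I2\<close>)
  then show ?thesis by (simp add: B_def)
qed

section \<open>Limits in the Sobolev space\<close>

lemma test_function_radial:
  fixes \<Phi> :: "real \<Rightarrow> real"
  assumes "\<And>m. Cm m UNIV \<Phi>" and "\<delta> > 0" "\<delta> < 1" and "\<And>s. s > 1 - \<delta> \<Longrightarrow> \<Phi> s = 0"
  shows "test_function (ball (0::'a::euclidean_space) 1) (\<lambda>x. \<Phi> (x \<bullet> x))"
proof -
  have sub: "{x::'a. \<Phi> (x \<bullet> x) \<noteq> 0} \<subseteq> cball 0 (sqrt (1 - \<delta>))"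
  proof clarsimp
    fix x :: 'a assume "\<Phi> (x \<bullet> x) \<noteq> 0"
    then have "x \<bullet> x \<le> 1 - \<delta>" using assms(4)[of "x \<bullet> x"] by force
    then show "norm x \<le> sqrt (1 - \<delta>)" by (simp add: norm_eq_sqrt_inner)
  qed
  then have cl: "closure {x::'a. \<Phi> (x \<bullet> x) \<noteq> 0} \<subseteq> cball 0 (sqrt (1 - \<delta>))"
    by (intro closure_minimal) auto
  have "sqrt (1 - \<delta>) < 1" using assms by (simp add: real_sqrt_lt_1_iff)
  then have "cball (0::'a) (sqrt (1 - \<delta>)) \<subseteq> ball 0 1"
    by (intro subsetI) (metis mem_ball_0 mem_cball_0 order_le_less_trans)
  then show ?thesis unfolding test_function_def
    using cl Ck_radial[OF assms(1)] bounded_subset[OF bounded_cball sub] by (auto simp: compact_closure)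
qed

lemma C1c_diff:
  assumes "C1c \<phi> G" "C1c \<psi> H" shows "C1c (\<lambda>x. \<phi> x - \<psi> x) (\<lambda>x. G x - H x)"
proof -
  obtain K1 where K1: "compact K1" "K1 \<subseteq> B1" "\<And>x. x \<notin> K1 \<Longrightarrow> \<phi> x = 0" using C1c_support[OF assms(1)] by metis
  obtain K2 where K2: "compact K2" "K2 \<subseteq> B1" "\<And>x. x \<notin> K2 \<Longrightarrow> \<psi> x = 0" using C1c_support[OF assms(2)] by metis
  show ?thesis unfolding C1c_def
  proof (intro conjI allI)
    fix x
    have "((\<lambda>x. \<phi> x - \<psi> x) has_derivative (\<lambda>v. G x \<bullet> v - H x \<bullet> v)) (at x)"
      using assms by (intro has_derivative_diff) (auto simp: C1c_def)
    then show "((\<lambda>x. \<phi> x - \<psi> x) has_derivative (\<lambda>v. (G x - H x) \<bullet> v)) (at x)" by (simp add: inner_diff_left)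
    show "continuous_on UNIV (\<lambda>x. G x - H x)" using assms by (intro continuous_intros C1c_continuous)
    show "\<exists>K. compact K \<and> K \<subseteq> B1 \<and> (\<forall>x. x \<notin> K \<longrightarrow> \<phi> x - \<psi> x = 0)"
      using K1 K2 by (intro exI[of _ "K1 \<union> K2"]) auto
  qed
qed

lemma C1c_measurable:
  assumes "C1c \<phi> G"
  shows "\<phi> \<in> borel_measurable D" "G \<in> borel_measurable D"
  using C1c_continuous[OF assms] by (auto intro!: measurable_D_punctured intro: continuous_on_subset)

lemma integrable_D_bounded:
  fixes f :: "plane \<Rightarrow> real"
  assumes "f \<in> borel_measurable D" "AE x in D. \<bar>f x\<bar> \<le> C"
  shows "integrable D f"
proof (rule Bochner_Integration.integrable_bound[OF integrable_const_D[of C]])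
  show "AE x in D. norm (f x) \<le> norm C" using assms(2) by eventually_elim auto
qed fact

lemma C1c_square_integrable:
  assumes "C1c \<phi> G"
  shows "integrable D (\<lambda>x. (\<phi> x)\<^sup>2)" "integrable D (\<lambda>x. (norm (G x))\<^sup>2)"
proof -
  obtain M where M: "M > 0" "\<And>x. \<bar>\<phi> x\<bar> \<le> M" "\<And>x. norm (G x) \<le> M" using C1c_bounded[OF assms] by metis
  note m = C1c_measurable[OF assms]
  show "integrable D (\<lambda>x. (\<phi> x)\<^sup>2)"
    by (rule integrable_D_bounded[where C="M\<^sup>2"])
      (use m M in \<open>auto intro!: AE_I2 simp: abs_le_square_iff[symmetric]\<close>)
  show "integrable D (\<lambda>x. (norm (G x))\<^sup>2)"
    by (rule integrable_D_bounded[where C="M\<^sup>2"])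
      (use m M in \<open>auto intro!: AE_I2 power_mono\<close>)
qed

lemma C1c_Vk_integrable:
  assumes "C1c \<phi> G" and k: "k > 0"
  shows "integrable D (\<lambda>x. Vk k (norm x) * \<bar>\<phi> x\<bar>)"
proof -
  obtain M where M: "M > 0" "\<And>x. \<bar>\<phi> x\<bar> \<le> M" using C1c_bounded[OF assms(1)] by metis
  show ?thesis
  proof (rule Bochner_Integration.integrable_bound)
    show "integrable D (\<lambda>x. Vk k (norm x) * M)" using integrable_Vk[OF k] by simp
    show "AE x in D. norm (Vk k (norm x) * \<bar>\<phi> x\<bar>) \<le> norm (Vk k (norm x) * M)"
      using M Vk_nonneg by (auto intro!: AE_I2 mult_left_mono simp: abs_mult)
  qed (intro borel_measurable_times borel_measurable_abs measurable_Vk C1c_measurable[OF assms(1)])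
qed

lemma norm_diff_square_le: "(norm (a - b))\<^sup>2 \<le> 2 * (norm a)\<^sup>2 + 2 * (norm b)\<^sup>2"
  for a b :: "'a::real_normed_vector"
proof -
  have "(norm (a - b))\<^sup>2 \<le> (norm a + norm b)\<^sup>2" by (intro power_mono norm_triangle_ineq4) auto
  also have "\<dots> \<le> 2 * (norm a)\<^sup>2 + 2 * (norm b)\<^sup>2"
    using zero_le_power2[of "norm a - norm b"] by (simp add: power2_eq_square algebra_simps)
  finally show ?thesis .
qed

lemma integrable_norm_diff_square:
  fixes f g :: "plane \<Rightarrow> 'b::euclidean_space"
  assumes "f \<in> borel_measurable D" "g \<in> borel_measurable D"
    "integrable D (\<lambda>x. (norm (f x))\<^sup>2)" "integrable D (\<lambda>x. (norm (g x))\<^sup>2)"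
  shows "integrable D (\<lambda>x. (norm (f x - g x))\<^sup>2)"
proof (rule Bochner_Integration.integrable_bound)
  show "integrable D (\<lambda>x. 2 * (norm (f x))\<^sup>2 + 2 * (norm (g x))\<^sup>2)" using assms by simp
qed (use assms norm_diff_square_le in \<open>auto intro!: AE_I2\<close>)

lemma integrable_inner_D:
  fixes f g :: "plane \<Rightarrow> 'b::euclidean_space"
  assumes "f \<in> borel_measurable D" "g \<in> borel_measurable D"
    "integrable D (\<lambda>x. (norm (f x))\<^sup>2)" "integrable D (\<lambda>x. (norm (g x))\<^sup>2)" and c: "c > 0"
  shows "integrable D (\<lambda>x. f x \<bullet> g x)"
    and "\<bar>integral\<^sup>L D (\<lambda>x. f x \<bullet> g x)\<bar> \<le> c / 2 * integral\<^sup>L D (\<lambda>x. (norm (f x))\<^sup>2) + 1 / (2 * c) * integral\<^sup>L D (\<lambda>x. (norm (g x))\<^sup>2)"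
proof -
  have le: "\<bar>f x \<bullet> g x\<bar> \<le> c / 2 * (norm (f x))\<^sup>2 + 1 / (2 * c) * (norm (g x))\<^sup>2" for x
    using Cauchy_Schwarz_ineq2[of "f x" "g x"] Young_ineq[OF c, of "norm (f x)" "norm (g x)"] by simp
  have i: "integrable D (\<lambda>x. c / 2 * (norm (f x))\<^sup>2 + 1 / (2 * c) * (norm (g x))\<^sup>2)"
    using assms by simp
  show I: "integrable D (\<lambda>x. f x \<bullet> g x)"
    by (rule Bochner_Integration.integrable_bound[OF i]) (use assms le in \<open>auto intro!: AE_I2 order_trans[OF le]\<close>)
  have "\<bar>integral\<^sup>L D (\<lambda>x. f x \<bullet> g x)\<bar> \<le> integral\<^sup>L D (\<lambda>x. \<bar>f x \<bullet> g x\<bar>)"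
    by (rule integral_abs_bound)
  also have "\<dots> \<le> integral\<^sup>L D (\<lambda>x. c / 2 * (norm (f x))\<^sup>2 + 1 / (2 * c) * (norm (g x))\<^sup>2)"
    by (rule integral_mono) (use I i le in auto)
  finally show "\<bar>integral\<^sup>L D (\<lambda>x. f x \<bullet> g x)\<bar> \<le> c / 2 * integral\<^sup>L D (\<lambda>x. (norm (f x))\<^sup>2) + 1 / (2 * c) * integral\<^sup>L D (\<lambda>x. (norm (g x))\<^sup>2)"
    using assms by simp
qed

text \<open>Hardy's inequality for \<open>\<psi> n - \<psi> m\<close> makes the approximations
  Cauchy in the weighted \<open>L^1\<close> norm. A subsequence converges to \<open>\<phi>\<close>
  almost everywhere, and Fatou's lemma in \<open>m\<close> transfers the estimate to
  \<open>\<psi> n - \<phi>\<close>.\<close>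

lemma H10_limit:
  assumes k: "k > 0" and H: "H10_grad B1 \<phi> h"
  obtains \<psi> where "\<And>n. test_function B1 (\<psi> n)"
    "(\<lambda>n. integral\<^sup>L D (\<lambda>x. (norm (h x - grad (\<psi> n) x))\<^sup>2)) \<longlonglongrightarrow> 0"
    "\<And>n. integrable D (\<lambda>x. (norm (h x - grad (\<psi> n) x))\<^sup>2)"
    "integrable D (\<lambda>x. Vk k (norm x) * \<bar>\<phi> x\<bar>)"
    "(\<lambda>n. integral\<^sup>L D (\<lambda>x. Vk k (norm x) * \<bar>\<psi> n x - \<phi> x\<bar>)) \<longlonglongrightarrow> 0"
proof -
  have L2: "L2_on B1 \<phi>" "L2_on B1 h" using H by (auto simp: H10_grad_def H1_grad_def)
  obtain \<eta> where \<eta>: "\<And>n. test_function B1 (\<eta> n)"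
    and \<eta>l: "(\<lambda>n. integral\<^sup>L D (\<lambda>x. (\<phi> x - \<eta> n x)\<^sup>2 + (norm (h x - grad (\<eta> n) x))\<^sup>2)) \<longlonglongrightarrow> 0"
    using H by (auto simp: H10_grad_def)
  note C = test_function_C1c[OF \<eta>]
  have i1: "integrable D (\<lambda>x. (\<phi> x - \<eta> n x)\<^sup>2)" for n
    using integrable_norm_diff_square[of \<phi> "\<eta> n"] L2 C1c_measurable[OF C, of n] C1c_square_integrable(1)[OF C, of n]
    by (auto simp: L2_on_def)
  have i2: "integrable D (\<lambda>x. (norm (h x - grad (\<eta> n) x))\<^sup>2)" for n
    using integrable_norm_diff_square[of h "grad (\<eta> n)"] L2 C1c_measurable[OF C, of n] C1c_square_integrable(2)[OF C, of n]
    by (auto simp: L2_on_def)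
  have e: "integral\<^sup>L D (\<lambda>x. (\<phi> x - \<eta> n x)\<^sup>2 + (norm (h x - grad (\<eta> n) x))\<^sup>2) =
      integral\<^sup>L D (\<lambda>x. (\<phi> x - \<eta> n x)\<^sup>2) + integral\<^sup>L D (\<lambda>x. (norm (h x - grad (\<eta> n) x))\<^sup>2)" for n
    by (rule Bochner_Integration.integral_add[OF i1 i2])
  have l1: "(\<lambda>n. integral\<^sup>L D (\<lambda>x. (\<phi> x - \<eta> n x)\<^sup>2)) \<longlonglongrightarrow> 0"
    by (rule tendsto_sandwich[OF _ _ tendsto_const \<eta>l]) (auto simp: e intro!: always_eventually)
  have l2: "(\<lambda>n. integral\<^sup>L D (\<lambda>x. (norm (h x - grad (\<eta> n) x))\<^sup>2)) \<longlonglongrightarrow> 0"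
    by (rule tendsto_sandwich[OF _ _ tendsto_const \<eta>l]) (auto simp: e intro!: always_eventually)
  obtain r where r: "strict_mono r" "AE x in D. (\<lambda>n. (\<phi> x - \<eta> (r n) x)\<^sup>2) \<longlonglongrightarrow> 0"
    using tendsto_L1_AE_subseq[of D "\<lambda>n x. (\<phi> x - \<eta> n x)\<^sup>2"] i1 l1 by auto
  define \<psi> where "\<psi> = (\<lambda>n. \<eta> (r n))"
  define d where "d = (\<lambda>n. integral\<^sup>L D (\<lambda>x. (norm (h x - grad (\<psi> n) x))\<^sup>2))"
  have d: "d \<longlonglongrightarrow> 0" using LIMSEQ_subseq_LIMSEQ[OF l2 r(1)] by (simp add: d_def \<psi>_def o_def)
  have d0: "d n \<ge> 0" for n by (simp add: d_def)
  have j2: "integrable D (\<lambda>x. (norm (h x - grad (\<psi> n) x))\<^sup>2)" for n using i2 by (simp add: \<psi>_def)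
  have C\<psi>: "C1c (\<psi> n) (grad (\<psi> n))" for n using C by (simp add: \<psi>_def)
  have ae: "AE x in D. (\<lambda>n. \<psi> n x) \<longlonglongrightarrow> \<phi> x"
    using r(2)
  proof eventually_elim
    case (elim x)
    then have "(\<lambda>n. sqrt ((\<phi> x - \<psi> n x)\<^sup>2)) \<longlonglongrightarrow> sqrt 0" unfolding \<psi>_def by (rule tendsto_real_sqrt)
    then have "(\<lambda>n. \<bar>\<psi> n x - \<phi> x\<bar>) \<longlonglongrightarrow> 0" by (simp add: abs_minus_commute)
    then have "(\<lambda>n. \<psi> n x - \<phi> x) \<longlonglongrightarrow> 0" by (simp add: tendsto_rabs_zero_iff)
    then show ?case by (simp add: LIM_zero_iff)
  qed
  define A where "A = integral\<^sup>L D (\<lambda>x. Vk k (norm x))"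
  have A: "A \<ge> 0" using Vk_nonneg by (simp add: A_def)
  have m\<phi>: "\<phi> \<in> borel_measurable D" using L2 by (simp add: L2_on_def)
  note m\<psi> = C1c_measurable[OF C\<psi>]
  have grad_diff: "integral\<^sup>L D (\<lambda>x. (norm (grad (\<psi> n) x - grad (\<psi> m) x))\<^sup>2) \<le> 2 * d n + 2 * d m" for n m
  proof -
    have "integral\<^sup>L D (\<lambda>x. (norm (grad (\<psi> n) x - grad (\<psi> m) x))\<^sup>2) \<le>
      integral\<^sup>L D (\<lambda>x. 2 * (norm (h x - grad (\<psi> m) x))\<^sup>2 + 2 * (norm (h x - grad (\<psi> n) x))\<^sup>2)"
    proof (rule integral_mono)
      show "integrable D (\<lambda>x. (norm (grad (\<psi> n) x - grad (\<psi> m) x))\<^sup>2)"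
        by (intro integrable_norm_diff_square m\<psi> C1c_square_integrable(2)[OF C\<psi>])
      show "(norm (grad (\<psi> n) x - grad (\<psi> m) x))\<^sup>2 \<le> 2 * (norm (h x - grad (\<psi> m) x))\<^sup>2 + 2 * (norm (h x - grad (\<psi> n) x))\<^sup>2" for x
        using norm_diff_square_le[of "h x - grad (\<psi> m) x" "h x - grad (\<psi> n) x"] by simp
    qed (use j2 in auto)
    also have "\<dots> = 2 * d m + 2 * d n" using j2 by (simp add: d_def)
    finally show ?thesis by simp
  qed
  have key: "\<exists>m0. \<forall>n\<ge>m0. integrable D (\<lambda>x. Vk k (norm x) * \<bar>\<psi> n x - \<phi> x\<bar>) \<and>
      integral\<^sup>L D (\<lambda>x. Vk k (norm x) * \<bar>\<psi> n x - \<phi> x\<bar>) \<le> \<epsilon>" if \<epsilon>: "\<epsilon> > 0" for \<epsilon>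
  proof -
    \<comment> \<open>Makes both terms of Hardy's bound at most \<open>\<epsilon> / 2\<close>:
      \<open>c / 2 * A \<le> \<epsilon> / 2\<close>, and \<open>d n < c * \<epsilon> / 4\<close>
      controls \<open>(2 * d n + 2 * d m) / (2 * c)\<close>. The added 1 avoids division by
      0.\<close>
    define c where "c = \<epsilon> / (A + 1)"
    have c: "c > 0" using \<epsilon> A by (simp add: c_def add_nonneg_pos)
    have "0 < c * \<epsilon> / 4" using c \<epsilon> by simp
    then have "\<forall>\<^sub>F n in sequentially. d n < c * \<epsilon> / 4" by (rule order_tendstoD(2)[OF d])
    then obtain m0 where m0: "\<And>n. n \<ge> m0 \<Longrightarrow> d n < c * \<epsilon> / 4" by (auto simp: eventually_sequentially)
    have "integrable D (\<lambda>x. Vk k (norm x) * \<bar>\<psi> n x - \<phi> x\<bar>) \<and>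
      integral\<^sup>L D (\<lambda>x. Vk k (norm x) * \<bar>\<psi> n x - \<phi> x\<bar>) \<le> \<epsilon>" if n: "n \<ge> m0" for n
    proof -
      \<comment> \<open>The shift by \<open>m0\<close> makes the bound hold for every
        \<open>m\<close>, as Fatou's lemma requires.\<close>
      let ?f = "\<lambda>m x. Vk k (norm x) * \<bar>\<psi> n x - \<psi> (m + m0) x\<bar>"
      have 1: "integrable D (?f m)" for m
        by (rule C1c_Vk_integrable[OF C1c_diff[OF C\<psi> C\<psi>] k])
      have 2: "integral\<^sup>L D (?f m) \<le> \<epsilon>" for m
      proof -
        have "integral\<^sup>L D (?f m) \<le> c / 2 * A + 1 / (2 * c) * (2 * d n + 2 * d (m + m0))"
          unfolding A_def using c
          by (intro order_trans[OF Hardy_C1c[OF k C1c_diff[OF C\<psi> C\<psi>] c]] add_left_mono mult_left_mono grad_diff) auto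
        also have "\<dots> \<le> c / 2 * A + 1 / (2 * c) * (c * \<epsilon>)"
          using c m0[OF n] m0[of "m + m0"] by (intro add_left_mono mult_left_mono) auto
        also have "\<dots> = c / 2 * A + \<epsilon> / 2" using c by simp
        also have "c / 2 * A \<le> \<epsilon> / 2" using \<epsilon> A by (simp add: c_def field_simps)
        finally show ?thesis by simp
      qed
      have 3: "AE x in D. (\<lambda>m. ?f m x) \<longlonglongrightarrow> Vk k (norm x) * \<bar>\<psi> n x - \<phi> x\<bar>"
        using ae
      proof eventually_elim
        case (elim x)
        then have "(\<lambda>m. \<psi> (m + m0) x) \<longlonglongrightarrow> \<phi> x" by (rule LIMSEQ_ignore_initial_segment)
        then show ?case by (intro tendsto_intros)
      qed
      have 4: "(\<lambda>x. Vk k (norm x) * \<bar>\<psi> n x - \<phi> x\<bar>) \<in> borel_measurable D"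
        by (intro borel_measurable_times borel_measurable_abs borel_measurable_diff measurable_Vk m\<psi> m\<phi>)
      have 5: "AE x in D. 0 \<le> ?f m x" for m using Vk_nonneg by (auto intro!: AE_I2)
      show ?thesis using integrable_Fatou[OF 1 5 2 3 4] by blast
    qed
    then show ?thesis by blast
  qed
  show ?thesis
  proof (rule that[of \<psi>])
    show "test_function B1 (\<psi> n)" for n using \<eta> by (simp add: \<psi>_def)
    show "(\<lambda>n. integral\<^sup>L D (\<lambda>x. (norm (h x - grad (\<psi> n) x))\<^sup>2)) \<longlonglongrightarrow> 0" using d by (simp add: d_def)
    show "integrable D (\<lambda>x. (norm (h x - grad (\<psi> n) x))\<^sup>2)" for n by (rule j2)
    show "(\<lambda>n. integral\<^sup>L D (\<lambda>x. Vk k (norm x) * \<bar>\<psi> n x - \<phi> x\<bar>)) \<longlonglongrightarrow> 0"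
    proof (rule LIMSEQ_I)
      fix \<epsilon> :: real assume "\<epsilon> > 0"
      then obtain m0 where m0: "\<And>n. n \<ge> m0 \<Longrightarrow> integral\<^sup>L D (\<lambda>x. Vk k (norm x) * \<bar>\<psi> n x - \<phi> x\<bar>) \<le> \<epsilon> / 2"
        using key[of "\<epsilon> / 2"] by auto
      have "0 \<le> integral\<^sup>L D (\<lambda>x. Vk k (norm x) * \<bar>\<psi> n x - \<phi> x\<bar>)" for n
        using Vk_nonneg by (intro integral_nonneg_AE AE_I2) auto
      then have "norm (integral\<^sup>L D (\<lambda>x. Vk k (norm x) * \<bar>\<psi> n x - \<phi> x\<bar>) - 0) < \<epsilon>" if "n \<ge> m0" for n
        using m0[OF that] \<open>\<epsilon> > 0\<close> by (simp add: abs_of_nonneg)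
      then show "\<exists>no. \<forall>n\<ge>no. norm (integral\<^sup>L D (\<lambda>x. Vk k (norm x) * \<bar>\<psi> n x - \<phi> x\<bar>) - 0) < \<epsilon>" by blast
    qed
    obtain n where n: "integrable D (\<lambda>x. Vk k (norm x) * \<bar>\<psi> n x - \<phi> x\<bar>)" using key[of 1] by auto
    show "integrable D (\<lambda>x. Vk k (norm x) * \<bar>\<phi> x\<bar>)"
    proof (rule Bochner_Integration.integrable_bound)
      show "integrable D (\<lambda>x. Vk k (norm x) * \<bar>\<psi> n x - \<phi> x\<bar> + Vk k (norm x) * \<bar>\<psi> n x\<bar>)"
        by (intro Bochner_Integration.integrable_add n C1c_Vk_integrable[OF C\<psi> k])
      show "AE x in D. norm (Vk k (norm x) * \<bar>\<phi> x\<bar>) \<le> norm (Vk k (norm x) * \<bar>\<psi> n x - \<phi> x\<bar> + Vk k (norm x) * \<bar>\<psi> n x\<bar>)"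
      proof (rule AE_I2)
        fix x
        have "Vk k (norm x) * \<bar>\<phi> x\<bar> \<le> Vk k (norm x) * (\<bar>\<psi> n x - \<phi> x\<bar> + \<bar>\<psi> n x\<bar>)"
          by (intro mult_left_mono Vk_nonneg) linarith
        then show "norm (Vk k (norm x) * \<bar>\<phi> x\<bar>) \<le> norm (Vk k (norm x) * \<bar>\<psi> n x - \<phi> x\<bar> + Vk k (norm x) * \<bar>\<psi> n x\<bar>)"
          using Vk_nonneg[of k "norm x"] by (simp add: abs_mult distrib_left)
      qed
    qed (intro borel_measurable_times borel_measurable_abs measurable_Vk m\<phi>)
  qed
qed

section \<open>Radial solutions are weak solutions\<close>

text \<open>\<open>h\<close> is the flux \<open>- r * w'\<close>, by which the equation becomes a
  first-order system. The bound of \<open>(h / r)^2\<close> by the weight is what makes the gradient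
  square integrable.\<close>

locale radial_sol =
  fixes k p l C :: real and w h :: "real \<Rightarrow> real" and u :: "plane \<Rightarrow> real"
  assumes k: "k > 0" and p: "p > 0" and l: "l > 0" and C: "C \<ge> 0"
    and w_cont: "continuous_on {0..1} w" and w_1: "w 1 = 0"
    and w_pos: "\<And>r. 0 \<le> r \<Longrightarrow> r < 1 \<Longrightarrow> 0 < w r"
    and w_le: "\<And>r. 0 < r \<Longrightarrow> r < 1 \<Longrightarrow> w r < w 0"
    and w_deriv: "\<And>r. 0 < r \<Longrightarrow> r < 1 \<Longrightarrow> (w has_real_derivative - h r / r) (at r)"
    and w_smooth: "\<And>m. Cm m {0<..<1} w"
    and h_pos: "\<And>r. 0 < r \<Longrightarrow> r < 1 \<Longrightarrow> 0 < h r"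
    and h_deriv: "\<And>r. 0 < r \<Longrightarrow> r < 1 \<Longrightarrow> (h has_real_derivative r * (l * Vk k r * nonlin p (w r))) (at r)"
    and h_lim: "(h \<longlongrightarrow> 0) (at_right 0)"
    and h_bound: "\<And>r. 0 < r \<Longrightarrow> r < 1 \<Longrightarrow> (h r / r)\<^sup>2 \<le> C * Vk k r"
    and u_eq: "\<And>x. x \<in> cball 0 1 \<Longrightarrow> u x = w (norm x)"
begin

abbreviation F :: real where "F \<equiv> nonlin p (w 0)"

lemma nonlin_bounds: assumes "0 < r" "r < 1" shows "0 \<le> nonlin p (w r)" "nonlin p (w r) \<le> F"
  using assms w_pos[of r] w_le[OF assms] p by (auto simp: nonlin_def intro!: powr_mono2)

sublocale fld: radial_field h "\<lambda>r. r * (l * Vk k r * nonlin p (w r))"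
proof
  have wc: "continuous_on {0<..<1} w" by (rule continuous_on_subset[OF w_cont]) auto
  have "1 + w r \<noteq> 0" if "r \<in> {0<..<1}" for r using w_pos[of r] that by auto
  then show "continuous_on {0<..<1} (\<lambda>r. r * (l * Vk k r * nonlin p (w r)))"
    unfolding nonlin_def
    by (intro continuous_intros continuous_on_subset[OF continuous_on_Vk] wc) auto
qed (use h_pos h_deriv h_lim Vk_nonneg nonlin_bounds l in auto)

definition g :: "plane \<Rightarrow> plane" where "g x = (- h (norm x) / (norm x)\<^sup>2) *\<^sub>R x"

lemma u_lt: "x \<in> B1 - {0} \<Longrightarrow> 0 < u x \<and> u x < w 0"
  using u_eq[of x] w_pos[of "norm x"] w_le[of "norm x"] by auto

lemma u_measurable: "u \<in> borel_measurable D"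
proof (rule measurable_D_punctured)
  have "continuous_on (B1 - {0}) (\<lambda>x. w (norm x))"
    by (rule continuous_on_compose2[OF w_cont]) (auto intro!: continuous_intros)
  then show "continuous_on (B1 - {0}) u"
    by (rule continuous_on_cong[THEN iffD1, rotated 2]) (auto simp: u_eq)
qed

lemma g_measurable: "g \<in> borel_measurable D"
proof (rule measurable_D_punctured)
  have "continuous_on (B1 - {0}) (\<lambda>x :: plane. h (norm x))"
    by (rule continuous_on_compose2[OF fld.h_cont]) (auto intro!: continuous_intros)
  then show "continuous_on (B1 - {0}) g"
    unfolding g_def by (intro continuous_intros) auto
qed

lemma norm_g: "x \<in> B1 - {0} \<Longrightarrow> norm (g x) = h (norm x) / norm x"
  using h_pos[of "norm x"] by (simp add: g_def power2_eq_square)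

lemma g_square_integrable: "integrable D (\<lambda>x. (norm (g x))\<^sup>2)"
proof (rule Bochner_Integration.integrable_bound)
  show "integrable D (\<lambda>x. C * Vk k (norm x))" using integrable_Vk[OF k] by simp
  show "AE x in D. norm ((norm (g x))\<^sup>2) \<le> norm (C * Vk k (norm x))"
    using AE_D
  proof eventually_elim
    case (elim x)
    then show ?case using h_bound[of "norm x"] C Vk_nonneg[of k "norm x"] norm_g[of x] by simp
  qed
  show "(\<lambda>x. (norm (g x))\<^sup>2) \<in> borel_measurable D"
    by (intro borel_measurable_power measurable_compose[OF _ borel_measurable_norm] g_measurable)
qed

lemma L2_u: "L2_on B1 u"
  unfolding L2_on_def
proof
  show "integrable D (\<lambda>x. (norm (u x))\<^sup>2)"
  proof (rule integrable_D_bounded)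
    show "AE x in D. \<bar>(norm (u x))\<^sup>2\<bar> \<le> (w 0)\<^sup>2"
      using AE_D
    proof eventually_elim
      case (elim x)
      then show ?case using u_lt[of x] by (auto simp: abs_le_square_iff[symmetric])
    qed
  qed (intro borel_measurable_power measurable_compose[OF _ borel_measurable_norm] u_measurable)
qed (rule u_measurable)

lemma L2_g: "L2_on B1 g"
  unfolding L2_on_def using g_measurable g_square_integrable by simp

text \<open>Truncating in the range of \<open>u\<close> rather than in the disc keeps the gradients
  bounded by a multiple of that of \<open>u\<close>: the chain rule only brings in the bounded
  derivatives of the truncation.\<close>

lemma approximation_exists:
  "\<exists>\<phi> B. (\<forall>n. test_function B1 (\<phi> n)) \<and>
    (\<forall>n x. x \<in> B1 - {0} \<longrightarrow> \<bar>\<phi> n x\<bar> \<le> 2 * w 0 \<and> norm (grad (\<phi> n) x) \<le> B * norm (g x)) \<and>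
    (\<forall>x \<in> B1 - {0}. (\<lambda>n. \<phi> n x) \<longlonglongrightarrow> u x \<and> (\<lambda>n. grad (\<phi> n) x) \<longlonglongrightarrow> g x)"
proof -
  define a where "a = w 0"
  have a: "a > 0" using w_pos[of 0] by (simp add: a_def)
  obtain \<theta> K where \<theta>: "\<And>m. Cm m UNIV \<theta>" "\<And>y. y \<le> 1 \<Longrightarrow> \<theta> y = 0" "\<And>y. y \<ge> 2 \<Longrightarrow> \<theta> y = y"
    "\<And>y. \<bar>\<theta> y\<bar> \<le> \<bar>y\<bar>" "\<And>y. \<bar>deriv \<theta> y\<bar> \<le> K"
    using smooth_truncation_exists by metis
  have K: "K \<ge> 0" using \<theta>(5)[of 0] by linarith
  \<comment> \<open>\<open>N n * a > 3\<close> separates the two truncations: where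
    \<open>N n * y \<le> 1\<close> one has \<open>N n * (a - y) \<ge> 2\<close>, so the upper one is
    inactive.\<close>
  obtain N0 :: nat where N0: "3 / a < real N0" using reals_Archimedean2 by blast
  define N where "N = (\<lambda>n. real (n + N0))"
  have N: "N n > 0" "N n * a > 3" for n
  proof -
    have "3 / a < N n" using N0 by (simp add: N_def)
    then show "N n * a > 3" using a by (simp add: pos_divide_less_eq)
    have "0 < 3 / a" using a by simp
    then show "N n > 0" using \<open>3 / a < N n\<close> by linarith
  qed
  define t where "t = (\<lambda>n y. \<theta> (N n * y) / N n)"
  \<comment> \<open>The reflection \<open>y \<mapsto> a - y\<close> turns the truncation at 0 into
    one at the maximum \<open>a\<close>; the outer \<open>t\<close> then truncates at 0.\<close>
  define \<Psi> where "\<Psi> = (\<lambda>n y. t n (a - t n (a - y)))"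
  have td: "(t n has_real_derivative deriv \<theta> (N n * y)) (at y)" for n y
  proof -
    have "(\<theta> has_real_derivative deriv \<theta> z) (at z)" for z using \<theta>(1)[of "Suc 0"] by simp
    from DERIV_cdivide[OF DERIV_chain2[OF this DERIV_cmult[OF DERIV_ident]], of "N n" "N n"]
    show ?thesis using N(1)[of n] by (simp add: t_def[abs_def])
  qed
  have \<Psi>d: "(\<Psi> n has_real_derivative deriv \<theta> (N n * (a - t n (a - y))) * deriv \<theta> (N n * (a - y))) (at y)" for n y
  proof -
    have "((\<lambda>y. a - y) has_real_derivative - 1) (at y)" by (auto intro!: derivative_eq_intros)
    from DERIV_chain2[OF td this] have "((\<lambda>y. a - t n (a - y)) has_real_derivative 0 - deriv \<theta> (N n * (a - y)) * (- 1)) (at y)"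
      by (intro DERIV_diff DERIV_const)
    from DERIV_chain2[OF td this] show ?thesis unfolding \<Psi>_def by simp
  qed
  have t_le: "\<bar>t n y\<bar> \<le> \<bar>y\<bar>" for n y
    using \<theta>(4)[of "N n * y"] N(1)[of n] by (simp add: t_def abs_mult field_simps)
  have t0: "t n y = 0" if "N n * y \<le> 1" for n y using \<theta>(2)[OF that] by (simp add: t_def)
  have t1: "t n y = y" if "N n * y \<ge> 2" for n y using \<theta>(3)[OF that] N(1)[of n] by (simp add: t_def)
  have Ct: "Cm m UNIV (t n)" for m n
    unfolding t_def divide_inverse mult.commute[of _ "inverse _"]
    by (intro Cm_cmult Cm_compose[OF _ \<theta>(1)] Cm_ident) auto
  have C\<Psi>: "Cm m UNIV (\<Psi> n)" for m n
    unfolding \<Psi>_def by (intro Cm_compose[OF _ Ct] Cm_diff Cm_const Cm_ident) auto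
  have \<Psi>0: "\<Psi> n y = 0" if "N n * y \<le> 1" for n y
  proof -
    have "N n * (a - y) \<ge> 2" using that N(2)[of n] by (simp add: right_diff_distrib)
    then show ?thesis using that by (simp add: \<Psi>_def t0 t1)
  qed
  have \<Psi>a: "\<Psi> n y = \<Psi> n a" if "N n * (a - y) \<le> 1" for n y
    using that by (simp add: \<Psi>_def t0)
  \<comment> \<open>A function of \<open>s = x \<bullet> x\<close>, as
    \<open>test_function_radial\<close> requires, continued by constants beyond both ends.\<close>
  define \<Phi> where "\<Phi> = (\<lambda>n s. if s \<le> 0 then \<Psi> n a else if s \<ge> 1 then 0 else \<Psi> n (w (sqrt s)))"
  have ends: "\<exists>\<delta>. 0 < \<delta> \<and> \<delta> < 1/2 \<and> (\<forall>s<\<delta>. \<Phi> n s = \<Psi> n a) \<and> (\<forall>s>1-\<delta>. \<Phi> n s = 0)" for n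
  proof -
    define e where "e = 1 / N n"
    have e: "e > 0" using N(1)[of n] by (simp add: e_def)
    have "\<exists>d>0. \<forall>r\<in>{0..1}. dist r 0 < d \<longrightarrow> dist (w r) (w 0) < e"
      using w_cont e unfolding continuous_on_iff by (meson atLeastAtMost_iff order_refl zero_le_one)
    then obtain d1 where d1: "d1 > 0" "\<And>r. 0 \<le> r \<Longrightarrow> r \<le> 1 \<Longrightarrow> r < d1 \<Longrightarrow> \<bar>w r - a\<bar> < e"
      by (auto simp: dist_real_def a_def)
    have "\<exists>d>0. \<forall>r\<in>{0..1}. dist r 1 < d \<longrightarrow> dist (w r) (w 1) < e"
      using w_cont e unfolding continuous_on_iff by (meson atLeastAtMost_iff order_refl zero_le_one)
    then obtain d2 where d2: "d2 > 0" "\<And>r. 0 \<le> r \<Longrightarrow> r \<le> 1 \<Longrightarrow> 1 - d2 < r \<Longrightarrow> \<bar>w r\<bar> < e"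
      by (auto simp: dist_real_def w_1)
    \<comment> \<open>\<open>d1\<close> is squared because \<open>s\<close> is the square of the
      radius; near 1 the inequality \<open>s \<le> sqrt s\<close> suffices. The entry
      \<open>1/4\<close> keeps the two end intervals apart.\<close>
    define \<delta> where "\<delta> = Min {d1\<^sup>2, d2, 1/4}"
    have \<delta>: "0 < \<delta>" "\<delta> < 1/2" "\<delta> \<le> d1\<^sup>2" "\<delta> \<le> d2" using d1 d2 by (auto simp: \<delta>_def)
    have "\<Phi> n s = \<Psi> n a" if s: "s < \<delta>" for s
    proof (cases "s \<le> 0")
      case False
      then have "sqrt s < sqrt (d1\<^sup>2)" using s \<delta> by (intro real_sqrt_less_mono) auto
      then have "sqrt s < d1" using d1 by simp
      moreover have "sqrt s \<le> 1" using s \<delta> by simp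
      ultimately have "\<bar>w (sqrt s) - a\<bar> < e" using d1(2)[of "sqrt s"] False by simp
      then have "a - w (sqrt s) \<le> 1 / N n" by (simp add: e_def)
      then have "N n * (a - w (sqrt s)) \<le> N n * (1 / N n)" using N(1)[of n] by (intro mult_left_mono) auto
      then have "N n * (a - w (sqrt s)) \<le> 1" using N(1)[of n] by simp
      then have "\<Psi> n (w (sqrt s)) = \<Psi> n a" by (rule \<Psi>a)
      then show ?thesis using False s \<delta> by (simp add: \<Phi>_def)
    qed (simp add: \<Phi>_def)
    moreover have "\<Phi> n s = 0" if s: "s > 1 - \<delta>" for s
    proof (cases "s \<ge> 1")
      case True then show ?thesis by (simp add: \<Phi>_def)
    next
      case False
      have s0: "s > 0" using s \<delta> by simp
      have "s \<le> sqrt s" using False s0 by (intro real_le_rsqrt) (simp add: power2_eq_square mult_left_le)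
      then have "\<bar>w (sqrt s)\<bar> < e" using d2(2)[of "sqrt s"] False s s0 \<delta> by simp
      then have "w (sqrt s) \<le> 1 / N n" by (simp add: e_def)
      then have "N n * w (sqrt s) \<le> N n * (1 / N n)" using N(1)[of n] by (intro mult_left_mono) auto
      then have "N n * w (sqrt s) \<le> 1" using N(1)[of n] by simp
      then have "\<Psi> n (w (sqrt s)) = 0" by (rule \<Psi>0)
      then show ?thesis using s0 False by (simp add: \<Phi>_def)
    qed
    ultimately show ?thesis using \<delta> by blast
  qed
  have C\<Phi>: "Cm m UNIV (\<Phi> n)" for m n
  proof -
    obtain \<delta> where \<delta>: "0 < \<delta>" "\<delta> < 1/2" "\<And>s. s < \<delta> \<Longrightarrow> \<Phi> n s = \<Psi> n a" "\<And>s. s > 1 - \<delta> \<Longrightarrow> \<Phi> n s = 0"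
      using ends[of n] by blast
    have 1: "Cm m {..<\<delta>} (\<Phi> n)" by (rule Cm_cong[OF _ _ Cm_const[of _ _ "\<Psi> n a"]]) (use \<delta> in auto)
    have 2: "Cm m {1-\<delta><..} (\<Phi> n)" by (rule Cm_cong[OF _ _ Cm_const[of _ _ 0]]) (use \<delta> in auto)
    have "Cm m {0<..<1} (\<lambda>s. s powr (1/2))" by (rule Cm_subset[OF Cm_powr]) auto
    then have sq: "Cm m {0<..<1} sqrt" by (rule Cm_cong[rotated 2]) (auto simp: powr_half_sqrt)
    have "Cm m {0<..<1} (\<lambda>s. \<Psi> n (w (sqrt s)))"
      by (intro Cm_compose[OF _ C\<Psi>] Cm_compose[OF _ w_smooth] sq) auto
    then have 3: "Cm m {0<..<1} (\<Phi> n)" by (rule Cm_cong[rotated 2]) (auto simp: \<Phi>_def)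
    have "Cm m (({..<\<delta>} \<union> {0<..<1}) \<union> {1-\<delta><..}) (\<Phi> n)"
      by (intro Cm_Un 1 2 3) auto
    moreover have "({..<\<delta>} \<union> {0<..<1}) \<union> {1-\<delta><..} = UNIV" using \<delta> by auto
    ultimately show ?thesis by simp
  qed
  define \<phi> where "\<phi> = (\<lambda>n (x::plane). \<Phi> n (x \<bullet> x))"
  have tf: "test_function B1 (\<phi> n)" for n
  proof -
    obtain \<delta> where "0 < \<delta>" "\<delta> < 1/2" "\<And>s. s > 1 - \<delta> \<Longrightarrow> \<Phi> n s = 0" using ends[of n] by blast
    then show ?thesis unfolding \<phi>_def by (intro test_function_radial[OF C\<Phi>, of \<delta>]) auto
  qed
  have \<phi>_eq: "\<phi> n x = \<Psi> n (w (norm x))" if "x \<in> B1 - {0}" for n x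
  proof -
    have "x \<bullet> x > 0" "x \<bullet> x < 1" using that by (auto simp: dot_square_norm power_less_one_iff)
    then have "\<not> x \<bullet> x \<le> 0" "\<not> x \<bullet> x \<ge> 1" by linarith+
    then show ?thesis by (simp only: \<phi>_def \<Phi>_def norm_eq_sqrt_inner if_False)
  qed
  define \<Psi>' where "\<Psi>' = (\<lambda>n y. deriv \<theta> (N n * (a - t n (a - y))) * deriv \<theta> (N n * (a - y)))"
  have gr: "grad (\<phi> n) x = \<Psi>' n (w (norm x)) *\<^sub>R g x" if x: "x \<in> B1 - {0}" for n x
  proof (rule grad_eq)
    have nx: "0 < norm x" "norm x < 1" using x by auto
    have "((\<lambda>x. \<Psi> n (w (norm x))) has_derivative (\<lambda>v. \<Psi>' n (w (norm x)) * ((- h (norm x) / norm x) * (v \<bullet> sgn x)))) (at x)"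
    proof -
      have x0: "x \<noteq> 0" using x by auto
      have 1: "((\<lambda>x. w (norm x)) has_derivative (\<lambda>v. (- h (norm x) / norm x) * (v \<bullet> sgn x))) (at x)"
        by (rule has_derivative_compose[OF has_derivative_norm[OF x0] w_deriv[OF nx, unfolded has_field_derivative_def]])
      have 2: "(\<Psi> n has_real_derivative \<Psi>' n (w (norm x))) (at (w (norm x)))"
        unfolding \<Psi>'_def by (rule \<Psi>d)
      show ?thesis by (rule has_derivative_compose[OF 1 2[unfolded has_field_derivative_def]])
    qed
    moreover have "(\<lambda>v. \<Psi>' n (w (norm x)) * ((- h (norm x) / norm x) * (v \<bullet> sgn x))) =
        (\<lambda>v. (\<Psi>' n (w (norm x)) *\<^sub>R g x) \<bullet> v)"
      by (auto simp: g_def sgn_div_norm power2_eq_square inner_commute divide_inverse)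
    ultimately have "((\<lambda>x. \<Psi> n (w (norm x))) has_derivative (\<lambda>v. (\<Psi>' n (w (norm x)) *\<^sub>R g x) \<bullet> v)) (at x)" by simp
    then show "(\<phi> n has_derivative (\<lambda>v. (\<Psi>' n (w (norm x)) *\<^sub>R g x) \<bullet> v)) (at x)"
      by (rule has_derivative_transform_within_open[of _ _ _ _ "B1 - {0}"]) (use x \<phi>_eq in auto)
  qed
  have \<Psi>'K: "\<bar>\<Psi>' n y\<bar> \<le> K * K" for n y
    unfolding \<Psi>'_def abs_mult using \<theta>(5) K by (intro mult_mono) auto
  \<comment> \<open>At a fixed value strictly inside the range both truncations are eventually
    inactive, so the sequences below are eventually constant.\<close>
  have ev: "\<forall>\<^sub>F n in sequentially. \<Psi> n y = y \<and> \<Psi>' n y = 1" if y: "0 < y" "y < a" for y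
  proof -
    obtain n0 :: nat where n0: "2 / y + 2 / (a - y) < real n0" using reals_Archimedean2 by blast
    have "\<Psi> n y = y \<and> \<Psi>' n y = 1" if n: "n \<ge> n0" for n
    proof -
      have "N n > 2 / y + 2 / (a - y)" using n0 n by (simp add: N_def)
      moreover have "2 / y > 0" "2 / (a - y) > 0" using y by auto
      ultimately have "2 / y < N n" "2 / (a - y) < N n" by linarith+
      then have Ny: "N n * y > 2" "N n * (a - y) > 2" using y by (auto simp: pos_divide_less_eq)
      have dth: "deriv \<theta> z = 1" if "z > 2" for z
      proof -
        have "(\<theta> has_real_derivative 1) (at z)"
          by (rule has_field_derivative_transform_within_open[of "\<lambda>x. x" _ _ "{2<..}"]) (use that \<theta>(3) in auto)
        then show ?thesis by (simp add: DERIV_imp_deriv)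
      qed
      have "t n (a - y) = a - y" using t1 Ny by simp
      then show ?thesis using Ny by (simp add: \<Psi>_def \<Psi>'_def t1 dth)
    qed
    then show ?thesis by (auto simp: eventually_sequentially)
  qed
  show ?thesis
  proof (intro exI[of _ \<phi>] exI[of _ "K * K"] conjI allI impI ballI)
    fix n show "test_function B1 (\<phi> n)" by (rule tf)
  next
    fix n x assume x: "x \<in> B1 - {0}"
    then have wx: "0 < w (norm x)" "w (norm x) < a" using w_pos[of "norm x"] w_le[of "norm x"] by (auto simp: a_def)
    have "\<bar>\<phi> n x\<bar> \<le> \<bar>a - t n (a - w (norm x))\<bar>" using \<phi>_eq[OF x] t_le by (simp add: \<Psi>_def)
    also have "\<dots> \<le> a + \<bar>a - w (norm x)\<bar>" using t_le[of n "a - w (norm x)"] a by linarith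
    also have "\<dots> \<le> 2 * a" using wx by simp
    finally show "\<bar>\<phi> n x\<bar> \<le> 2 * w 0" by (simp add: a_def)
    show "norm (grad (\<phi> n) x) \<le> K * K * norm (g x)"
      using \<Psi>'K[of n "w (norm x)"] by (simp add: gr[OF x] mult_right_mono)
  next
    fix x assume x: "x \<in> B1 - {0}"
    then have wx: "0 < w (norm x)" "w (norm x) < a" using w_pos[of "norm x"] w_le[of "norm x"] by (auto simp: a_def)
    have ux: "u x = w (norm x)" using u_eq x by auto
    show "(\<lambda>n. \<phi> n x) \<longlonglongrightarrow> u x"
      by (rule tendsto_eventually) (use ev[OF wx] in eventually_elim, simp add: \<phi>_eq[OF x] ux)
    show "(\<lambda>n. grad (\<phi> n) x) \<longlonglongrightarrow> g x"
      by (rule tendsto_eventually) (use ev[OF wx] in eventually_elim, simp add: gr[OF x])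
  qed
qed

text \<open>The weak gradient identity and the convergence in \<open>H^1\<close> both pass from the
  approximations to \<open>u\<close> by dominated convergence, with a constant and a multiple of
  \<open>norm (g x)\<close> as majorants of the functions and their gradients.\<close>

lemma H10_g: "H10_grad B1 u g"
proof -
  obtain \<phi> B where \<phi>: "\<And>n. test_function B1 (\<phi> n)"
    and bd: "\<And>n x. x \<in> B1 - {0} \<Longrightarrow> \<bar>\<phi> n x\<bar> \<le> 2 * w 0" "\<And>n x. x \<in> B1 - {0} \<Longrightarrow> norm (grad (\<phi> n) x) \<le> B * norm (g x)"
    and lim: "\<And>x. x \<in> B1 - {0} \<Longrightarrow> (\<lambda>n. \<phi> n x) \<longlonglongrightarrow> u x" "\<And>x. x \<in> B1 - {0} \<Longrightarrow> (\<lambda>n. grad (\<phi> n) x) \<longlonglongrightarrow> g x"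
    using approximation_exists by blast
  note C\<phi> = test_function_C1c[OF \<phi>]
  have w0: "w 0 > 0" using w_pos[of 0] by simp
  have AE: "AE x in D. x \<in> B1 - {0}" using AE_D by eventually_elim auto
  have g1: "integrable D (\<lambda>x. norm (g x))"
  proof (rule Bochner_Integration.integrable_bound)
    show "integrable D (\<lambda>x. 1 + (norm (g x))\<^sup>2)" using g_square_integrable by simp
    show "AE x in D. norm (norm (g x)) \<le> norm (1 + (norm (g x))\<^sup>2)"
    proof (rule AE_I2)
      fix x
      have "0 \<le> (norm (g x) - 1/2)\<^sup>2" by simp
      then show "norm (norm (g x)) \<le> norm (1 + (norm (g x))\<^sup>2)" by (simp add: power2_eq_square algebra_simps)
    qed
  qed (intro measurable_compose[OF _ borel_measurable_norm] g_measurable)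
  have weak: "(LINT x|D. u x * (grad \<eta> x \<bullet> b)) = - (LINT x|D. (g x \<bullet> b) * \<eta> x)"
    if \<eta>: "test_function B1 \<eta>" and b: "b \<in> Basis" for \<eta> b
  proof -
    note C\<eta> = test_function_C1c[OF \<eta>]
    obtain M where M: "M > 0" "\<And>x. \<bar>\<eta> x\<bar> \<le> M" "\<And>x. norm (grad \<eta> x) \<le> M" using C1c_bounded[OF C\<eta>] by metis
    have bM: "\<bar>grad \<eta> x \<bullet> b\<bar> \<le> M" for x using Basis_le_norm[OF b, of "grad \<eta> x"] M(3)[of x] by linarith
    note m = C1c_measurable[OF C\<eta>] C1c_measurable[OF C\<phi>]
    have m1: "(\<lambda>x. \<phi> n x * (grad \<eta> x \<bullet> b)) \<in> borel_measurable D" "(\<lambda>x. (grad (\<phi> n) x \<bullet> b) * \<eta> x) \<in> borel_measurable D" for n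
      by (intro borel_measurable_times borel_measurable_inner borel_measurable_const m)+
    have i1: "integrable D (\<lambda>x. \<phi> n x * (grad \<eta> x \<bullet> b))" for n
    proof (rule integrable_D_bounded[OF m1(1)])
      show "AE x in D. \<bar>\<phi> n x * (grad \<eta> x \<bullet> b)\<bar> \<le> 2 * w 0 * M"
        using AE unfolding abs_mult by eventually_elim (use bd bM w0 in \<open>auto intro!: mult_mono\<close>)
    qed
    have gb: "\<bar>grad (\<phi> n) x \<bullet> b\<bar> * \<bar>\<eta> x\<bar> \<le> B * norm (g x) * M" if "x \<in> B1 - {0}" for n x
      using Basis_le_norm[OF b, of "grad (\<phi> n) x"] bd(2)[OF that, of n] M(2)[of x]
      by (intro mult_mono) (auto intro: order_trans[OF norm_ge_zero])
    have i2: "integrable D (\<lambda>x. (grad (\<phi> n) x \<bullet> b) * \<eta> x)" for n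
    proof (rule Bochner_Integration.integrable_bound[OF _ m1(2)])
      show "integrable D (\<lambda>x. B * norm (g x) * M)" using g1 by simp
      show "AE x in D. norm ((grad (\<phi> n) x \<bullet> b) * \<eta> x) \<le> norm (B * norm (g x) * M)"
        using AE unfolding real_norm_def
        by eventually_elim (rule order_trans[OF eq_refl[OF abs_mult] order_trans[OF gb abs_ge_self]])
    qed
    have parts: "(LINT x|D. \<phi> n x * (grad \<eta> x \<bullet> b)) = - (LINT x|D. (grad (\<phi> n) x \<bullet> b) * \<eta> x)" for n
    proof -
      obtain K where K: "compact K" "K \<subseteq> B1" "\<And>x. x \<notin> K \<Longrightarrow> \<eta> x = 0" "\<And>x. x \<notin> K \<Longrightarrow> grad \<eta> x = 0"
        using C1c_support[OF C\<eta>] by metis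
      have "has_bochner_integral lborel (\<lambda>x. \<phi> n x * (grad \<eta> x \<bullet> b) + (grad (\<phi> n) x \<bullet> b) * \<eta> x) 0"
      proof (rule integral_partial_derivative_compact_support[where \<psi>="\<lambda>x. \<phi> n x * \<eta> x" and K=K and b=b
            and \<psi>'="\<lambda>x v. \<phi> n x * (grad \<eta> x \<bullet> v) + (grad (\<phi> n) x \<bullet> v) * \<eta> x"])
        fix x show "((\<lambda>x. \<phi> n x * \<eta> x) has_derivative (\<lambda>v. \<phi> n x * (grad \<eta> x \<bullet> v) + (grad (\<phi> n) x \<bullet> v) * \<eta> x)) (at x)"
          using C\<eta> C\<phi>[of n] by (intro has_derivative_mult) (auto simp: C1c_def)
        show "continuous_on UNIV (\<lambda>x. \<phi> n x * (grad \<eta> x \<bullet> b) + (grad (\<phi> n) x \<bullet> b) * \<eta> x)"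
          by (intro continuous_intros C1c_continuous[OF C\<eta>] C1c_continuous[OF C\<phi>])
      qed (use K in auto)
      then have "has_bochner_integral D (\<lambda>x. \<phi> n x * (grad \<eta> x \<bullet> b) + (grad (\<phi> n) x \<bullet> b) * \<eta> x) 0"
      proof (rule has_bochner_integral_D)
        fix x assume "x \<notin> B1"
        then have "x \<notin> K" using K(2) by blast
        then show "\<phi> n x * (grad \<eta> x \<bullet> b) + (grad (\<phi> n) x \<bullet> b) * \<eta> x = 0" using K by simp
      qed simp
      then have "(LINT x|D. \<phi> n x * (grad \<eta> x \<bullet> b) + (grad (\<phi> n) x \<bullet> b) * \<eta> x) = 0"
        by (rule has_bochner_integral_integral_eq)
      then show ?thesis using i1 i2 by simp
    qed
    have "(\<lambda>n. LINT x|D. \<phi> n x * (grad \<eta> x \<bullet> b)) \<longlonglongrightarrow> (LINT x|D. u x * (grad \<eta> x \<bullet> b))"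
    proof (rule integral_dominated_convergence[where w="\<lambda>_. 2 * w 0 * M"])
      show "AE x in D. (\<lambda>n. \<phi> n x * (grad \<eta> x \<bullet> b)) \<longlonglongrightarrow> u x * (grad \<eta> x \<bullet> b)"
        using AE by eventually_elim (intro tendsto_intros lim)
      show "AE x in D. norm (\<phi> n x * (grad \<eta> x \<bullet> b)) \<le> 2 * w 0 * M" for n
        using AE unfolding real_norm_def abs_mult by eventually_elim (use bd bM w0 in \<open>auto intro!: mult_mono\<close>)
      show "(\<lambda>x. u x * (grad \<eta> x \<bullet> b)) \<in> borel_measurable D"
        by (intro borel_measurable_times borel_measurable_inner borel_measurable_const m u_measurable)
    qed (use m1 in auto)
    moreover have "(\<lambda>n. LINT x|D. (grad (\<phi> n) x \<bullet> b) * \<eta> x) \<longlonglongrightarrow> (LINT x|D. (g x \<bullet> b) * \<eta> x)"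
    proof (rule integral_dominated_convergence[where w="\<lambda>x. B * norm (g x) * M"])
      show "AE x in D. (\<lambda>n. (grad (\<phi> n) x \<bullet> b) * \<eta> x) \<longlonglongrightarrow> (g x \<bullet> b) * \<eta> x"
        using AE by eventually_elim (intro tendsto_intros lim)
      show "AE x in D. norm ((grad (\<phi> n) x \<bullet> b) * \<eta> x) \<le> B * norm (g x) * M" for n
        using AE by eventually_elim (use gb in \<open>auto simp: abs_mult\<close>)
      show "(\<lambda>x. (g x \<bullet> b) * \<eta> x) \<in> borel_measurable D"
        by (intro borel_measurable_times borel_measurable_inner borel_measurable_const m g_measurable)
    qed (use m1 g1 in auto)
    ultimately show ?thesis
      unfolding parts using tendsto_minus LIMSEQ_unique by blast
  qed
  have "(\<lambda>n. LINT x|D. (u x - \<phi> n x)\<^sup>2 + (norm (g x - grad (\<phi> n) x))\<^sup>2) \<longlonglongrightarrow> (LINT x|D. 0)"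
  proof (rule integral_dominated_convergence[where w="\<lambda>x. (3 * w 0)\<^sup>2 + ((1 + B) * norm (g x))\<^sup>2"])
    show "AE x in D. (\<lambda>n. (u x - \<phi> n x)\<^sup>2 + (norm (g x - grad (\<phi> n) x))\<^sup>2) \<longlonglongrightarrow> 0"
      using AE
    proof eventually_elim
      case (elim x)
      have "(\<lambda>n. (u x - \<phi> n x)\<^sup>2 + (norm (g x - grad (\<phi> n) x))\<^sup>2) \<longlonglongrightarrow> (u x - u x)\<^sup>2 + (norm (g x - g x))\<^sup>2"
        by (intro tendsto_intros lim elim)
      then show ?case by simp
    qed
    show "integrable D (\<lambda>x. (3 * w 0)\<^sup>2 + ((1 + B) * norm (g x))\<^sup>2)"
      using g_square_integrable by (simp add: power_mult_distrib)
    show "AE x in D. norm ((u x - \<phi> n x)\<^sup>2 + (norm (g x - grad (\<phi> n) x))\<^sup>2) \<le> (3 * w 0)\<^sup>2 + ((1 + B) * norm (g x))\<^sup>2" for n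
      using AE
    proof eventually_elim
      case (elim x)
      have "\<bar>u x - \<phi> n x\<bar> \<le> \<bar>3 * w 0\<bar>" using bd(1)[OF elim, of n] u_lt[OF elim] w0 by linarith
      then have 1: "(u x - \<phi> n x)\<^sup>2 \<le> (3 * w 0)\<^sup>2" by (simp only: abs_le_square_iff)
      have "norm (g x - grad (\<phi> n) x) \<le> norm (g x) + B * norm (g x)"
        using norm_triangle_ineq4[of "g x" "grad (\<phi> n) x"] bd(2)[OF elim, of n] by linarith
      then have 2: "(norm (g x - grad (\<phi> n) x))\<^sup>2 \<le> ((1 + B) * norm (g x))\<^sup>2"
        by (intro power_mono) (auto simp: distrib_right)
      show ?case using 1 2 by simp
    qed
    show "(\<lambda>x. (u x - \<phi> n x)\<^sup>2 + (norm (g x - grad (\<phi> n) x))\<^sup>2) \<in> borel_measurable D" for n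
      by (intro borel_measurable_add borel_measurable_power measurable_compose[OF _ borel_measurable_norm] borel_measurable_diff
          u_measurable g_measurable C1c_measurable[OF C\<phi>])
  qed auto
  then have "(\<lambda>n. LINT x|D. (u x - \<phi> n x)\<^sup>2 + (norm (g x - grad (\<phi> n) x))\<^sup>2) \<longlonglongrightarrow> 0" by simp
  then show ?thesis
    unfolding H10_grad_def H1_grad_def using L2_u L2_g weak \<phi> by blast
qed

text \<open>This is the divergence identity for the field of \<open>h\<close>, which is
  \<open>- g\<close> and whose divergence is the right-hand side of the equation.\<close>

lemma weak_test:
  assumes "C1c \<phi> G"
  shows "(LINT x|D. g x \<bullet> G x) = l * (LINT x|D. Vk k (norm x) * nonlin p (u x) * \<phi> x)"
proof -
  \<comment> \<open>One constant has to serve both hypotheses of \<open>divergence\<close>: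
    \<open>l * F\<close> bounds the source, and \<open>1 + C\<close> bounds \<open>h / r\<close>
    through \<open>y \<le> 1 + y^2\<close>.\<close>
  have C1: "r * (l * Vk k r * nonlin p (w r)) / r \<le> (1 + C + l * F) * Vk k r" if "0 < r" "r < 1" for r
  proof -
    have "l * Vk k r * nonlin p (w r) \<le> l * Vk k r * F"
      using nonlin_bounds[OF that] l Vk_nonneg by (intro mult_left_mono) auto
    also have "\<dots> = (l * F) * Vk k r" by simp
    also have "\<dots> \<le> (1 + C + l * F) * Vk k r"
      using C Vk_nonneg by (intro mult_right_mono) auto
    finally show ?thesis using that by simp
  qed
  have C2: "h r / r \<le> (1 + C + l * F) * (1 + Vk k r)" if "0 < r" "r < 1" for r
  proof -
    have "h r / r \<le> 1 + (h r / r)\<^sup>2"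
      using zero_le_power2[of "h r / r - 1/2"] by (simp add: power2_eq_square algebra_simps)
    also have "\<dots> \<le> 1 + C * Vk k r" using h_bound[OF that] by simp
    also have "\<dots> \<le> (1 + C) * (1 + Vk k r)" using C Vk_nonneg[of k r] by (simp add: algebra_simps)
    also have "\<dots> \<le> (1 + C + l * F) * (1 + Vk k r)"
      using l Vk_nonneg[of k r] by (intro mult_right_mono) (auto simp: nonlin_def)
    finally show ?thesis .
  qed
  note dv = fld.divergence[OF k assms C1 C2]
  have AE: "AE x in D. x \<in> B1 - {0}" using AE_D by eventually_elim auto
  have e1: "g x \<bullet> G x = - (h (norm x) / (norm x)\<^sup>2 * (x \<bullet> G x))" for x by (simp add: g_def)
  have "(LINT x|D. g x \<bullet> G x) = (LINT x|D. norm x * (l * Vk k (norm x) * nonlin p (w (norm x))) / norm x * \<phi> x)"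
    unfolding e1 using dv(3) by simp
  also have "\<dots> = (LINT x|D. l * (Vk k (norm x) * nonlin p (u x) * \<phi> x))"
  proof (rule Bochner_Integration.integral_cong)
    fix x assume "x \<in> space D"
    then have "u x = w (norm x)" using u_eq by simp
    then show "norm x * (l * Vk k (norm x) * nonlin p (w (norm x))) / norm x * \<phi> x = l * (Vk k (norm x) * nonlin p (u x) * \<phi> x)"
      by (cases "norm x = 0") (auto simp: Vk_def)
  qed simp
  finally show ?thesis by simp
qed

text \<open>The left side of the equation passes to the limit by \<open>L^2\<close> convergence of
  the gradients. On the right the factor \<open>nonlin p (u x)\<close> is bounded by
  \<open>F\<close>, so convergence in the weighted \<open>L^1\<close> norm is enough.\<close>

lemma weak_sol: "weak_solution k p l u"
  unfolding weak_solution_def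
proof (intro exI[of _ g] conjI allI impI)
  show "H10_grad B1 u g" by (rule H10_g)
  fix \<phi> :: "plane \<Rightarrow> real" and hh :: "plane \<Rightarrow> plane"
  assume H: "H10_grad B1 \<phi> hh"
  then have L2: "L2_on B1 \<phi>" "L2_on B1 hh" by (auto simp: H10_grad_def H1_grad_def)
  obtain \<psi> where \<psi>: "\<And>n. test_function B1 (\<psi> n)"
    and l1: "(\<lambda>n. integral\<^sup>L D (\<lambda>x. (norm (hh x - grad (\<psi> n) x))\<^sup>2)) \<longlonglongrightarrow> 0"
    and i1: "\<And>n. integrable D (\<lambda>x. (norm (hh x - grad (\<psi> n) x))\<^sup>2)"
    and i2: "integrable D (\<lambda>x. Vk k (norm x) * \<bar>\<phi> x\<bar>)"
    and l2: "(\<lambda>n. integral\<^sup>L D (\<lambda>x. Vk k (norm x) * \<bar>\<psi> n x - \<phi> x\<bar>)) \<longlonglongrightarrow> 0"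
    by (rule H10_limit[OF k H]) (rule that)
  note C\<psi> = test_function_C1c[OF \<psi>]
  have AE: "AE x in D. x \<in> B1 - {0}" using AE_D by eventually_elim auto
  have F0: "F \<ge> 0" by (simp add: nonlin_def)
  have nl: "0 \<le> nonlin p (u x)" "nonlin p (u x) \<le> F" if "x \<in> B1 - {0}" for x
    using nonlin_bounds[of "norm x"] u_eq[of x] that by auto
  have mn: "(\<lambda>x. nonlin p (u x)) \<in> borel_measurable D"
    unfolding nonlin_def using u_measurable by simp
  have m\<phi>: "\<phi> \<in> borel_measurable D" "hh \<in> borel_measurable D" using L2 by (auto simp: L2_on_def)
  have int: "integrable D (\<lambda>x. Vk k (norm x) * nonlin p (u x) * f x)"
    if f: "f \<in> borel_measurable D" "integrable D (\<lambda>x. Vk k (norm x) * \<bar>f x\<bar>)" for f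
  proof (rule Bochner_Integration.integrable_bound)
    show "integrable D (\<lambda>x. F * (Vk k (norm x) * \<bar>f x\<bar>))" using f(2) by simp
    show "AE x in D. norm (Vk k (norm x) * nonlin p (u x) * f x) \<le> norm (F * (Vk k (norm x) * \<bar>f x\<bar>))"
      using AE
    proof eventually_elim
      case (elim x)
      have "nonlin p (u x) * (Vk k (norm x) * \<bar>f x\<bar>) \<le> F * (Vk k (norm x) * \<bar>f x\<bar>)"
        using nl[OF elim] Vk_nonneg[of k "norm x"] by (intro mult_right_mono) auto
      then show ?case using nl[OF elim] Vk_nonneg[of k "norm x"] F0 by (simp add: abs_mult mult_ac)
    qed
  qed (intro borel_measurable_times measurable_Vk mn f)
  show I: "integrable D (\<lambda>x. Vk k (norm x) * nonlin p (u x) * \<phi> x)" by (rule int[OF m\<phi>(1) i2])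
  have iV\<psi>: "integrable D (\<lambda>x. Vk k (norm x) * \<bar>\<psi> n x\<bar>)" for n
    by (rule C1c_Vk_integrable[OF C\<psi> k])
  have iV\<psi>\<phi>: "integrable D (\<lambda>x. Vk k (norm x) * \<bar>\<psi> n x - \<phi> x\<bar>)" for n
  proof (rule Bochner_Integration.integrable_bound)
    show "integrable D (\<lambda>x. Vk k (norm x) * \<bar>\<psi> n x\<bar> + Vk k (norm x) * \<bar>\<phi> x\<bar>)" using iV\<psi> i2 by simp
    show "AE x in D. norm (Vk k (norm x) * \<bar>\<psi> n x - \<phi> x\<bar>) \<le> norm (Vk k (norm x) * \<bar>\<psi> n x\<bar> + Vk k (norm x) * \<bar>\<phi> x\<bar>)"
    proof (rule AE_I2)
      fix x
      have "Vk k (norm x) * \<bar>\<psi> n x - \<phi> x\<bar> \<le> Vk k (norm x) * (\<bar>\<psi> n x\<bar> + \<bar>\<phi> x\<bar>)"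
        by (intro mult_left_mono Vk_nonneg) linarith
      then show "norm (Vk k (norm x) * \<bar>\<psi> n x - \<phi> x\<bar>) \<le> norm (Vk k (norm x) * \<bar>\<psi> n x\<bar> + Vk k (norm x) * \<bar>\<phi> x\<bar>)"
        using Vk_nonneg[of k "norm x"] by (simp add: distrib_left)
    qed
  qed (intro borel_measurable_times borel_measurable_abs borel_measurable_diff measurable_Vk m\<phi> C1c_measurable[OF C\<psi>])
  have r: "(\<lambda>n. LINT x|D. Vk k (norm x) * nonlin p (u x) * \<psi> n x) \<longlonglongrightarrow> (LINT x|D. Vk k (norm x) * nonlin p (u x) * \<phi> x)"
  proof (rule Lim_null[THEN iffD2], rule tendsto_0_le[OF l2, where K=F], rule always_eventually, rule allI)
    fix n
    have m: "(\<lambda>x. \<psi> n x - \<phi> x) \<in> borel_measurable D"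
      by (intro borel_measurable_diff m\<phi> C1c_measurable[OF C\<psi>])
    have "(LINT x|D. Vk k (norm x) * nonlin p (u x) * \<psi> n x) - (LINT x|D. Vk k (norm x) * nonlin p (u x) * \<phi> x)
       = (LINT x|D. Vk k (norm x) * nonlin p (u x) * (\<psi> n x - \<phi> x))"
      using int[OF C1c_measurable(1)[OF C\<psi>] iV\<psi>] I by (simp add: right_diff_distrib)
    also have "norm \<dots> \<le> (LINT x|D. norm (Vk k (norm x) * nonlin p (u x) * (\<psi> n x - \<phi> x)))"
      by (rule integral_norm_bound)
    also have "\<dots> \<le> (LINT x|D. F * (Vk k (norm x) * \<bar>\<psi> n x - \<phi> x\<bar>))"
    proof (rule integral_mono_AE)
      show "integrable D (\<lambda>x. norm (Vk k (norm x) * nonlin p (u x) * (\<psi> n x - \<phi> x)))"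
        by (rule integrable_norm[OF int[OF m iV\<psi>\<phi>]])
      show "AE x in D. norm (Vk k (norm x) * nonlin p (u x) * (\<psi> n x - \<phi> x)) \<le> F * (Vk k (norm x) * \<bar>\<psi> n x - \<phi> x\<bar>)"
        using AE
      proof eventually_elim
        case (elim x)
        have "nonlin p (u x) * (Vk k (norm x) * \<bar>\<psi> n x - \<phi> x\<bar>) \<le> F * (Vk k (norm x) * \<bar>\<psi> n x - \<phi> x\<bar>)"
          using nl[OF elim] Vk_nonneg[of k "norm x"] by (intro mult_right_mono) auto
        then show ?case using nl[OF elim] Vk_nonneg[of k "norm x"] by (simp add: abs_mult mult_ac)
      qed
    qed (use iV\<psi>\<phi> in simp)
    also have "\<dots> \<le> norm (LINT x|D. Vk k (norm x) * \<bar>\<psi> n x - \<phi> x\<bar>) * F"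
    proof -
      have "F * i \<le> \<bar>i\<bar> * F" for i using F0 mult_right_mono[OF abs_ge_self F0, of i] by (simp add: mult.commute)
      then show ?thesis by simp
    qed
    finally show "norm ((LINT x|D. Vk k (norm x) * nonlin p (u x) * \<psi> n x) - (LINT x|D. Vk k (norm x) * nonlin p (u x) * \<phi> x))
      \<le> norm (LINT x|D. Vk k (norm x) * \<bar>\<psi> n x - \<phi> x\<bar>) * F" .
  qed
  have hh2: "integrable D (\<lambda>x. (norm (hh x))\<^sup>2)" using L2 by (simp add: L2_on_def)
  have gh: "integrable D (\<lambda>x. g x \<bullet> hh x)"
    by (rule integrable_inner_D(1)[OF g_measurable m\<phi>(2) g_square_integrable hh2, of 1]) simp
  have g\<psi>: "integrable D (\<lambda>x. g x \<bullet> grad (\<psi> n) x)" for n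
    by (rule integrable_inner_D(1)[OF g_measurable C1c_measurable(2)[OF C\<psi>] g_square_integrable C1c_square_integrable(2)[OF C\<psi>], of 1]) simp
  have lft: "(\<lambda>n. LINT x|D. g x \<bullet> grad (\<psi> n) x) \<longlonglongrightarrow> (LINT x|D. g x \<bullet> hh x)"
  proof (rule LIMSEQ_I)
    fix \<epsilon> :: real assume \<epsilon>: "\<epsilon> > 0"
    define A where "A = (LINT x|D. (norm (g x))\<^sup>2)"
    have A: "A \<ge> 0" by (simp add: A_def)
    \<comment> \<open>Balances the two terms of Young's inequality, each being at most
      \<open>\<epsilon> / 2\<close>.\<close>
    define c where "c = \<epsilon> / (A + 1)"
    have c: "c > 0" using \<epsilon> A by (simp add: c_def add_nonneg_pos)
    have "0 < c * \<epsilon>" using c \<epsilon> by simp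
    from order_tendstoD(2)[OF l1 this] obtain n0 where n0:
      "\<And>n. n \<ge> n0 \<Longrightarrow> integral\<^sup>L D (\<lambda>x. (norm (hh x - grad (\<psi> n) x))\<^sup>2) < c * \<epsilon>"
      by (auto simp: eventually_sequentially)
    have "norm ((LINT x|D. g x \<bullet> grad (\<psi> n) x) - (LINT x|D. g x \<bullet> hh x)) < \<epsilon>" if n: "n \<ge> n0" for n
    proof -
      have m: "(\<lambda>x. hh x - grad (\<psi> n) x) \<in> borel_measurable D"
        by (intro borel_measurable_diff m\<phi> C1c_measurable[OF C\<psi>])
      have "norm ((LINT x|D. g x \<bullet> grad (\<psi> n) x) - (LINT x|D. g x \<bullet> hh x)) = \<bar>LINT x|D. g x \<bullet> (hh x - grad (\<psi> n) x)\<bar>"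
        using gh g\<psi> by (simp add: inner_diff_right abs_minus_commute)
      also have "\<dots> \<le> c / 2 * A + 1 / (2 * c) * integral\<^sup>L D (\<lambda>x. (norm (hh x - grad (\<psi> n) x))\<^sup>2)"
        unfolding A_def by (rule integrable_inner_D(2)[OF g_measurable m g_square_integrable i1 c])
      also have "\<dots> < c / 2 * A + 1 / (2 * c) * (c * \<epsilon>)"
        using c n0[OF n] by (intro add_strict_left_mono mult_strict_left_mono) auto
      also have "\<dots> = c / 2 * A + \<epsilon> / 2" using c by simp
      also have "c / 2 * A \<le> \<epsilon> / 2" using \<epsilon> A by (simp add: c_def field_simps)
      finally show ?thesis by simp
    qed
    then show "\<exists>no. \<forall>n\<ge>no. norm ((LINT x|D. g x \<bullet> grad (\<psi> n) x) - (LINT x|D. g x \<bullet> hh x)) < \<epsilon>" by blast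
  qed
  have "(\<lambda>n. LINT x|D. g x \<bullet> grad (\<psi> n) x) \<longlonglongrightarrow> l * (LINT x|D. Vk k (norm x) * nonlin p (u x) * \<phi> x)"
    unfolding weak_test[OF C\<psi>] by (intro tendsto_intros r)
  then show "(LINT x|D. g x \<bullet> hh x) = l * (LINT x|D. Vk k (norm x) * nonlin p (u x) * \<phi> x)"
    by (rule LIMSEQ_unique[OF lft])
qed

end

section \<open>Radial solutions of the problem\<close>

text \<open>Each pure second derivative is computed along a line through \<open>x\<close>. Over the
  two coordinates the squares \<open>(x \<bullet> b)^2\<close> add up to \<open>r^2\<close>, and
  \<open>w1 / r\<close> is counted twice and subtracted once.\<close>

lemma laplacian_radial:
  fixes u :: "plane \<Rightarrow> real"
  assumes w1: "\<And>r. 0 < r \<Longrightarrow> r < 1 \<Longrightarrow> (w has_real_derivative w1 r) (at r)"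
    and w2: "\<And>r. 0 < r \<Longrightarrow> r < 1 \<Longrightarrow> (w1 has_real_derivative w2 r) (at r)"
    and u: "\<And>x. x \<in> B1 - {0} \<Longrightarrow> u x = w (norm x)" and x: "x \<in> B1 - {0}"
  shows "laplacian u x = w2 (norm x) + w1 (norm x) / norm x"
proof -
  define r where "r = norm x"
  have r: "0 < r" "r < 1" using x by (auto simp: r_def)
  have part: "deriv (deriv (\<lambda>t. u (x + t *\<^sub>R b))) 0 =
      w2 r * (x \<bullet> b)\<^sup>2 / r\<^sup>2 + w1 r * (1 / r - (x \<bullet> b)\<^sup>2 / r ^ 3)" if b: "b \<in> Basis" for b
  proof -
    define N where "N = (\<lambda>t. norm (x + t *\<^sub>R b))"
    have "open (B1 - {0::plane})" by auto
    then have "open ((\<lambda>t. x + t *\<^sub>R b) -` (B1 - {0}))"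
      by (rule open_vimage) (intro continuous_intros)
    moreover have "0 \<in> (\<lambda>t. x + t *\<^sub>R b) -` (B1 - {0})" using x by auto
    ultimately obtain e where e: "e > 0" "ball 0 e \<subseteq> (\<lambda>t. x + t *\<^sub>R b) -` (B1 - {0})"
      by (rule openE)
    then have B: "x + t *\<^sub>R b \<in> B1 - {0}" if "t \<in> {-e<..<e}" for t
      using that by (auto simp: subset_iff dist_real_def abs_less_iff)
    have N01: "0 < N t" "N t < 1" if "t \<in> {-e<..<e}" for t using B[OF that] by (auto simp: N_def)
    have dN: "(N has_real_derivative ((x \<bullet> b) + t) / N t) (at t)" if t: "t \<in> {-e<..<e}" for t
    proof -
      have "((\<lambda>t. x + t *\<^sub>R b) has_derivative (\<lambda>h. h *\<^sub>R b)) (at t)" by (auto intro!: derivative_eq_intros)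
      from has_derivative_compose[OF this has_derivative_norm] B[OF t]
      have "(N has_derivative (\<lambda>h. (h *\<^sub>R b) \<bullet> sgn (x + t *\<^sub>R b))) (at t)" by (simp add: N_def)
      moreover have "(\<lambda>h. (h *\<^sub>R b) \<bullet> sgn (x + t *\<^sub>R b)) = (*) (((x \<bullet> b) + t) / N t)"
        using b by (auto simp: N_def sgn_div_norm inner_add_right inner_commute divide_inverse fun_eq_iff algebra_simps)
      ultimately show ?thesis by (simp add: has_field_derivative_def)
    qed
    define F where "F = (\<lambda>t. w1 (N t) * (((x \<bullet> b) + t) / N t))"
    \<comment> \<open>Needed on a whole interval around 0, since \<open>laplacian\<close>
      differentiates this derivative once more.\<close>
    have d1: "deriv (\<lambda>t. u (x + t *\<^sub>R b)) t = F t" if t: "t \<in> {-e<..<e}" for t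
    proof (rule DERIV_imp_deriv)
      have "((\<lambda>t. w (N t)) has_real_derivative F t) (at t)"
        unfolding F_def by (rule DERIV_chain2[where f=w and g=N, OF w1[OF N01[OF t]] dN[OF t]])
      then show "((\<lambda>t. u (x + t *\<^sub>R b)) has_real_derivative F t) (at t)"
        by (rule has_field_derivative_transform_within_open[of _ _ _ "{-e<..<e}"]) (use t u B in \<open>auto simp: N_def\<close>)
    qed
    have 0: "0 \<in> {-e<..<e}" using e by simp
    have N0: "N 0 = r" by (simp add: N_def r_def)
    have dw: "((\<lambda>t. w1 (N t)) has_real_derivative w2 r * ((x \<bullet> b) / r)) (at 0)"
      using DERIV_chain2[where f=w1 and g=N, OF w2[OF N01[OF 0]] dN[OF 0]] by (simp add: N0)
    have dq: "((\<lambda>t. ((x \<bullet> b) + t) / N t) has_real_derivative (1 * r - (x \<bullet> b) * ((x \<bullet> b) / r)) / (r * r)) (at 0)"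
    proof -
      have "((\<lambda>t. (x \<bullet> b) + t) has_real_derivative 1) (at 0)" by (auto intro!: derivative_eq_intros)
      from DERIV_divide[OF this dN[OF 0]] r show ?thesis by (simp add: N0)
    qed
    have "(F has_real_derivative w2 r * ((x \<bullet> b) / r) * ((x \<bullet> b) / r) +
        (1 * r - (x \<bullet> b) * ((x \<bullet> b) / r)) / (r * r) * w1 r) (at 0)"
      using DERIV_mult[OF dw dq] unfolding F_def by (simp add: N0)
    also have "w2 r * ((x \<bullet> b) / r) * ((x \<bullet> b) / r) + (1 * r - (x \<bullet> b) * ((x \<bullet> b) / r)) / (r * r) * w1 r =
        w2 r * (x \<bullet> b)\<^sup>2 / r\<^sup>2 + w1 r * (1 / r - (x \<bullet> b)\<^sup>2 / r ^ 3)"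
      using r by (simp add: field_simps power2_eq_square power3_eq_cube)
    finally have "(deriv (\<lambda>t. u (x + t *\<^sub>R b)) has_real_derivative
        w2 r * (x \<bullet> b)\<^sup>2 / r\<^sup>2 + w1 r * (1 / r - (x \<bullet> b)\<^sup>2 / r ^ 3)) (at 0)"
      by (rule has_field_derivative_transform_within_open[of _ _ _ "{-e<..<e}"]) (use 0 d1 in auto)
    then show ?thesis by (rule DERIV_imp_deriv)
  qed
  have s: "(\<Sum>b\<in>Basis. (x \<bullet> b)\<^sup>2) = r\<^sup>2"
  proof -
    have "(norm x)\<^sup>2 = (\<Sum>b\<in>Basis. (x \<bullet> b) * (x \<bullet> b))"
      using power2_norm_eq_inner[of x] euclidean_inner[of x x] by (rule trans)
    then show ?thesis unfolding r_def by (simp add: power2_eq_square[of "_ \<bullet> _"])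
  qed
  have "laplacian u x = (\<Sum>b\<in>(Basis::plane set). (w2 r / r\<^sup>2 - w1 r / r ^ 3) * (x \<bullet> b)\<^sup>2 + w1 r / r)"
    unfolding laplacian_def by (intro sum.cong refl) (simp add: part algebra_simps diff_divide_distrib)
  also have "\<dots> = (w2 r / r\<^sup>2 - w1 r / r ^ 3) * r\<^sup>2 + 2 * (w1 r / r)"
    by (simp add: sum.distrib sum_distrib_left[symmetric] s)
  also have "\<dots> = w2 r + w1 r / r" using r by (simp add: field_simps power2_eq_square power3_eq_cube)
  finally show ?thesis by (simp add: r_def)
qed

text \<open>The Emden--Fowler variable: \<open>x = xi r\<close> maps \<open>[0,1]\<close> onto itself and
  removes the logarithm. The case \<open>r = 0\<close> is separate because \<open>ln 0 = 0\<close>.\<close>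

context emden_profile begin

definition xi :: "real \<Rightarrow> real" where
  "xi r = (if r \<le> 0 then 0 else (1 - ln r) powr (- k))"

definition wX :: "real \<Rightarrow> real \<Rightarrow> real" where "wX X r = W (X * xi r) / W X - 1"

definition uX :: "real \<Rightarrow> plane \<Rightarrow> real" where "uX X x = (if norm x \<le> 1 then wX X (norm x) else 0)"

text \<open>The flux \<open>- r * wX'\<close> of the rescaled profile.\<close>

definition hX :: "real \<Rightarrow> real \<Rightarrow> real" where "hX X r = X powr (- q) * Z (X * xi r) / W X"

lemma L_pos: "0 < r \<Longrightarrow> r \<le> 1 \<Longrightarrow> 1 \<le> 1 - ln r" for r :: real
  using ln_le_zero_iff[of r] by linarith

lemma xi_0 [simp]: "xi 0 = 0" and xi_1 [simp]: "xi 1 = 1"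
  by (auto simp: xi_def)

lemma xi_bounds: assumes r: "0 < r" "r \<le> 1" shows "0 < xi r \<and> xi r \<le> 1"
proof -
  note L = L_pos[OF r]
  then have nz: "1 - ln r \<noteq> 0" by linarith
  have e: "xi r = (1 - ln r) powr (- k)" using r by (simp add: xi_def)
  have "xi r \<le> (1 - ln r) powr 0" unfolding e using L k by (intro powr_mono) auto
  also have "\<dots> = 1" using nz by simp
  finally have "xi r \<le> 1" .
  moreover have "0 < xi r" unfolding e powr_gt_zero by (rule nz)
  ultimately show ?thesis by simp
qed

lemma xi_lt_1: "0 < r \<Longrightarrow> r < 1 \<Longrightarrow> xi r < 1"
proof -
  assume r: "0 < r" "r < 1"
  then have "1 < 1 - ln r" by simp
  then have "(1 - ln r) powr (- k) < (1 - ln r) powr 0" using k by (intro powr_less_mono) auto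
  then show ?thesis using r \<open>1 < 1 - ln r\<close> by (simp add: xi_def)
qed

lemma xi_deriv:
  assumes "0 < r" "r \<le> 1"
  shows "(xi has_real_derivative k * (1 - ln r) powr (- k - 1) / r) (at r)"
proof -
  have L: "1 - ln r > 0" using L_pos[OF assms] by linarith
  have d: "((\<lambda>r. 1 - ln r) has_real_derivative - (1 / r)) (at r)"
    using assms by (auto intro!: derivative_eq_intros simp: divide_inverse)
  have "((\<lambda>y. y powr (- k)) has_real_derivative (- k) * (1 - ln r) powr (- k - 1)) (at (1 - ln r))"
    using L by (auto intro!: derivative_eq_intros)
  from DERIV_chain2[OF this d]
  have "((\<lambda>r. (1 - ln r) powr (- k)) has_real_derivative k * (1 - ln r) powr (- k - 1) / r) (at r)" by simp
  then show ?thesis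
    by (rule has_field_derivative_transform_within_open[of _ _ _ "{0<..}"]) (use assms in \<open>auto simp: xi_def\<close>)
qed

lemma xi_cont: "continuous_on {0..1} xi"
  unfolding continuous_on_eq_continuous_within
proof
  fix r :: real assume r: "r \<in> {0..1}"
  show "continuous (at r within {0..1}) xi"
  proof (cases "r = 0")
    case True
    have "((\<lambda>r. (1 - ln r) powr (- k)) \<longlongrightarrow> 0) (at_right 0)" by (rule log_powr_tendsto_0[OF k])
    then have "(xi \<longlongrightarrow> 0) (at_right 0)"
      by (rule Lim_transform_eventually) (auto simp: xi_def eventually_at_right_field intro!: exI[of _ 1])
    then show ?thesis using True by (simp add: continuous_within at_within_Icc_at_right)
  next
    case False
    have "isCont xi r" using False r by (intro DERIV_isCont[OF xi_deriv]) auto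
    then show ?thesis by (rule continuous_at_imp_continuous_at_within)
  qed
qed

lemma xi_powrs:
  assumes "0 < r" "r \<le> 1"
  shows "xi r powr q = (1 - ln r) powr (- 1)" "xi r powr (- 1 - q) = (1 - ln r) powr (k + 1)"
    "xi r powr (1 + q) = (1 - ln r) powr (- k - 1)"
proof -
  have e: "- k * q = - 1" "- k * (- 1 - q) = k + 1" "- k * (1 + q) = - k - 1"
    using kq by (auto simp: algebra_simps)
  show "xi r powr q = (1 - ln r) powr (- 1)" "xi r powr (- 1 - q) = (1 - ln r) powr (k + 1)"
    "xi r powr (1 + q) = (1 - ln r) powr (- k - 1)"
    using assms by (simp_all only: xi_def powr_powr e not_le if_not_P if_False)
qed

text \<open>By \<open>k * q = 1\<close> the derivative of \<open>xi\<close> cancels all powers of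
  \<open>1 - ln r\<close> in the first equation, and leaves the power \<open>- 2 - k\<close>, the
  numerator of the weight, in the second.\<close>

lemma wX_deriv:
  assumes X: "X > 0" "W X > 0" and r: "0 < r" "r \<le> 1"
  shows "(wX X has_real_derivative - hX X r / r) (at r)"
    and "(hX X has_real_derivative r * (lam X * Vk k r * nonlin p (wX X r))) (at r)"
proof -
  have L: "1 - ln r > 0" using L_pos[OF r] by linarith
  have xi: "xi r > 0" "xi r \<le> 1" using xi_bounds[OF r] by auto
  then have Xx: "X * xi r > 0" "X * xi r \<le> X" using X by (auto simp: mult_left_le)
  have W1: "0 < W (X * xi r)" "W (X * xi r) \<le> 1" using W_antimono[of "X * xi r" X] W_le_1[of "X * xi r"] X Xx by auto
  have dx: "((\<lambda>r. X * xi r) has_real_derivative X * (k * (1 - ln r) powr (- k - 1) / r)) (at r)"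
    by (intro DERIV_cmult xi_deriv r)
  have m1: "(1 - ln r) powr (k + 1) * (1 - ln r) powr (- k - 1) = 1" using L by (simp flip: powr_add)
  have m2: "(1 - ln r) powr (- 1) * (1 - ln r) powr (- k - 1) = (1 - ln r) powr (- 2 - k)"
  proof -
    have e: "- 1 + (- k - 1) = - 2 - k" by simp
    show ?thesis unfolding powr_add[symmetric] e ..
  qed
  have Xq: "X powr (- 1 - q) * X = X powr (- q)" "X powr (- q) * X powr q = 1"
    using X by (simp_all add: powr_diff powr_minus field_simps)
  have "((\<lambda>r. W (X * xi r)) has_real_derivative
      - q * (X * xi r) powr (- 1 - q) * Z (X * xi r) * (X * (k * (1 - ln r) powr (- k - 1) / r))) (at r)"
    by (rule DERIV_chain2[where f=W, OF W_deriv[OF Xx(1)] dx])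
  from DERIV_diff[OF DERIV_cdivide[OF this, of "W X"] DERIV_const[of 1]]
  show "(wX X has_real_derivative - hX X r / r) (at r)" unfolding wX_def
  proof (rule DERIV_cong)
    have "- q * (X * xi r) powr (- 1 - q) * Z (X * xi r) * (X * (k * (1 - ln r) powr (- k - 1) / r)) / W X - 0
      = - (k * q) * (X powr (- 1 - q) * X) * ((1 - ln r) powr (k + 1) * (1 - ln r) powr (- k - 1)) * Z (X * xi r) / r / W X"
      using X xi by (simp add: powr_mult xi_powrs[OF r])
    also have "\<dots> = - hX X r / r" unfolding m1 Xq kq by (simp add: hX_def)
    finally show "- q * (X * xi r) powr (- 1 - q) * Z (X * xi r) * (X * (k * (1 - ln r) powr (- k - 1) / r)) / W X - 0 = - hX X r / r" .
  qed
  have "((\<lambda>r. Z (X * xi r)) has_real_derivative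
      q * (X * xi r) powr q * g (W (X * xi r)) * (X * (k * (1 - ln r) powr (- k - 1) / r))) (at r)"
    by (rule DERIV_chain2[where f=Z, OF Z_deriv[OF Xx(1)] dx])
  from DERIV_cdivide[OF DERIV_cmult[OF this, of "X powr (- q)"], of "W X"]
  show "(hX X has_real_derivative r * (lam X * Vk k r * nonlin p (wX X r))) (at r)" unfolding hX_def
  proof (rule DERIV_cong)
    have gW: "g (W (X * xi r)) = W (X * xi r) powr p" using cut_powr_eq W1 by simp
    have "X powr (- q) * (q * (X * xi r) powr q * g (W (X * xi r)) * (X * (k * (1 - ln r) powr (- k - 1) / r))) / W X
      = (k * q) * (X powr (- q) * X powr q) * ((1 - ln r) powr (- 1) * (1 - ln r) powr (- k - 1)) * W (X * xi r) powr p * X / r / W X"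
      using X xi by (simp add: powr_mult xi_powrs[OF r] gW)
    also have "\<dots> = (1 - ln r) powr (- 2 - k) * W (X * xi r) powr p * X / r / W X" unfolding m2 Xq kq by simp
    also have "\<dots> = r * (lam X * Vk k r * nonlin p (wX X r))"
    proof -
      have "nonlin p (wX X r) = W (X * xi r) powr p / W X powr p"
        using X W1 by (simp add: nonlin_def wX_def powr_divide)
      moreover have "W X powr (p - 1) / W X powr p = 1 / W X" using X by (simp add: powr_diff)
      then have "W X powr (p - 1) / W X powr p * W (X * xi r) powr p = 1 / W X * W (X * xi r) powr p" by (rule arg_cong)
      then have "W X powr (p - 1) * (W (X * xi r) powr p / W X powr p) = W (X * xi r) powr p / W X" by simp
      moreover have "r * (lam X * Vk k r * nonlin p (wX X r)) = r * X * Vk k r * (W X powr (p - 1) * nonlin p (wX X r))"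
        by (simp add: lam_def)
      ultimately have "r * (lam X * Vk k r * nonlin p (wX X r)) = r * X * Vk k r * (W (X * xi r) powr p / W X)"
        by (simp only:)
      then show ?thesis using r by (simp add: Vk_eq power2_eq_square)
    qed
    finally show "X powr (- q) * (q * (X * xi r) powr q * g (W (X * xi r)) * (X * (k * (1 - ln r) powr (- k - 1) / r))) / W X
      = r * (lam X * Vk k r * nonlin p (wX X r))" .
  qed
qed

lemma wX_0: "W X > 0 \<Longrightarrow> wX X 0 = alpha X" and wX_1: "W X > 0 \<Longrightarrow> wX X 1 = 0"
  by (auto simp: wX_def alpha_def)

lemma wX_bounds:
  assumes X: "X > 0" "W X > 0" and r: "0 < r" "r < 1"
  shows "0 < wX X r" "wX X r < alpha X"
proof -
  have xi: "xi r > 0" "xi r < 1" using xi_bounds[of r] xi_lt_1[of r] r by auto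
  then have "X * xi r < X * 1" using X by (intro mult_strict_left_mono) auto
  then have "W X < W (X * xi r)" "W (X * xi r) < W 0"
    using W_strict_antimono[of "X * xi r" X] W_strict_antimono[of 0 "X * xi r"] X xi by auto
  then show "0 < wX X r" "wX X r < alpha X" using X by (auto simp: wX_def alpha_def divide_strict_right_mono)
qed

lemma alpha_pos: "X > 0 \<Longrightarrow> W X > 0 \<Longrightarrow> alpha X > 0"
  using W_strict_antimono[of 0 X] by (simp add: alpha_def)

lemma lam_pos: "X > 0 \<Longrightarrow> W X > 0 \<Longrightarrow> lam X > 0"
  by (simp add: lam_def)

lemma wX_cont: assumes "X > 0" "W X > 0" shows "continuous_on {0..1} (wX X)"
proof -
  have "xi r \<ge> 0" if "r \<in> {0..1}" for r using xi_bounds[of r] that by (cases "r = 0") auto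
  then have "continuous_on {0..1} (\<lambda>r. W (X * xi r))"
    using assms by (intro continuous_on_compose2[OF W_cont] continuous_intros xi_cont) auto
  then show ?thesis unfolding wX_def using assms by (intro continuous_intros) auto
qed

text \<open>\<open>Z_upper\<close> becomes
  \<open>hX X r \<le> c * (1 - ln r) powr (- k - 1)\<close>, which gives both the limit 0 of the
  flux and the bound of its square by the weight. Smoothness is a joint induction, as the
  derivatives of \<open>wX\<close> and \<open>hX\<close> are expressed by each other.\<close>

lemma wX_radial_sol:
  assumes X: "X > 0" "W X > 0"
  shows "\<exists>C. radial_sol k p (lam X) C (wX X) (hX X) (uX X)"
proof -
  define c where "c = X powr (- q) / W X * (q / (1 + q) * X powr (1 + q))"
  have c: "c \<ge> 0" using X q by (simp add: c_def)
  have h_up: "hX X r \<le> c * (1 - ln r) powr (- k - 1)" if r: "0 < r" "r < 1" for r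
  proof -
    have "0 \<le> X * xi r" using X xi_bounds[of r] r by auto
    then have "hX X r \<le> X powr (- q) * (q / (1 + q) * (X * xi r) powr (1 + q)) / W X"
      unfolding hX_def using X Z_upper[of "X * xi r"] by (intro divide_right_mono mult_left_mono) auto
    also have "\<dots> = c * xi r powr (1 + q)" using X xi_bounds[of r] r by (simp add: c_def powr_mult mult_ac)
    finally show ?thesis using xi_powrs(3)[of r] r by simp
  qed
  have "radial_sol k p (lam X) (c\<^sup>2) (wX X) (hX X) (uX X)"
  proof
    show hp: "0 < hX X r" if "0 < r" "r < 1" for r
      using X Z_pos[of "X * xi r"] xi_bounds[of r] that by (simp add: hX_def)
    show "(wX X has_real_derivative - hX X r / r) (at r)" if "0 < r" "r < 1" for r
      using wX_deriv(1)[OF X] that by simp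
    show hd: "(hX X has_real_derivative r * (lam X * Vk k r * nonlin p (wX X r))) (at r)" if "0 < r" "r < 1" for r
      using wX_deriv(2)[OF X] that by simp
    show "0 < wX X r" if "0 \<le> r" "r < 1" for r
      using wX_bounds[OF X, of r] wX_0 alpha_pos X that by (cases "r = 0") auto
    show "wX X r < wX X 0" if "0 < r" "r < 1" for r
      using wX_bounds[OF X, of r] wX_0 X that by auto
    show "(hX X r / r)\<^sup>2 \<le> c\<^sup>2 * Vk k r" if r: "0 < r" "r < 1" for r
    proof -
      have L: "1 \<le> 1 - ln r" using L_pos[of r] r by simp
      have "(hX X r)\<^sup>2 \<le> (c * (1 - ln r) powr (- k - 1))\<^sup>2"
        using h_up[OF r] hp[OF r] by (intro power_mono) auto
      also have "\<dots> = c\<^sup>2 * (1 - ln r) powr (- 2 - 2 * k)"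
      proof -
        have e: "- k - 1 + (- k - 1) = - 2 - 2 * k" by simp
        have "(1 - ln r) powr (- k - 1) * (1 - ln r) powr (- k - 1) = (1 - ln r) powr (- 2 - 2 * k)"
          unfolding powr_add[symmetric] e ..
        moreover have "(c * a)\<^sup>2 = c\<^sup>2 * (a * a)" for a by (simp add: power2_eq_square)
        ultimately show ?thesis by (simp only:)
      qed
      also have "\<dots> \<le> c\<^sup>2 * (1 - ln r) powr (- 2 - k)"
        using L k by (intro mult_left_mono powr_mono) auto
      finally show ?thesis using r by (simp add: Vk_eq power_divide divide_right_mono)
    qed
    have lim: "((\<lambda>r. c * (1 - ln r) powr (- (k + 1))) \<longlongrightarrow> c * 0) (at_right 0)"
      using k by (intro tendsto_mult tendsto_const log_powr_tendsto_0) auto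
    show "(hX X \<longlongrightarrow> 0) (at_right 0)"
    proof (rule tendsto_sandwich[OF _ _ tendsto_const])
      show "\<forall>\<^sub>F r in at_right 0. 0 \<le> hX X r" using hp
        by (auto simp: eventually_at_right_field less_imp_le intro!: exI[of _ 1])
      show "\<forall>\<^sub>F r in at_right 0. hX X r \<le> c * (1 - ln r) powr (- (k + 1))" using h_up
        by (auto simp: eventually_at_right_field intro!: exI[of _ 1])
      show "((\<lambda>r. c * (1 - ln r) powr (- (k + 1))) \<longlongrightarrow> 0) (at_right 0)" using lim by simp
    qed
    have "Cm m {0<..<1} (wX X) \<and> Cm m {0<..<1} (hX X)" for m
    proof (induction m)
      case 0
      then show ?case
        by (auto intro!: continuous_at_imp_continuous_on DERIV_isCont wX_deriv[OF X] less_imp_le)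
    next
      case (Suc m)
      have pw: "Cm m {0<..<1} (\<lambda>r. r powr a)" for a by (rule Cm_subset[OF Cm_powr]) auto
      have "Cm m {0<..<1} ln" by (rule Cm_subset[OF Cm_ln]) auto
      then have V: "Cm m {0<..<1} (\<lambda>r. (1 - ln r) powr (- 2 - k))"
        by (intro Cm_compose[OF _ Cm_powr] Cm_diff Cm_const) (auto simp: ln_less_zero_iff order_less_trans[of _ 0])
      have n: "Cm m {0<..<1} (\<lambda>r. (1 + wX X r) powr p)"
        by (intro Cm_compose[OF _ Cm_powr] Cm_add Cm_const conjunct1[OF Suc])
          (use wX_bounds[OF X] in \<open>auto intro: add_pos_pos\<close>)
      have "Cm (Suc m) {0<..<1} (wX X)"
      proof (rule Cm_SucI[where f'="\<lambda>r. (- 1) * (hX X r * r powr (- 1))"])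
        show "Cm m {0<..<1} (\<lambda>r. (- 1) * (hX X r * r powr (- 1)))"
          by (intro Cm_cmult Cm_mult pw conjunct2[OF Suc]) auto
        show "(wX X has_real_derivative (- 1) * (hX X r * r powr (- 1))) (at r)" if "r \<in> {0<..<1}" for r
          using wX_deriv(1)[OF X, of r] that by (simp add: powr_minus divide_inverse)
      qed auto
      moreover have "Cm (Suc m) {0<..<1} (hX X)"
      proof (rule Cm_SucI[where f'="\<lambda>r. lam X * (r powr (- 1) * ((1 - ln r) powr (- 2 - k) * (1 + wX X r) powr p))"])
        show "Cm m {0<..<1} (\<lambda>r. lam X * (r powr (- 1) * ((1 - ln r) powr (- 2 - k) * (1 + wX X r) powr p)))"
          by (intro Cm_cmult Cm_mult pw V n) auto
        show "(hX X has_real_derivative lam X * (r powr (- 1) * ((1 - ln r) powr (- 2 - k) * (1 + wX X r) powr p))) (at r)"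
          if "r \<in> {0<..<1}" for r
          by (rule DERIV_cong[OF hd]) (use that in \<open>auto simp: Vk_eq nonlin_def powr_minus power2_eq_square field_simps\<close>)
      qed auto
      ultimately show ?case by blast
    qed
    then show "Cm m {0<..<1} (wX X)" for m by blast
    show "uX X x = wX X (norm x)" if "x \<in> cball 0 1" for x using that by (simp add: uX_def)
  qed (use k p X lam_pos wX_cont wX_1 in auto)
  then show ?thesis by blast
qed

lemma uX_radial_solution:
  assumes X: "X > 0" "W X > 0"
  shows "radial_solution k p (lam X) (uX X)"
  unfolding radial_solution_def
proof (intro conjI exI[of _ "wX X"] ballI allI impI)
  define w1 where "w1 = (\<lambda>r. - hX X r / r)"
  define w2 where "w2 = (\<lambda>r. - (r * (lam X * Vk k r * nonlin p (wX X r)) * r - hX X r) / r\<^sup>2)"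
  have d1: "(wX X has_real_derivative w1 r) (at r)" if "0 < r" "r \<le> 1" for r
    unfolding w1_def by (rule wX_deriv(1)[OF X that])
  have d2: "(w1 has_real_derivative w2 r) (at r)" if r: "0 < r" "r \<le> 1" for r
    unfolding w1_def using DERIV_divide[OF DERIV_minus[OF wX_deriv(2)[OF X r]] DERIV_ident] r
    by (rule_tac DERIV_cong) (auto simp: w2_def power2_eq_square)
  show "continuous_on {0..1} (wX X)" by (rule wX_cont[OF X])
  show "C2_on {0<..1} (wX X)"
    unfolding C2_on_def
  proof (intro exI conjI ballI)
    show "(wX X has_real_derivative w1 r) (at r within {0<..1})" "(w1 has_real_derivative w2 r) (at r within {0<..1})"
      if "r \<in> {0<..1}" for r
      using d1[of r] d2[of r] that by (auto intro: has_field_derivative_at_within)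
    have wc: "continuous_on {0<..1} (wX X)" by (rule continuous_on_subset[OF wX_cont[OF X]]) auto
    have hc: "continuous_on {0<..1} (hX X)"
      by (auto intro!: continuous_at_imp_continuous_on DERIV_isCont wX_deriv(2)[OF X])
    have "1 + wX X r \<noteq> 0" if "r \<in> {0<..1}" for r
      using wX_bounds(1)[OF X, of r] wX_1[OF X(2)] that by (cases "r = 1") auto
    then show "continuous_on {0<..1} w2"
      unfolding w2_def nonlin_def by (intro continuous_intros wc hc continuous_on_Vk) auto
  qed
  show "- laplacian (uX X) x = lam X * Vk k (norm x) * nonlin p (uX X x)" if x: "x \<in> B1 - {0}" for x
  proof -
    have nx: "0 < norm x" "norm x < 1" using x by auto
    have "laplacian (uX X) x = w2 (norm x) + w1 (norm x) / norm x"
      by (rule laplacian_radial[OF d1 d2 _ x]) (auto simp: uX_def)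
    also have "\<dots> = - (lam X * Vk k (norm x) * nonlin p (wX X (norm x)))"
      using nx by (simp add: w1_def w2_def field_simps power2_eq_square)
    finally show ?thesis using nx by (simp add: uX_def)
  qed
  show "uX X x > 0" if "x \<in> B1" for x
    using that wX_bounds(1)[OF X, of "norm x"] wX_0 alpha_pos X by (cases "x = 0") (auto simp: uX_def)
qed (use X lam_pos wX_1 in \<open>auto simp: uX_def\<close>)

end

section \<open>Classification of all radial solutions and the parametrized curve\<close>

context emden_profile begin

text \<open>The inverse of \<open>xi\<close> on \<open>[0, 1]\<close>, by which an arbitrary
  solution is transported to the Emden-Fowler variable.\<close>

definition rr :: "real \<Rightarrow> real" where "rr x = (if x \<le> 0 then 0 else exp (1 - x powr (- q)))"

lemma rr_0 [simp]: "rr 0 = 0" and rr_1 [simp]: "rr 1 = 1"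
  by (auto simp: rr_def)

lemma rr_pos: "0 < x \<Longrightarrow> 0 < rr x"
  by (simp add: rr_def)

lemma rr_le_1: assumes "x \<le> 1" shows "rr x \<le> 1"
proof (cases "x \<le> 0")
  case False
  then have "1 powr (- q) \<le> x powr (- q)" using assms q by (intro powr_mono2') auto
  then show ?thesis using False by (simp add: rr_def)
qed (simp add: rr_def)

lemma rr_lt_1: assumes "0 < x" "x < 1" shows "rr x < 1"
proof -
  have "1 powr (- q) < x powr (- q)" using assms q by (intro powr_less_mono2_neg) auto
  then show ?thesis using assms by (simp add: rr_def)
qed

lemma rr_xi: assumes "0 < r" "r \<le> 1" shows "rr (xi r) = r"
proof -
  have L: "1 - ln r > 0" using L_pos[OF assms] by linarith
  have e: "- k * - q = 1" using kq by simp
  have "xi r powr (- q) = (1 - ln r) powr (- k * - q)" using assms by (simp add: xi_def powr_powr)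
  also have "\<dots> = 1 - ln r" unfolding e using L by simp
  finally have "rr (xi r) = exp (ln r)" using xi_bounds[OF assms] by (simp add: rr_def)
  then show ?thesis using assms by simp
qed

lemma rr_deriv: assumes "0 < x" shows "(rr has_real_derivative rr x * (q * x powr (- 1 - q))) (at x)"
proof -
  have e: "x powr (- q - 1) = x powr (- 1 - q)" by (simp only: minus_diff_commute)
  have "((\<lambda>x. 1 - x powr (- q)) has_real_derivative 0 - (- q * x powr (- q - 1))) (at x)"
    using assms by (intro DERIV_diff DERIV_const) (auto intro!: derivative_eq_intros)
  then have "((\<lambda>x. 1 - x powr (- q)) has_real_derivative q * x powr (- 1 - q)) (at x)" unfolding e by simp
  from DERIV_chain2[OF DERIV_exp this]
  have "((\<lambda>x. exp (1 - x powr (- q))) has_real_derivative exp (1 - x powr (- q)) * (q * x powr (- 1 - q))) (at x)" .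
  then have "(rr has_real_derivative exp (1 - x powr (- q)) * (q * x powr (- 1 - q))) (at x)"
    by (rule has_field_derivative_transform_within_open[of _ _ _ "{0<..}"]) (use assms in \<open>auto simp: rr_def\<close>)
  then show ?thesis using assms by (simp add: rr_def)
qed

lemma rr_cont: "continuous_on {0..1} rr"
  unfolding continuous_on_eq_continuous_within
proof
  fix x :: real assume x: "x \<in> {0..1}"
  show "continuous (at x within {0..1}) rr"
  proof (cases "x = 0")
    case True
    have "filterlim (\<lambda>x::real. x powr (- q)) at_top (at_right 0)"
    proof -
      have "((\<lambda>x::real. x powr q) \<longlongrightarrow> 0 powr q) (at_right 0)"
        using q by (intro tendsto_powr') (auto intro!: tendsto_intros simp: eventually_at_filter)
      then have "((\<lambda>x::real. x powr q) \<longlongrightarrow> 0) (at_right 0)" by simp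
      then have "filterlim (\<lambda>x::real. inverse (x powr q)) at_top (at_right 0)"
        by (rule filterlim_inverse_at_top) (auto simp: eventually_at_right_field intro!: exI[of _ 1])
      then show ?thesis by (simp add: powr_minus)
    qed
    then have "filterlim (\<lambda>x::real. - (x powr (- q))) at_bot (at_right 0)"
      by (simp add: filterlim_uminus_at_top)
    then have "((\<lambda>x. exp (- (x powr (- q)))) \<longlongrightarrow> 0) (at_right 0)"
      by (rule filterlim_compose[OF exp_at_bot])
    then have "((\<lambda>x. exp 1 * exp (- (x powr (- q)))) \<longlongrightarrow> 0) (at_right 0)"
      by (rule tendsto_mult_right_zero)
    then have "(rr \<longlongrightarrow> 0) (at_right 0)"
      by (rule Lim_transform_eventually)
        (auto simp: rr_def eventually_at_right_field mult_exp_exp intro!: exI[of _ 1])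
    then show ?thesis using True by (simp add: continuous_within at_within_Icc_at_right)
  next
    case False
    have "isCont rr x" using False x by (intro DERIV_isCont[OF rr_deriv]) auto
    then show ?thesis by (rule continuous_at_imp_continuous_at_within)
  qed
qed

text \<open>The variable \<open>t = x powr -q\<close> is unbounded at the origin; the contradictions
  in \<open>limit_of_flux\<close> are brought into this form.\<close>

lemma neg_powr_unbounded:
  assumes "c > 0" "x1 > 0" and bd: "\<And>y. 0 < y \<Longrightarrow> y < x1 \<Longrightarrow> c * y powr (- q) \<le> M"
  shows False
proof -
  \<comment> \<open>Large enough that \<open>T powr (- 1 / q)\<close> lies below \<open>x1\<close>
    and that \<open>c * T\<close> exceeds \<open>M\<close>.\<close>
  define T where "T = \<bar>M\<bar> / c + x1 powr (- q) + 1"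
  have T: "T > x1 powr (- q)" "T > 0" "c * T > M"
  proof -
    have "\<bar>M\<bar> / c \<ge> 0" using assms by simp
    then show "T > x1 powr (- q)" by (simp add: T_def)
    then show "T > 0" using powr_ge_zero[of x1 "- q"] by linarith
    have "c * T = \<bar>M\<bar> + c * (x1 powr (- q) + 1)" using assms by (simp add: T_def algebra_simps)
    moreover have "c * (x1 powr (- q) + 1) > 0" using assms powr_ge_zero[of x1 "- q"] by (intro mult_pos_pos) linarith+
    ultimately show "c * T > M" by linarith
  qed
  define y where "y = T powr (- 1 / q)"
  have yq: "y powr (- q) = T" using T q by (simp add: y_def powr_powr)
  have "y > 0" using T by (simp add: y_def)
  moreover have "y < x1"
  proof (rule ccontr)
    assume "\<not> y < x1"
    then have "y powr (- q) \<le> x1 powr (- q)" using assms q by (intro powr_mono2') auto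
    then show False using T yq by simp
  qed
  ultimately show False using bd[of y] T yq by simp
qed

text \<open>In the variable \<open>t = x powr -q\<close>, which tends to infinity at the origin, the
  slope of \<open>om\<close> is \<open>ze\<close>. A bounded function has no slope bounded away from
  0 on a half-line, so the monotone \<open>ze\<close> can neither be negative somewhere nor stay
  above a positive number. This replaces an initial condition on the derivative.\<close>

lemma limit_of_flux:
  fixes om ze :: "real \<Rightarrow> real"
  assumes om_deriv: "\<And>x. 0 < x \<Longrightarrow> x < 1 \<Longrightarrow> (om has_real_derivative - q * x powr (- 1 - q) * ze x) (at x)"
    and ze_deriv: "\<And>x. 0 < x \<Longrightarrow> x < 1 \<Longrightarrow> \<exists>d\<ge>0. (ze has_real_derivative d) (at x)"
    and om_bd: "\<And>x. 0 < x \<Longrightarrow> x < 1 \<Longrightarrow> \<bar>om x\<bar> \<le> B"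
  shows "\<And>x. 0 < x \<Longrightarrow> x < 1 \<Longrightarrow> 0 \<le> ze x" and "(ze \<longlongrightarrow> 0) (at_right 0)"
proof -
  have ze_mono: "ze y \<le> ze x" if "0 < y" "y \<le> x" "x < 1" for x y
  proof (rule DERIV_nonneg_imp_nondecreasing[OF that(2)])
    fix z assume "y \<le> z" "z \<le> x"
    then have "0 < z" "z < 1" using that by auto
    from ze_deriv[OF this] show "\<exists>d. (ze has_real_derivative d) (at z) \<and> 0 \<le> d" by blast
  qed
  have pw: "z powr (- q - 1) = z powr (- 1 - q)" for z :: real by (simp only: minus_diff_commute)
  have bar: "((\<lambda>x. c * x powr (- q)) has_real_derivative - q * c * x powr (- 1 - q)) (at x)" if "x > 0" for c x
    using that by (auto intro!: derivative_eq_intros simp: pw)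
  \<comment> \<open>The sign \<open>s\<close> treats slopes above \<open>c\<close> and slopes below
    \<open>- c\<close> together.\<close>
  have contra: False if c: "c > 0" and x1: "0 < x1" "x1 < 1" and s: "s = 1 \<or> s = -1"
    and le: "\<And>y. 0 < y \<Longrightarrow> y \<le> x1 \<Longrightarrow> c \<le> s * ze y" for c x1 s
  proof (rule neg_powr_unbounded[OF c x1(1)])
    fix y assume y: "0 < y" "y < x1"
    let ?f = "\<lambda>x. c * x powr (- q) - s * om x"
    have "?f y \<le> ?f x1"
    proof (rule DERIV_nonneg_imp_nondecreasing[of y x1 ?f])
      fix z assume z: "y \<le> z" "z \<le> x1"
      have "(?f has_real_derivative - q * c * z powr (- 1 - q) - s * (- q * z powr (- 1 - q) * ze z)) (at z)"
        using z y x1 by (intro DERIV_diff DERIV_cmult bar om_deriv) auto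
      moreover have "- q * c * z powr (- 1 - q) - s * (- q * z powr (- 1 - q) * ze z) = q * z powr (- 1 - q) * (s * ze z - c)"
        by (simp add: algebra_simps)
      moreover have "q * z powr (- 1 - q) * (s * ze z - c) \<ge> 0" using q le[of z] z y by simp
      ultimately show "\<exists>w. (?f has_real_derivative w) (at z) \<and> 0 \<le> w" by metis
    qed (use y in auto)
    then have f: "c * y powr (- q) \<le> c * x1 powr (- q) - s * om x1 + s * om y" by linarith
    have "\<bar>s * om y\<bar> \<le> B" "\<bar>s * om x1\<bar> \<le> B" using s om_bd[of y] om_bd[of x1] x1 y by auto
    then show "c * y powr (- q) \<le> c * x1 powr (- q) + 2 * B" using f by linarith
  qed
  show nn: "0 \<le> ze x" if x: "0 < x" "x < 1" for x
  proof (rule ccontr)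
    assume "\<not> 0 \<le> ze x"
    then show False
      using contra[of "- ze x" x "-1"] ze_mono[of _ x] x by fastforce
  qed
  show "(ze \<longlongrightarrow> 0) (at_right 0)"
  proof (rule tendstoI)
    fix e :: real assume e: "e > 0"
    have "\<exists>x1. 0 < x1 \<and> x1 < 1 \<and> ze x1 < e"
    proof (rule ccontr)
      assume "\<not> ?thesis"
      then have "e \<le> ze y" if "0 < y" "y < 1" for y using that by force
      then show False using contra[OF e, of "1/2" 1] by force
    qed
    then obtain x1 where x1: "0 < x1" "x1 < 1" "ze x1 < e" by blast
    have "dist (ze y) 0 < e" if "0 < y" "y < x1" for y
      using nn[of y] ze_mono[of y x1] x1 that by simp
    then show "\<forall>\<^sub>F x in at_right 0. dist (ze x) 0 < e"
      using x1(1) by (auto simp: eventually_at_right_field)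
  qed
qed

text \<open>With \<open>a\<close> the value at the origin, \<open>(1 + w) / (1 + a)\<close> in the
  Emden-Fowler variable satisfies the equation of the profile rescaled by
  \<open>X = l * (1 + a) powr (p - 1)\<close>. Uniqueness identifies it with
  \<open>W (X * x)\<close>; the boundary value 0 reads \<open>W X = 1 / (1 + a)\<close>, and this
  determines \<open>l\<close> and \<open>v\<close>.\<close>

lemma radial_solution_classification:
  assumes "radial_solution k p l v"
  shows "\<exists>X>0. W X > 0 \<and> l = lam X \<and> v = uX X"
proof -
  have l: "l > 0" and eq: "\<And>x. x \<in> B1 - {0} \<Longrightarrow> - laplacian v x = l * Vk k (norm x) * nonlin p (v x)"
    and pos: "\<And>x. x \<in> B1 \<Longrightarrow> v x > 0" and bd: "\<And>x. x \<in> sphere 0 1 \<Longrightarrow> v x = 0" and out: "\<And>x. x \<notin> cball 0 1 \<Longrightarrow> v x = 0"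
    using assms by (auto simp: radial_solution_def)
  obtain w where vw: "\<And>x. x \<in> cball 0 1 \<Longrightarrow> v x = w (norm x)" and wc: "continuous_on {0..1} w" and "C2_on {0<..1} w"
    using assms by (auto simp: radial_solution_def)
  then obtain w' w'' where d: "\<And>r. r \<in> {0<..1} \<Longrightarrow> (w has_real_derivative w' r) (at r within {0<..1})"
      "\<And>r. r \<in> {0<..1} \<Longrightarrow> (w' has_real_derivative w'' r) (at r within {0<..1})"
    unfolding C2_on_def by blast
  have at: "at r within {0<..1} = at r" if "0 < r" "r < 1" for r :: real
    by (rule at_within_nhd[of _ "{0<..<1}"]) (use that in auto)
  have d1: "(w has_real_derivative w' r) (at r)" and d2: "(w' has_real_derivative w'' r) (at r)" if "0 < r" "r < 1" for r
    using d(1)[of r] d(2)[of r] at[OF that] that by auto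
  have ex: "\<exists>x::plane. norm x = r" if "r \<ge> 0" for r
    using vector_choose_size[OF that] by metis
  have wpos: "w r > 0" if r: "0 \<le> r" "r < 1" for r
  proof -
    obtain x :: plane where x: "norm x = r" using ex r by blast
    then show ?thesis using pos[of x] vw[of x] r by auto
  qed
  have w1: "w 1 = 0"
  proof -
    obtain x :: plane where x: "norm x = 1" using ex[of 1] by auto
    then show ?thesis using bd[of x] vw[of x] by auto
  qed
  have ode: "w'' r + w' r / r = - (l * Vk k r * nonlin p (w r))" if r: "0 < r" "r < 1" for r
  proof -
    obtain x :: plane where x: "norm x = r" using ex r by (meson less_imp_le)
    then have xB: "x \<in> B1 - {0}" using r by auto
    have "laplacian v x = w'' (norm x) + w' (norm x) / norm x"
      by (rule laplacian_radial[OF d1 d2 _ xB]) (auto intro: vw)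
    then show ?thesis using eq[OF xB] vw[of x] x r by auto
  qed
  define a where "a = w 0"
  have a: "a > 0" using wpos[of 0] by (simp add: a_def)
  define X where "X = l * (1 + a) powr (p - 1)"
  have X: "X > 0" using l a by (simp add: X_def)
  define om where "om = (\<lambda>x. (1 + w (rr x)) / (1 + a))"
  define ze where "ze = (\<lambda>x. - rr x * w' (rr x) / (1 + a))"
  have om_pos: "om x > 0" if "0 < x" "x < 1" for x
    using wpos[of "rr x"] rr_pos[of x] rr_lt_1[of x] that a by (simp add: om_def add_pos_pos)
  have om_d: "(om has_real_derivative - q * x powr (- 1 - q) * ze x) (at x)" if x: "0 < x" "x < 1" for x
  proof -
    have "((\<lambda>x. w (rr x)) has_real_derivative w' (rr x) * (rr x * (q * x powr (- 1 - q)))) (at x)"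
      by (rule DERIV_chain2[where f=w, OF d1 rr_deriv]) (use x rr_pos rr_lt_1 in auto)
    from DERIV_cdivide[OF DERIV_add[OF DERIV_const[of 1] this], of "1 + a"]
    show ?thesis unfolding om_def by (rule DERIV_cong) (simp add: ze_def)
  qed
  have ze_d: "(ze has_real_derivative q * X * x powr q * om x powr p) (at x)" if x: "0 < x" "x < 1" for x
  proof -
    define R where "R = rr x"
    have R: "0 < R" "R < 1" using rr_pos rr_lt_1 x by (auto simp: R_def)
    have dr: "(rr has_real_derivative R * (q * x powr (- 1 - q))) (at x)" unfolding R_def by (rule rr_deriv[OF x(1)])
    have dw: "((\<lambda>x. w' (rr x)) has_real_derivative w'' R * (R * (q * x powr (- 1 - q)))) (at x)"
      unfolding R_def by (rule DERIV_chain2[where f=w', OF d2 rr_deriv]) (use x rr_pos rr_lt_1 in auto)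
    have "(ze has_real_derivative (- (R * (q * x powr (- 1 - q))) * w' R + w'' R * (R * (q * x powr (- 1 - q))) * - R) / (1 + a)) (at x)"
      using DERIV_cdivide[OF DERIV_mult[OF DERIV_minus[OF dr] dw], of "1 + a"] unfolding ze_def R_def by simp
    moreover have "(- (R * (q * x powr (- 1 - q))) * w' R + w'' R * (R * (q * x powr (- 1 - q))) * - R) / (1 + a)
        = q * X * x powr q * om x powr p"
    proof -
      have "- (R * (q * x powr (- 1 - q))) * w' R + w'' R * (R * (q * x powr (- 1 - q))) * - R
        = - (R\<^sup>2 * (q * x powr (- 1 - q))) * (w'' R + w' R / R)"
        using R by (simp add: field_simps power2_eq_square)
      also have "\<dots> = (R\<^sup>2 * Vk k R) * q * x powr (- 1 - q) * l * (1 + w R) powr p"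
        unfolding ode[OF R] by (simp add: nonlin_def)
      \<comment> \<open>The logarithm of \<open>rr x\<close> is \<open>1 - x powr -q\<close>, so the
        weight becomes a pure power of \<open>x\<close>.\<close>
      also have "R\<^sup>2 * Vk k R = x powr (2 * q + 1)"
      proof -
        have "1 - ln R = x powr (- q)" using x by (simp add: R_def rr_def)
        moreover have e: "- q * (- 2 - k) = 2 * q + 1" using kq by (simp add: algebra_simps)
        ultimately show ?thesis using R by (simp only: Vk_eq powr_powr e) simp
      qed
      also have "x powr (2 * q + 1) * q * x powr (- 1 - q) * l * (1 + w R) powr p
        = q * l * (x powr (2 * q + 1) * x powr (- 1 - q)) * (1 + w R) powr p" by simp
      also have "x powr (2 * q + 1) * x powr (- 1 - q) = x powr q"
        by (simp flip: powr_add)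
      also have "(1 + w R) powr p = (1 + a) powr p * om x powr p"
        using a wpos[of R] R by (simp add: om_def R_def powr_divide)
      finally have "(- (R * (q * x powr (- 1 - q))) * w' R + w'' R * (R * (q * x powr (- 1 - q))) * - R) / (1 + a)
        = q * l * x powr q * ((1 + a) powr p / (1 + a)) * om x powr p" by simp
      also have "(1 + a) powr p / (1 + a) = (1 + a) powr (p - 1)" using a by (simp add: powr_diff)
      finally show ?thesis by (simp add: X_def)
    qed
    ultimately show ?thesis by simp
  qed
  have om_c: "continuous_on {0..1} om"
  proof -
    have "rr x \<in> {0..1}" if "x \<in> {0..1}" for x
      using rr_pos[of x] rr_le_1[of x] that by (cases "x = 0") auto
    then have "continuous_on {0..1} (\<lambda>x. w (rr x))"
      by (intro continuous_on_compose2[OF wc rr_cont]) auto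
    then show ?thesis unfolding om_def using a by (intro continuous_intros) auto
  qed
  have om_0: "om 0 = 1" using a by (simp add: om_def a_def)
  obtain B where B: "\<And>x. x \<in> {0..1} \<Longrightarrow> \<bar>om x\<bar> \<le> B"
    using compact_imp_bounded[OF compact_continuous_image[OF om_c compact_Icc]]
    unfolding bounded_iff by (metis image_eqI real_norm_def)
  have ze_ex: "\<exists>d\<ge>0. (ze has_real_derivative d) (at x)" if "0 < x" "x < 1" for x
    using ze_d[OF that] q X by (intro exI[of _ "q * X * x powr q * om x powr p"]) auto
  have om_B: "\<bar>om x\<bar> \<le> B" if "0 < x" "x < 1" for x using B that by auto
  have flux: "0 \<le> ze x" if "0 < x" "x < 1" for x
    by (rule limit_of_flux(1)[of om ze B]) (rule om_d ze_ex om_B that; assumption)+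
  have flux_lim: "(ze \<longlongrightarrow> 0) (at_right 0)"
    by (rule limit_of_flux(2)[of om ze B]) (rule om_d ze_ex om_B; assumption)+
  \<comment> \<open>Together with positivity this makes \<open>cut_powr\<close> inactive, as
    \<open>profile_unique\<close> speaks of the equation with the cut-off.\<close>
  have om_le: "om x \<le> 1" if x: "0 < x" "x < 1" for x
  proof -
    have "- 1 \<le> - om x"
    proof (rule nonneg_deriv_ge_limit[where f="\<lambda>x. - om x" and b=1])
      show "((\<lambda>x. - om x) has_real_derivative - (- q * x powr (- 1 - q) * ze x)) (at x)" if "0 < x" "x < 1" for x
        by (rule DERIV_minus[OF om_d[OF that]])
      show "0 \<le> - (- q * x powr (- 1 - q) * ze x)" if "0 < x" "x < 1" for x
        using flux[OF that] q by simp
      have "(om \<longlongrightarrow> om 0) (at 0 within {0..1})" using om_c by (auto simp: continuous_on_def)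
      then have "(om \<longlongrightarrow> 1) (at_right 0)" by (simp add: at_within_Icc_at_right om_0)
      then show "((\<lambda>x. - om x) \<longlongrightarrow> - 1) (at_right 0)" by (rule tendsto_minus)
    qed (use x in auto)
    then show ?thesis by simp
  qed
  have ze_d': "(ze has_real_derivative q * X * x powr q * g (om x)) (at x)" if "0 < x" "x < 1" for x
    using ze_d[OF that] om_pos[OF that] om_le[OF that] by (simp add: cut_powr_eq)
  have om_W: "om x = W (X * x)" if "0 \<le> x" "x \<le> 1" for x
    by (rule profile_unique[OF X om_c om_0 _ _ flux_lim that]) (rule om_d ze_d'; assumption)+
  have WX: "W X = 1 / (1 + a)" using om_W[of 1] w1 by (simp add: om_def)
  have WX0: "W X > 0" using WX a by simp
  have wX: "w r = wX X r" if r: "0 \<le> r" "r \<le> 1" for r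
  proof (cases "r = 0")
    case True
    then show ?thesis using WX a by (simp add: wX_def a_def)
  next
    case False
    then have "rr (xi r) = r" "0 \<le> xi r" "xi r \<le> 1" using rr_xi[of r] xi_bounds[of r] r by auto
    then have "(1 + w r) / (1 + a) = W (X * xi r)" using om_W[of "xi r"] by (simp add: om_def)
    then have "W (X * xi r) / W X = 1 + w r" using a by (simp add: WX field_simps)
    then show ?thesis by (simp add: wX_def)
  qed
  have "v = uX X"
  proof
    fix x show "v x = uX X x"
      using vw[of x] wX[of "norm x"] out[of x] by (cases "norm x \<le> 1") (auto simp: uX_def)
  qed
  moreover have "l = lam X"
  proof -
    have "(1 + a) powr (p - 1) * W X powr (p - 1) = 1" using a by (simp add: WX powr_divide)
    then show ?thesis by (simp add: lam_def X_def mult.assoc)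
  qed
  ultimately show ?thesis using X WX0 by blast
qed

text \<open>The value at the origin alone does not affect an essential supremum; by continuity
  \<open>wX X\<close> exceeds any \<open>c < alpha X\<close> on a small disc, which has positive
  measure.\<close>

lemma Linf_norm_uX:
  assumes X: "X > 0" "W X > 0"
  shows "Linf_norm B1 (uX X) = ereal (alpha X)"
proof -
  obtain C where C: "radial_sol k p (lam X) C (wX X) (hX X) (uX X)" using wX_radial_sol[OF X] by blast
  then have m: "uX X \<in> borel_measurable D" by (rule radial_sol.u_measurable)
  have m': "(\<lambda>x. ereal \<bar>uX X x\<bar>) \<in> borel_measurable D" using m by simp
  have "esssup D (\<lambda>x. ereal \<bar>uX X x\<bar>) \<le> ereal (alpha X)"
  proof (rule esssup_I[OF m'])
    show "AE x in D. ereal \<bar>uX X x\<bar> \<le> ereal (alpha X)"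
      using AE_D
    proof eventually_elim
      case (elim x)
      then show ?case using wX_bounds[OF X, of "norm x"] by (simp add: uX_def)
    qed
  qed
  moreover have "ereal (alpha X) \<le> esssup D (\<lambda>x. ereal \<bar>uX X x\<bar>)"
  proof (rule ccontr)
    assume "\<not> ?thesis"
    then have lt: "esssup D (\<lambda>x. ereal \<bar>uX X x\<bar>) < ereal (alpha X)" by simp
    then obtain c where c: "esssup D (\<lambda>x. ereal \<bar>uX X x\<bar>) < ereal c" "c < alpha X"
      using ereal_dense2[OF lt] by auto
    have "continuous (at 0 within {0..1}) (wX X)"
      using wX_cont[OF X] by (simp add: continuous_on_eq_continuous_within)
    then have "(wX X \<longlongrightarrow> alpha X) (at_right 0)"
      using wX_0[OF X(2)] by (simp add: continuous_within at_within_Icc_at_right)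
    from order_tendstoD(1)[OF this c(2)] obtain \<delta> where \<delta>: "\<delta> > 0" "\<And>r. 0 < r \<Longrightarrow> r < \<delta> \<Longrightarrow> c < wX X r"
      by (auto simp: eventually_at_right_field)
    define S where "S = ball (0::plane) (min \<delta> 1)"
    have "AE x in D. x \<notin> S"
      using AE_D esssup_AE[of "\<lambda>x. ereal \<bar>uX X x\<bar>" D]
    proof eventually_elim
      case (elim x)
      then have "ereal \<bar>uX X x\<bar> < ereal c" using c(1) by (meson order_le_less_trans)
      then show ?case using \<delta>(2)[of "norm x"] elim by (auto simp: S_def uX_def)
    qed
    then have "AE x in lebesgue. x \<in> B1 \<longrightarrow> x \<notin> S" by (subst (asm) AE_restrict_space_iff) auto
    then have "AE x in lebesgue. x \<notin> S" by eventually_elim (auto simp: S_def)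
    then have "S \<in> null_sets lebesgue" by (subst AE_iff_null_sets) (auto simp: S_def)
    then have "negligible S" by (simp add: negligible_iff_null_sets)
    moreover have "\<not> negligible S" unfolding S_def using \<delta> by (intro open_not_negligible) auto
    ultimately show False by blast
  qed
  ultimately show ?thesis unfolding Linf_norm_def by (rule antisym)
qed

text \<open>The solutions have to be indexed by their maximum, so the parameter \<open>X\<close> is
  recovered from it; it is determined because \<open>W\<close> is strictly decreasing.\<close>

definition X_of :: "real \<Rightarrow> real" where "X_of a = (SOME X. X > 0 \<and> W X > 0 \<and> alpha X = a)"

lemma X_of_alpha: assumes "X > 0" "W X > 0" shows "X_of (alpha X) = X"
  unfolding X_of_def
proof (rule some_equality)
  fix Y assume Y: "Y > 0 \<and> W Y > 0 \<and> alpha Y = alpha X"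
  then have "W Y = W X" by (simp add: alpha_def)
  then show "Y = X" using W_strict_antimono[of X Y] W_strict_antimono[of Y X] Y assms by (cases X Y rule: linorder_cases) auto
qed (use assms in auto)

lemma solution_set:
  "radial_solutions k p = {(lam (b powr (p - 1)), uX (b powr (p - 1))) | b. b \<in> dom}"
proof (intro set_eqI iffI)
  fix z assume "z \<in> radial_solutions k p"
  then obtain X where X: "X > 0" "W X > 0" "z = (lam X, uX X)"
    using radial_solution_classification by (auto simp: radial_solutions_def)
  have b: "(X powr (1 / (p - 1))) powr (p - 1) = X" using X p by (simp add: powr_powr)
  then show "z \<in> {(lam (b powr (p - 1)), uX (b powr (p - 1))) | b. b \<in> dom}"
    using X by (intro CollectI exI[of _ "X powr (1 / (p - 1))"]) (simp add: dom_def)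
next
  fix z assume "z \<in> {(lam (b powr (p - 1)), uX (b powr (p - 1))) | b. b \<in> dom}"
  then show "z \<in> radial_solutions k p"
    using uX_radial_solution by (auto simp: radial_solutions_def dom_def)
qed

lemma uX_at_0: "W X > 0 \<Longrightarrow> uX X 0 = alpha X"
  by (simp add: uX_def wX_0)

lemma lam_root:
  assumes "b \<in> dom"
  shows "lam (b powr (p - 1)) powr (1 / (p - 1)) = b * W (b powr (p - 1))"
proof -
  have b: "b > 0" "W (b powr (p - 1)) > 0" using assms by (auto simp: dom_def)
  have e: "(p - 1) * (1 / (p - 1)) = 1" using p by simp
  show ?thesis unfolding lam_def using b
    by (simp only: powr_mult powr_ge_zero powr_powr e) simp
qed

lemma beta_of_solution:
  assumes "b \<in> dom"
  shows "lam (b powr (p - 1)) powr (1 / (p - 1)) * (alpha (b powr (p - 1)) + 1) = b"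
    and "alpha (b powr (p - 1)) = lam (b powr (p - 1)) powr (- (1 / (p - 1))) * b - 1"
proof -
  have b: "b > 0" "W (b powr (p - 1)) > 0" using assms by (auto simp: dom_def)
  show "lam (b powr (p - 1)) powr (1 / (p - 1)) * (alpha (b powr (p - 1)) + 1) = b"
    unfolding lam_root[OF assms] alpha_def using b by simp
  show "alpha (b powr (p - 1)) = lam (b powr (p - 1)) powr (- (1 / (p - 1))) * b - 1"
    unfolding powr_minus lam_root[OF assms] alpha_def using b by (simp add: field_simps)
qed

text \<open>\<open>lam\<close> is bounded along the curve, so it is \<open>alpha\<close> that must
  be unbounded: \<open>W\<close> takes arbitrarily small positive values.\<close>

lemma curve_unbounded: "\<not> bounded {(lam (b powr (p - 1)), alpha (b powr (p - 1))) | b. b \<in> dom}"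
proof
  assume "bounded {(lam (b powr (p - 1)), alpha (b powr (p - 1))) | b. b \<in> dom}"
  then obtain M where M: "M > 0" "\<And>b. b \<in> dom \<Longrightarrow> norm (lam (b powr (p - 1)), alpha (b powr (p - 1))) \<le> M"
    by (auto simp: bounded_pos)
  obtain X where X: "X > 0" "0 < W X" "W X < 1 / (M + 1)" using W_small[of "1 / (M + 1)"] M by auto
  have b: "(X powr (1 / (p - 1))) powr (p - 1) = X" using X p by (simp add: powr_powr)
  then have "norm (lam X, alpha X) \<le> M" using M(2)[of "X powr (1 / (p - 1))"] X by (simp add: dom_def)
  moreover have "alpha X \<le> norm (alpha X)" by simp
  moreover have "norm (alpha X) \<le> norm (lam X, alpha X)" by (rule norm_snd_le)
  moreover have "alpha X > M" using X M by (simp add: alpha_def field_simps)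
  ultimately show False by linarith
qed

lemma solution_weak:
  assumes "X > 0" "W X > 0"
  shows "uX X \<in> H10 B1" "weak_solution k p (lam X) (uX X)"
proof -
  obtain C where C: "radial_sol k p (lam X) C (wX X) (hX X) (uX X)" using wX_radial_sol[OF assms] by blast
  show "uX X \<in> H10 B1" unfolding H10_def using radial_sol.H10_g[OF C] by blast
  show "weak_solution k p (lam X) (uX X)" by (rule radial_sol.weak_sol[OF C])
qed

end

theorem theorem1p2:
  fixes k p :: real
  assumes "k > 0" and "p > p_s k"
  shows "\<exists>(\<beta>s :: ereal) (lam :: real \<Rightarrow> real) (\<alpha> :: real \<Rightarrow> real) (u :: real \<Rightarrow> plane \<Rightarrow> real).
    \<beta>s > 0 \<and>
    (let I = {\<beta> :: real. 0 < \<beta> \<and> ereal \<beta> < \<beta>s} in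
      radial_solutions k p = {(lam \<beta>, u (\<alpha> \<beta>)) | \<beta>. \<beta> \<in> I} \<and>
      (\<forall>\<beta>\<in>I. \<alpha> \<beta> = lam \<beta> powr (- (1 / (p - 1))) * \<beta> - 1 \<and>
              Linf_norm B1 (u (\<alpha> \<beta>)) = ereal (\<alpha> \<beta>) \<and>
              u (\<alpha> \<beta>) 0 = \<alpha> \<beta> \<and>
              {(l, v) \<in> radial_solutions k p. l powr (1 / (p - 1)) * (v 0 + 1) = \<beta>} =
                {(lam \<beta>, u (\<alpha> \<beta>))}) \<and>
      (\<forall>(l, v) \<in> radial_solutions k p. v \<in> H10 B1 \<and> weak_solution k p l v) \<and>
      real_analytic_on (\<lambda>\<beta>. (lam \<beta>, \<alpha> \<beta>)) I \<and>
      ((\<lambda>\<beta>. (lam \<beta>, \<alpha> \<beta>)) \<longlongrightarrow> (0, 0)) (at_right 0) \<and>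
      \<not> bounded {(lam \<beta>, \<alpha> \<beta>) | \<beta>. \<beta> \<in> I} \<and>
      (\<exists>lams > 0. \<forall>\<beta>\<in>I. lam \<beta> \<le> lams)) \<and>
    (p \<ge> p_c k \<longrightarrow> \<beta>s = \<infinity>) \<and>
    (p < p_c k \<longrightarrow> \<beta>s < \<infinity>)"
proof -
  have p: "p > 1" using assms by (simp add: p_s_def)
  interpret emden k p "1 / k" using assms p by unfold_locales auto
  obtain W Z where "emden_profile k p (1 / k) W Z"
  proof -
    obtain W Z where "continuous_on {0..} W \<and> continuous_on {0..} Z \<and> W 0 = 1 \<and> Z 0 = 0 \<and>
      (\<forall>x>0. (W has_real_derivative - (1 / k) * x powr (- 1 - 1 / k) * Z x) (at x)) \<and>
      (\<forall>x>0. (Z has_real_derivative (1 / k) * x powr (1 / k) * cut_powr p (W x)) (at x))"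
      using profile_exists by blast
    then have "emden_profile k p (1 / k) W Z" by unfold_locales auto
    then show ?thesis by (rule that)
  qed
  then interpret emden_profile k p "1 / k" W Z .
  obtain \<beta>s :: ereal where \<beta>s: "\<beta>s > 0" "{b. 0 < b \<and> ereal b < \<beta>s} = dom"
      "p \<ge> 2 * k + 1 \<longrightarrow> \<beta>s = \<infinity>" "p < 2 * k + 1 \<longrightarrow> \<beta>s < \<infinity>"
    using beta_star_exists by blast
  define \<Lambda> where "\<Lambda> = (\<lambda>b. lam (b powr (p - 1)))"
  define A where "A = (\<lambda>b. alpha (b powr (p - 1)))"
  define U where "U = (\<lambda>a. uX (X_of a))"
  have domD: "b powr (p - 1) > 0" "W (b powr (p - 1)) > 0" if "b \<in> dom" for b
    using that by (auto simp: dom_def)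
  have UA: "U (A b) = uX (b powr (p - 1))" if "b \<in> dom" for b
    unfolding U_def A_def by (simp add: X_of_alpha[OF domD[OF that]])
  have sols: "radial_solutions k p = {(\<Lambda> b, U (A b)) | b. b \<in> dom}"
    unfolding solution_set using UA by (fastforce simp: \<Lambda>_def)
  have solD: "\<exists>b\<in>dom. l = \<Lambda> b \<and> v = U (A b)" if "(l, v) \<in> radial_solutions k p" for l v
    using that unfolding sols by blast
  have U0: "U (A b) 0 = A b" if "b \<in> dom" for b
    using uX_at_0 domD[OF that] UA[OF that] by (simp add: A_def)
  have beta: "\<Lambda> b powr (1 / (p - 1)) * (U (A b) 0 + 1) = b" if "b \<in> dom" for b
    using beta_of_solution(1)[OF that] U0[OF that] by (simp add: \<Lambda>_def A_def)
  have uniq: "{(l, v) \<in> radial_solutions k p. l powr (1 / (p - 1)) * (v 0 + 1) = b} = {(\<Lambda> b, U (A b))}"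
    if b: "b \<in> dom" for b
  proof (intro set_eqI iffI)
    fix z assume "z \<in> {(l, v) \<in> radial_solutions k p. l powr (1 / (p - 1)) * (v 0 + 1) = b}"
    then obtain l v where z: "z = (l, v)" "(l, v) \<in> radial_solutions k p" "l powr (1 / (p - 1)) * (v 0 + 1) = b" by blast
    from solD[OF z(2)] obtain b' where "b' \<in> dom" "l = \<Lambda> b'" "v = U (A b')" by blast
    \<comment> \<open>The expression equals the parameter on every solution, which forces
      \<open>b' = b\<close>.\<close>
    then show "z \<in> {(\<Lambda> b, U (A b))}" using beta[of b'] z by simp
  next
    fix z assume "z \<in> {(\<Lambda> b, U (A b))}"
    then show "z \<in> {(l, v) \<in> radial_solutions k p. l powr (1 / (p - 1)) * (v 0 + 1) = b}"
      using b beta[OF b] unfolding sols by auto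
  qed
  obtain C where C: "C > 0" "\<And>X. X > 0 \<Longrightarrow> W X > 0 \<Longrightarrow> lam X \<le> C" using lam_bounded by blast
  have weak: "v \<in> H10 B1 \<and> weak_solution k p l v" if "(l, v) \<in> radial_solutions k p" for l v
    using solD[OF that] solution_weak domD UA by (auto simp: \<Lambda>_def)
  show ?thesis
    unfolding p_c_def Let_def
  proof (rule exI[of _ \<beta>s], rule exI[of _ \<Lambda>], rule exI[of _ A], rule exI[of _ U], intro conjI, unfold \<beta>s(2))
    show "radial_solutions k p = {(\<Lambda> b, U (A b)) | b. b \<in> dom}" by (rule sols)
    show "\<forall>b\<in>dom. A b = \<Lambda> b powr (- (1 / (p - 1))) * b - 1 \<and> Linf_norm B1 (U (A b)) = ereal (A b) \<and>
        U (A b) 0 = A b \<and>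
        {(l, v) \<in> radial_solutions k p. l powr (1 / (p - 1)) * (v 0 + 1) = b} = {(\<Lambda> b, U (A b))}"
    proof (intro ballI conjI)
      fix b assume b: "b \<in> dom"
      show "A b = \<Lambda> b powr (- (1 / (p - 1))) * b - 1"
        unfolding A_def \<Lambda>_def by (rule beta_of_solution(2)[OF b])
      show "Linf_norm B1 (U (A b)) = ereal (A b)"
        unfolding UA[OF b] unfolding A_def by (rule Linf_norm_uX[OF domD[OF b]])
    qed (rule U0 uniq, assumption)+
    show "\<forall>(l, v)\<in>radial_solutions k p. v \<in> H10 B1 \<and> weak_solution k p l v" using weak by blast
    show "real_analytic_on (\<lambda>b. (\<Lambda> b, A b)) dom" unfolding \<Lambda>_def A_def by (rule curve_analytic)
    show "((\<lambda>b. (\<Lambda> b, A b)) \<longlongrightarrow> (0, 0)) (at_right 0)" unfolding \<Lambda>_def A_def by (rule curve_lim)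
    show "\<not> bounded {(\<Lambda> b, A b) | b. b \<in> dom}" unfolding \<Lambda>_def A_def by (rule curve_unbounded)
    show "\<exists>lams>0. \<forall>b\<in>dom. \<Lambda> b \<le> lams"
      using C domD by (intro exI[of _ C]) (auto simp: \<Lambda>_def)
  qed (use \<beta>s in auto)
qed

end
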